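(* Let $\mathbf{k}$ be an algebraically closed field of characteristic $p > 0$, let $q = p^\nu$ with $\nu \geq 1$ an integer, and let $X \subset \mathbf{P}^{q+1}$ be the Fermat hypersurface over $\mathbf{k}$ defined by $T_0^{q+1} + \cdots + T_{q+1}^{q+1} = 0$. Let $\varphi \colon \mathbf{P}^1 \to X$ be a nonconstant morphism over $\mathbf{k}$ of degree $e = mq + r$, where $m, r \in \mathbf{Z}$ and $0 \leq r \leq q-1$. If $\varphi$ is free, then $$q + 1 \leq m^2 + m + r \quad \text{if } r > 0, \qquad\text{and}\qquad q \leq m^2 + m \quad \text{if } r = 0.$$
   Context: The degree of $\varphi$ is the degree of the line bundle $\varphi^*\mathcal{O}_{\mathbf{P}^{q+1}}(1)$ on $\mathbf{P}^1$. The morphism $\varphi$ is free if $\mathrm{H}^1(\mathbf{P}^1, \varphi^*\mathcal{T}_X \otimes \mathcal{O}_{\mathbf{P}^1}(-1)) = 0$, where $\mathcal{T}_X$ is the tangent bundle of $X$. *)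

theory Defs
  imports "HOL-Computational_Algebra.Computational_Algebra" "HOL-Library.Function_Algebras"
begin

text \<open>
  Classical projective geometry over an algebraically closed field, where varieties are described
  by their closed points. A point of projective \<open>n\<close>-space is a line through the origin
  without the origin, as a set of coordinate vectors (supported on the indices \<open>0, ..., n\<close>).
  For a set \<open>U\<close> of points, \<open>\<Union>U\<close> is the punctured cone over \<open>U\<close>.
\<close>

type_synonym 'k vec = "nat \<Rightarrow> 'k"
type_synonym 'k point = "'k vec set"

definition line :: "'k::field vec \<Rightarrow> 'k point" where
  "line x = {\<lambda>i. c * x i | c. c \<noteq> 0}"

definition proj_space :: "nat \<Rightarrow> 'k::field point set" where
  "proj_space n = {line x | x. (\<exists>i. x i \<noteq> 0) \<and> (\<forall>i>n. x i = 0)}"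

text \<open>
  Homogeneous polynomials of degree \<open>d\<close> in \<open>T\<^sub>0, ..., T\<^sub>n\<close>, as functions; over an
  infinite field (such as an algebraically closed one) nothing is lost by this.
\<close>

inductive form :: "nat \<Rightarrow> nat \<Rightarrow> ('k::field vec \<Rightarrow> 'k) \<Rightarrow> bool" for n where
  form_const: "form n 0 (\<lambda>x. c)"
| form_var: "i \<le> n \<Longrightarrow> form n 1 (\<lambda>x. x i)"
| form_add: "form n d P \<Longrightarrow> form n d Q \<Longrightarrow> form n d (\<lambda>x. P x + Q x)"
| form_mult: "form n a P \<Longrightarrow> form n b Q \<Longrightarrow> form n (a + b) (\<lambda>x. P x * Q x)"

definition zariski_open :: "nat \<Rightarrow> 'k::field point set \<Rightarrow> bool" where
  "zariski_open n U \<longleftrightarrow>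
     (\<exists>S. (\<forall>P\<in>S. \<exists>d. form n d P) \<and>
          U = {x \<in> proj_space n. \<exists>P\<in>S. \<exists>v\<in>x. P v \<noteq> 0})"

text \<open>
  \<open>twist n d U\<close> is the set of sections over \<open>U\<close> of the sheaf \<open>O(d)\<close> on projective
  \<open>n\<close>-space, as functions on the cone over \<open>U\<close> which are homogeneous of degree \<open>d\<close> and
  locally quotients of forms. Only values on \<open>\<Union>U\<close> matter. For \<open>d = 0\<close> these are the regular
  functions on \<open>U\<close>.
\<close>

definition twist :: "nat \<Rightarrow> int \<Rightarrow> 'k::field point set \<Rightarrow> ('k vec \<Rightarrow> 'k) set" where
  "twist n d U = {s. \<forall>x\<in>U. \<exists>W a b G H.
      zariski_open n W \<and> x \<in> W \<and> W \<subseteq> U \<and>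
      form n a G \<and> form n b H \<and> int a - int b = d \<and>
      (\<forall>v\<in>\<Union>W. H v \<noteq> 0 \<and> s v = G v / H v)}"

abbreviation regular :: "nat \<Rightarrow> 'k::field point set \<Rightarrow> ('k vec \<Rightarrow> 'k) set" where
  "regular n U \<equiv> twist n 0 U"

definition preimage :: "nat \<Rightarrow> ('k::field point \<Rightarrow> 'k point) \<Rightarrow> 'k point set \<Rightarrow> 'k point set" where
  "preimage m \<phi> V = {y \<in> proj_space m. \<phi> y \<in> V}"

text \<open>
  Morphisms from projective \<open>m\<close>-space to projective \<open>n\<close>-space: continuous maps that pull regular
  functions back to regular functions (\<open>h\<close> below is the function \<open>g \<circ> \<phi>\<close>).
\<close>

definition proj_morphism :: "nat \<Rightarrow> nat \<Rightarrow> ('k::field point \<Rightarrow> 'k point) \<Rightarrow> bool" where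
  "proj_morphism m n \<phi> \<longleftrightarrow>
     (\<forall>y\<in>proj_space m. \<phi> y \<in> proj_space n) \<and>
     (\<forall>V. zariski_open n V \<longrightarrow>
        zariski_open m (preimage m \<phi> V) \<and>
        (\<forall>g\<in>regular n V. \<exists>h\<in>regular m (preimage m \<phi> V).
           \<forall>u\<in>\<Union>(preimage m \<phi> V). \<forall>v\<in>\<phi> (line u). h u = g v))"

definition hypersurface :: "nat \<Rightarrow> ('k::field vec \<Rightarrow> 'k) \<Rightarrow> 'k point set" where
  "hypersurface n F = {x \<in> proj_space n. \<forall>v\<in>x. F v = 0}"

text \<open>
  Since projective space is reduced, a morphism to a closed subvariety \<open>X\<close> is a
  morphism to the ambient space with image in \<open>X\<close>.
\<close>

definition morphism_to_hypersurface ::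
  "nat \<Rightarrow> nat \<Rightarrow> ('k::field vec \<Rightarrow> 'k) \<Rightarrow> ('k point \<Rightarrow> 'k point) \<Rightarrow> bool" where
  "morphism_to_hypersurface m n F \<phi> \<longleftrightarrow>
     proj_morphism m n \<phi> \<and> (\<forall>y\<in>proj_space m. \<phi> y \<in> hypersurface n F)"

text \<open>
  Sections over \<open>W\<close> of the line bundle \<open>\<phi>\<^sup>*O(a) \<otimes> O(b)\<close>. The fibre of \<open>O(a)\<close> at a point
  consists of the functions on the corresponding line that are homogeneous of degree \<open>a\<close>; hence a
  section is a function of \<open>u\<close> in the cone over \<open>W\<close> and of \<open>v\<close> on the line \<open>\<phi> (line u)\<close>. As
  \<open>O(a)\<close> is locally generated by one section, every section is locally a pure tensor.
\<close>

definition pullback_twist ::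
  "nat \<Rightarrow> nat \<Rightarrow> ('k::field point \<Rightarrow> 'k point) \<Rightarrow> int \<Rightarrow> int \<Rightarrow> 'k point set
     \<Rightarrow> ('k vec \<Rightarrow> 'k vec \<Rightarrow> 'k) set" where
  "pullback_twist m n \<phi> a b W = {s. \<forall>y\<in>W. \<exists>W' V t f.
      zariski_open m W' \<and> y \<in> W' \<and> W' \<subseteq> W \<and> zariski_open n V \<and> W' \<subseteq> preimage m \<phi> V \<and>
      t \<in> twist n a V \<and> f \<in> twist m b W' \<and>
      (\<forall>u\<in>\<Union>W'. \<forall>v\<in>\<phi> (line u). s u v = f u * t v)}"

text \<open>
  A line bundle on the projective line has degree \<open>e\<close> iff it is isomorphic to \<open>O(e)\<close>. An
  isomorphism from \<open>O(e)\<close> to \<open>\<phi>\<^sup>*O(1)\<close> is a nowhere vanishing global section of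
  \<open>Hom(O(e), \<phi>\<^sup>*O(1)) = \<phi>\<^sup>*O(1) \<otimes> O(-e)\<close>.
\<close>

definition has_degree :: "nat \<Rightarrow> ('k::field point \<Rightarrow> 'k point) \<Rightarrow> int \<Rightarrow> bool" where
  "has_degree n \<phi> e \<longleftrightarrow>
     (\<exists>s\<in>pullback_twist 1 n \<phi> 1 (- e) (proj_space 1).
        \<forall>u\<in>\<Union>(proj_space 1). \<forall>v\<in>\<phi> (line u). s u v \<noteq> 0)"

text \<open>
  The stalk at \<open>x\<close> of the structure sheaf of projective space (germs are represented by
  functions), and the stalk of the ideal sheaf \<open>F \<cdot> O(-d)\<close> of the hypersurface defined by a form
  \<open>F\<close> of degree \<open>d\<close>.
\<close>

definition stalk :: "nat \<Rightarrow> 'k::field point \<Rightarrow> ('k vec \<Rightarrow> 'k) set" where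
  "stalk n x = {g. \<exists>W. zariski_open n W \<and> x \<in> W \<and> g \<in> regular n W}"

definition ideal_stalk ::
  "nat \<Rightarrow> nat \<Rightarrow> ('k::field vec \<Rightarrow> 'k) \<Rightarrow> 'k point \<Rightarrow> ('k vec \<Rightarrow> 'k) set" where
  "ideal_stalk n d F x = {g. \<exists>W. zariski_open n W \<and> x \<in> W \<and>
      (\<exists>s\<in>twist n (- int d) W. \<forall>v\<in>\<Union>W. g v = F v * s v)}"

text \<open>
  The tangent space at \<open>x\<close> of the hypersurface defined by a form \<open>F\<close> of degree \<open>d\<close>: the
  \<open>k\<close>-linear derivations from the local ring of the hypersurface at \<open>x\<close> to the residue field
  \<open>k\<close>. The last condition is a normalisation: values outside the stalk carry no information.
\<close>

definition tangent_space ::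
  "nat \<Rightarrow> nat \<Rightarrow> ('k::field vec \<Rightarrow> 'k) \<Rightarrow> 'k point \<Rightarrow> (('k vec \<Rightarrow> 'k) \<Rightarrow> 'k) set" where
  "tangent_space n d F x = {D.
      (\<forall>g\<in>stalk n x. \<forall>h\<in>stalk n x.
         D (\<lambda>v. g v + h v) = D g + D h \<and>
         (\<forall>v\<in>x. D (\<lambda>v. g v * h v) = g v * D h + h v * D g)) \<and>
      (\<forall>c. D (\<lambda>v. c) = 0) \<and>
      (\<forall>g\<in>stalk n x. \<forall>h\<in>stalk n x.
         (\<exists>W. zariski_open n W \<and> x \<in> W \<and> (\<forall>v\<in>\<Union>W. g v = h v)) \<longrightarrow> D g = D h) \<and>
      (\<forall>g\<in>ideal_stalk n d F x. D g = 0) \<and>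
      (\<forall>g. g \<notin> stalk n x \<longrightarrow> D g = 0)}"

text \<open>
  Sections over \<open>W\<close> of \<open>\<phi>\<^sup>*T\<^sub>X \<otimes> O(b)\<close>, where \<open>X\<close> is the hypersurface defined by \<open>F\<close> (smooth,
  so that its tangent spaces form a vector bundle): assignments of tangent vectors \<open>s u\<close> of \<open>X\<close>
  at \<open>\<phi> (line u)\<close>, homogeneous of degree \<open>b\<close> in \<open>u\<close>, whose derivatives of regular functions
  are regular.
\<close>

definition pullback_tangent ::
  "nat \<Rightarrow> nat \<Rightarrow> nat \<Rightarrow> ('k::field vec \<Rightarrow> 'k) \<Rightarrow> ('k point \<Rightarrow> 'k point) \<Rightarrow> int \<Rightarrow> 'k point set
     \<Rightarrow> ('k vec \<Rightarrow> ('k vec \<Rightarrow> 'k) \<Rightarrow> 'k) set" where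
  "pullback_tangent m n d F \<phi> b W = {s.
      (\<forall>u\<in>\<Union>W. s u \<in> tangent_space n d F (\<phi> (line u))) \<and>
      (\<forall>V g. zariski_open n V \<and> g \<in> regular n V \<longrightarrow>
         (\<lambda>u. s u g) \<in> twist m b (W \<inter> preimage m \<phi> V))}"

text \<open>
  Vanishing of the first cohomology of a sheaf \<open>\<F>\<close> on projective \<open>n\<close>-space whose sections over
  \<open>U\<close> are functions on \<open>\<Union>U\<close>: every Cech 1-cocycle for every open cover is a
  coboundary. This is vanishing of sheaf cohomology, since in degree one the latter is
  the direct limit of the Cech cohomology groups over all covers, with injective transition maps.
\<close>

definition H1_vanishes ::
  "nat \<Rightarrow> ('k::field point set \<Rightarrow> ('k vec \<Rightarrow> 'v::ab_group_add) set) \<Rightarrow> bool" where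
  "H1_vanishes n \<F> \<longleftrightarrow>
     (\<forall>\<U> c.
        (\<forall>U\<in>\<U>. zariski_open n U) \<and> \<Union>\<U> = proj_space n \<and>
        (\<forall>U\<in>\<U>. \<forall>V\<in>\<U>. c U V \<in> \<F> (U \<inter> V)) \<and>
        (\<forall>U\<in>\<U>. \<forall>V\<in>\<U>. \<forall>W\<in>\<U>. \<forall>u\<in>\<Union>(U \<inter> V \<inter> W). c U V u + c V W u = c U W u)
      \<longrightarrow>
        (\<exists>b. (\<forall>U\<in>\<U>. b U \<in> \<F> U) \<and>
             (\<forall>U\<in>\<U>. \<forall>V\<in>\<U>. \<forall>u\<in>\<Union>(U \<inter> V). c U V u = b V u - b U u)))"

definition free_morphism ::
  "nat \<Rightarrow> nat \<Rightarrow> ('k::field vec \<Rightarrow> 'k) \<Rightarrow> ('k point \<Rightarrow> 'k point) \<Rightarrow> bool" where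
  "free_morphism n d F \<phi> \<longleftrightarrow> H1_vanishes 1 (pullback_tangent 1 n d F \<phi> (- 1))"

definition fermat_form :: "nat \<Rightarrow> 'k::field vec \<Rightarrow> 'k" where
  "fermat_form q T = (\<Sum>i\<le>q + 1. T i ^ (q + 1))"

lemma form_power: "form n d P \<Longrightarrow> form n (k * d) (\<lambda>x. P x ^ k)"
  by (induction k) (auto intro: form_const[of n 1] form_mult)

lemma form_zero: "form n d (\<lambda>x. 0)"
  using form_mult[OF form_const[of n 0] form_power[OF form_var[of 0 n], of d]] by simp

lemma form_sum:
  assumes "finite I" "\<And>i. i \<in> I \<Longrightarrow> form n d (P i)"
  shows "form n d (\<lambda>x. \<Sum>i\<in>I. P i x)"
  using assms by (induction I rule: finite_induct) (auto intro: form_zero form_add)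

lemma form_fermat: "form (q + 1) (q + 1) (fermat_form q)"
proof -
  have "form (q + 1) (q + 1) (\<lambda>x. x i ^ (q + 1))" if "i \<le> q + 1" for i
    using form_power[OF form_var[OF that], of "q + 1"] by simp
  then show ?thesis
    unfolding fermat_form_def by (intro form_sum) auto
qed

end

theory Submission
  imports Defs
begin

text \<open>
  Write \<open>\<phi>\<close> as \<open>(f\<^sub>0 : \<dots> : f\<^sub>n)\<close>, \<open>n = q + 1\<close>, with binary forms \<open>f\<^sub>i\<close> of degree \<open>e\<close>. Since the differential
  of the Fermat form is \<open>v \<mapsto> \<Sum> f\<^sub>i\<^sup>q v\<^sub>i\<close>, the Euler sequence turns freeness into the statement that the
  \<open>f\<^sub>i\<^sup>q\<close> generate all forms of degree \<open>q e + e - 1\<close>. Comparing coordinates over the subring of \<open>q\<close>-th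
  powers, the \<open>f\<^sub>i\<close> themselves generate all forms of degree \<open>e + m - 1\<close>, so that the space of syzygies
  \<open>\<Sum> f\<^sub>i B\<^sub>i = 0\<close> with \<open>deg B\<^sub>i = m - 1\<close> has dimension \<open>(q + 2) m - (e + m) = m - r\<close>.

  The equation \<open>\<Sum> f\<^sub>i\<^sup>q f\<^sub>i = 0\<close> says that all coordinates of \<open>(f\<^sub>i)\<close> over the subring of \<open>q\<close>-th powers are
  syzygies. There are \<open>r + 1\<close> coordinates of degree \<open>m\<close>, and the others have degree \<open>m - 1\<close>. Therefore
  the \<open>f\<^sub>i\<close> span a space of dimension at most \<open>(r + 1) (m + 1) + (m - r) m = m\<^sup>2 + m + r + 1\<close>. On the other
  hand, \<open>l\<close> independent linear relations between the \<open>f\<^sub>i\<close> yield \<open>l m\<close> independent syzygies of degree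
  \<open>m - 1\<close>, so \<open>l m \<le> m - r\<close>; that is, \<open>l = 0\<close>, or \<open>l = 1\<close> and \<open>r = 0\<close>.
\<close>

text \<open>Let K be the kernel of the differential from O(e - 1)^(q + 2) to O(q e + e - 1). It
  contains O(- 1), embedded by the coordinates, and the quotient is the pulled back tangent bundle
  of X twisted by O(- 1). All cohomology of O(- 1) vanishes, so freeness says H^1(K) = 0, and this
  is the surjectivity on global forms. The connecting map is made explicit: a form is solved for on
  each of the two charts, the difference of the solutions is a cocycle of tangent vectors, and the
  cochain supplied by freeness is lifted back. The obstacle is that lifts are determined only up to
  multiples of the coordinate vector. A Bezout identity fixes them on each chart, and splitting a
  Laurent polynomial, that is H^1(O(- 1)) = 0, removes the discrepancy between the charts. If there
  are l independent linear relations, the span has dimension q + 2 - l. The bound q + 2 - l \<le>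
  m^2 + m + r + 1 is the claim for l = 0; the possible relation when r = 0 accounts for the weaker
  second inequality.\<close>

declare sum.atMost_Suc [simp del]

section \<open>Polynomials over the subring of q-th powers\<close>

text \<open>The product \<open>h * p\<close> vanishes everywhere. If it were nonzero, it would be
  nonconstant, and at a root of \<open>h * p + 1\<close> it would take the value
  \<open>- 1\<close>.\<close>

lemma poly_eq_0_of_dense:
  fixes p h :: "'k::alg_closed_field poly"
  assumes "h \<noteq> 0" and "\<And>x. poly h x \<noteq> 0 \<Longrightarrow> poly p x = 0"
  shows "p = 0"
proof (rule ccontr)
  assume "p \<noteq> 0"
  have z: "poly (h * p) x = 0" for x using assms(2)[of x] by auto
  have nz: "h * p \<noteq> 0" using assms(1) \<open>p \<noteq> 0\<close> by simp
  have "degree (h * p) > 0"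
  proof (rule ccontr)
    assume "\<not> degree (h * p) > 0"
    then obtain c where "h * p = [:c:]" using degree_eq_zeroE by blast
    then show False using z[of 0] nz by simp
  qed
  then have "degree (h * p + 1) > 0"
    by (metis add.commute degree_1 degree_add_eq_right)
  then obtain x where "poly (h * p + 1) x = 0" using alg_closed_imp_poly_has_root by blast
  then have "poly (h * p) x + 1 = 0" by (simp only: poly_add poly_1)
  then show False unfolding z by simp
qed

lemma poly_eq_of_dense:
  fixes p p' h :: "'k::alg_closed_field poly"
  assumes "h \<noteq> 0" and "\<And>x. poly h x \<noteq> 0 \<Longrightarrow> poly p x = poly p' x"
  shows "p = p'"
  using poly_eq_0_of_dense[of h "p - p'"] assms by simp

text \<open>Gaussian elimination, one equation at a time. The dimension counts below come down to
  this statement.\<close>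

lemma homogeneous_system_solution:
  fixes A :: "'i \<Rightarrow> 'j \<Rightarrow> 'k::field"
  assumes "finite I" "finite J" "card I < card J"
  shows "\<exists>x. (\<exists>j\<in>J. x j \<noteq> 0) \<and> (\<forall>i\<in>I. (\<Sum>j\<in>J. A i j * x j) = 0)"
  using assms
proof (induction I arbitrary: J A rule: finite_induct)
  case empty
  then have "J \<noteq> {}" by auto
  then show ?case by (intro exI[of _ "\<lambda>_. 1"]) auto
next
  case (insert i I)
  show ?case
  proof (cases "\<forall>j\<in>J. A i j = 0")
    case True
    have "card I < card J" using insert by simp
    from insert.IH[OF insert.prems(1) this, of A] obtain x where
      "\<exists>j\<in>J. x j \<noteq> 0" "\<forall>i\<in>I. (\<Sum>j\<in>J. A i j * x j) = 0" by blast
    then show ?thesis using True by (intro exI[of _ x]) auto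
  next
    case False
    then obtain j0 where j0: "j0 \<in> J" "A i j0 \<noteq> 0" by blast
    define J' where "J' = J - {j0}"
    have J': "finite J'" "j0 \<notin> J'" "J = insert j0 J'" using j0 insert.prems by (auto simp: J'_def)
    then have "card I < card J'" using insert by simp
    \<comment> \<open>The pivot equation \<open>i\<close> is solved for the unknown
      \<open>j0\<close> and substituted into the others.\<close>
    from insert.IH[OF J'(1) this, of "\<lambda>i' j. A i' j - A i' j0 * A i j / A i j0"] obtain x where
      x: "\<exists>j\<in>J'. x j \<noteq> 0" "\<forall>i'\<in>I. (\<Sum>j\<in>J'. (A i' j - A i' j0 * A i j / A i j0) * x j) = 0"
      by blast
    define s where "s = (\<Sum>j\<in>J'. A i j * x j)"
    define y where "y = x(j0 := - s / A i j0)"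
    have sum: "(\<Sum>j\<in>J. A i' j * y j) = A i' j0 * (- s / A i j0) + (\<Sum>j\<in>J'. A i' j * x j)" for i'
    proof -
      have "(\<Sum>j\<in>J'. A i' j * y j) = (\<Sum>j\<in>J'. A i' j * x j)"
        using J' by (intro sum.cong) (auto simp: y_def)
      then show ?thesis using J' by (simp add: y_def)
    qed
    have "(\<Sum>j\<in>J. A i' j * y j) = 0" if "i' \<in> I" for i'
    proof -
      have "0 = (\<Sum>j\<in>J'. A i' j * x j - A i' j0 / A i j0 * (A i j * x j))"
        using x(2) that by (simp add: left_diff_distrib mult.assoc)
      also have "\<dots> = (\<Sum>j\<in>J'. A i' j * x j) - A i' j0 / A i j0 * s"
        by (simp add: sum_subtractf sum_distrib_left s_def)
      finally show ?thesis unfolding sum by simp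
    qed
    moreover have "(\<Sum>j\<in>J. A i j * y j) = 0" unfolding sum using j0 by (simp add: s_def)
    moreover have "\<exists>j\<in>J. y j \<noteq> 0" using x(1) J' by (auto simp: y_def)
    ultimately show ?thesis by blast
  qed
qed

lemma smult_sum_right: "smult c (\<Sum>i\<in>I. f i) = (\<Sum>i\<in>I. smult c (f i))"
  by (induction I rule: infinite_finite_induct) (auto simp: smult_add_right)

text \<open>A choice among the roots of \<open>y ^ q = x\<close>. Once \<open>q\<close> is a power
  of the characteristic the root is unique, and the choice becomes additive and
  multiplicative.\<close>

definition qroot :: "nat \<Rightarrow> 'k::alg_closed_field \<Rightarrow> 'k" where
  "qroot q x = (SOME y. y ^ q = x)"

lemma qroot_power: "q > 0 \<Longrightarrow> qroot q x ^ q = x"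
  unfolding qroot_def using nth_root_exists[of q x] by (rule someI_ex)

text \<open>The coordinates of a polynomial with respect to the basis \<open>1, t, \<dots>, t\<^sup>q\<^sup>-\<^sup>1\<close> of \<open>k[t]\<close>
  over its subring of \<open>q\<close>-th powers.\<close>

definition frob_coord :: "nat \<Rightarrow> nat \<Rightarrow> 'k::alg_closed_field poly \<Rightarrow> 'k poly" where
  "frob_coord q c P = Abs_poly (\<lambda>k. qroot q (coeff P (k * q + c)))"

text \<open>The parameter \<open>ty\<close> ties the locale to the field type, which
  \<open>q\<close> and \<open>\<nu>\<close> do not mention.\<close>

locale frobenius =
  fixes q \<nu> :: nat and ty :: "'k::alg_closed_field itself"
  assumes prime_char: "prime CHAR('k)" and q_eq: "q = CHAR('k) ^ \<nu>" and nu_pos: "\<nu> \<ge> 1"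
begin

lemma q_gt_1: "q > 1"
  unfolding q_eq using nu_pos prime_gt_1_nat[OF prime_char] by (intro one_less_power) auto

lemma add_power_q: "((x::'k) + y) ^ q = x ^ q + y ^ q"
  using freshmans_dream'[OF prime_char q_eq] .

lemma add_power_q_poly: "((x::'k poly) + y) ^ q = x ^ q + y ^ q"
  using freshmans_dream'[where 'a="'k poly"] prime_char q_eq by simp

lemma of_nat_q: "of_nat q = (0::'k)"
  using q_eq nu_pos by (simp add: of_nat_eq_0_iff_char_dvd dvd_power)

text \<open>Additivity of the q-th power gives \<open>(x - y) ^ q = 0\<close>.\<close>

lemma power_q_inj: "(x::'k) ^ q = y ^ q \<Longrightarrow> x = y"
proof -
  assume "x ^ q = y ^ q"
  moreover have "x ^ q = (x - y) ^ q + y ^ q" using add_power_q[of "x - y" y] by simp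
  ultimately show ?thesis by simp
qed

lemma qroot_eqI: "(y::'k) ^ q = x \<Longrightarrow> qroot q x = y"
  using qroot_power[of q x] q_gt_1 by (auto intro: power_q_inj)

lemma qroot_0 [simp]: "qroot q (0::'k) = 0"
  using q_gt_1 by (intro qroot_eqI) (simp add: power_0_left)

lemma qroot_1 [simp]: "qroot q (1::'k) = 1"
  by (intro qroot_eqI) simp

lemma qroot_add: "qroot q ((x::'k) + y) = qroot q x + qroot q y"
  using q_gt_1 by (intro qroot_eqI) (simp add: add_power_q qroot_power)

lemma qroot_mult: "qroot q ((x::'k) * y) = qroot q x * qroot q y"
  using q_gt_1 by (intro qroot_eqI) (simp add: power_mult_distrib qroot_power)

lemma coeff_frob_coord: "coeff (frob_coord q c (P::'k poly)) k = qroot q (coeff P (k * q + c))"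
proof -
  \<comment> \<open>\<open>Abs_poly\<close> returns the given coefficients only if almost all of
    them vanish.\<close>
  have "\<forall>\<^sub>\<infinity>k. qroot q (coeff P (k * q + c)) = 0"
  proof (subst MOST_nat, intro exI[of _ "degree P"] allI impI)
    fix k assume "degree P < k"
    then have "degree P < k * q + c" using q_gt_1
      by (metis One_nat_def less_le_trans mult.right_neutral mult_le_mono2 nat_less_le trans_le_add1)
    then show "qroot q (coeff P (k * q + c)) = 0" by (simp add: coeff_eq_0)
  qed
  then show ?thesis by (simp add: frob_coord_def Abs_poly_inverse)
qed

lemma frob_coord_0 [simp]: "frob_coord q c (0::'k poly) = 0"
  by (rule poly_eqI) (simp add: coeff_frob_coord)

lemma frob_coord_add: "frob_coord q c ((P::'k poly) + Q) = frob_coord q c P + frob_coord q c Q"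
  by (rule poly_eqI) (simp add: coeff_frob_coord qroot_add)

lemma frob_coord_sum: "frob_coord q c (\<Sum>i\<in>I. (P i::'k poly)) = (\<Sum>i\<in>I. frob_coord q c (P i))"
  by (induction I rule: infinite_finite_induct) (auto simp: frob_coord_add)

text \<open>A q-th power acts on a coordinate through its root: the coordinates are linear over the
  subring of q-th powers, which Frobenius identifies with the polynomial ring (up to roots of the
  constants). By additivity of the q-th power it suffices to treat constants and
  \<open>t\<close>.\<close>

lemma frob_coord_power_mult:
  assumes "c < q"
  shows "frob_coord q c ((P::'k poly) ^ q * Q) = P * frob_coord q c Q"
proof (induction P)
  case 0
  then show ?case using q_gt_1 by (simp add: power_0_left)
next
  case (pCons a P)
  have 1: "pCons a P = [:a:] + monom 1 1 * P"
    by (simp add: monom_altdef)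
  have 2: "(pCons a P) ^ q = [:a ^ q:] + monom 1 q * P ^ q"
    unfolding 1 add_power_q_poly power_mult_distrib by (simp add: monom_power poly_const_pow)
  have 3: "frob_coord q c ([:a ^ q:] * R) = [:a:] * frob_coord q c R" for R
    by (rule poly_eqI) (simp add: coeff_frob_coord qroot_mult qroot_eqI)
  \<comment> \<open>Multiplication by \<open>t ^ q\<close> moves the coefficient at
    \<open>k * q + c\<close> to the next \<open>k\<close>; nothing arrives at \<open>k = 0\<close>
    because \<open>c < q\<close>.\<close>
  have 4: "frob_coord q c (monom 1 q * R) = monom 1 1 * frob_coord q c R" for R :: "'k poly"
  proof (rule poly_eqI)
    fix k show "coeff (frob_coord q c (monom 1 q * R)) k = coeff (monom 1 1 * frob_coord q c R) k"
      using assms by (cases k) (auto simp: coeff_frob_coord coeff_monom_mult)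
  qed
  have "frob_coord q c ((pCons a P) ^ q * Q)
      = frob_coord q c ([:a ^ q:] * Q) + frob_coord q c (monom 1 q * (P ^ q * Q))"
    unfolding 2 by (simp only: distrib_right frob_coord_add mult.assoc)
  also have "\<dots> = [:a:] * frob_coord q c Q + monom 1 1 * (P * frob_coord q c Q)"
    unfolding 3 4 pCons.IH ..
  also have "\<dots> = pCons a P * frob_coord q c Q" unfolding 1 by (simp only: distrib_right mult.assoc)
  finally show ?case .
qed

text \<open>Every exponent is of the form \<open>k * q + c\<close> with \<open>c < q\<close>, so the
  coordinates together contain all coefficients.\<close>

lemma frob_coord_eq_0D:
  assumes "\<And>c. c < q \<Longrightarrow> frob_coord q c (P::'k poly) = 0"
  shows "P = 0"
proof (rule poly_eqI)
  fix k
  have "qroot q (coeff P k) = coeff (frob_coord q (k mod q) P) (k div q)"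
    by (simp add: coeff_frob_coord)
  also have "\<dots> = 0" using assms[of "k mod q"] q_gt_1 by simp
  finally have "qroot q (coeff P k) ^ q = 0" using q_gt_1 by simp
  then show "coeff P k = coeff 0 k" using q_gt_1 by (simp add: qroot_power)
qed

lemma frob_coord_monom: "c < q \<Longrightarrow> frob_coord q c (monom (1::'k) c) = 1"
proof (rule poly_eqI)
  fix k assume "c < q"
  then show "coeff (frob_coord q c (monom (1::'k) c)) k = coeff 1 k"
    using q_gt_1 by (cases k) (auto simp: coeff_frob_coord)
qed

end

section \<open>Syzygies of the coordinates of a free curve\<close>

text \<open>\<open>F\<close> are the coordinates of the curve on a chart, and forms of degree \<open>d\<close> become polynomials
  of degree at most \<open>d\<close>.\<close>

locale fermat_curve = frobenius q \<nu> ty for q \<nu> :: nat and ty :: "'k::alg_closed_field itself" +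
  fixes F :: "nat \<Rightarrow> 'k poly" and e m r :: nat
  assumes e_eq: "e = m * q + r" and r_less: "r < q" and e_pos: "e > 0"
    and deg_F: "\<And>i k. i \<le> q + 1 \<Longrightarrow> k > e \<Longrightarrow> coeff (F i) k = 0"
    and fermat: "(\<Sum>i\<le>q+1. F i ^ (q + 1)) = 0"
    and surj: "\<And>h. degree h \<le> q * e + e - 1 \<Longrightarrow>
      \<exists>v. (\<forall>i\<le>q+1. \<forall>k\<ge>e. coeff (v i) k = 0) \<and> (\<Sum>i\<le>q+1. F i ^ q * v i) = h"
begin

text \<open>Vanishing coefficients, instead of a bound on \<open>degree\<close>, make the degree
  bound \<open>m - 1\<close> mean \<open>B i = 0\<close> when \<open>m = 0\<close>.\<close>

definition syz :: "(nat \<Rightarrow> 'k poly) \<Rightarrow> bool" where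
  "syz B \<longleftrightarrow> (\<forall>i\<le>q+1. \<forall>k\<ge>m. coeff (B i) k = 0) \<and> (\<Sum>i\<le>q+1. F i * B i) = 0"

text \<open>Linear independence over the field of tuples of polynomials. It is stated for indexed
  families, so that a repeated member counts as a dependency.\<close>

definition indep :: "'j set \<Rightarrow> ('j \<Rightarrow> nat \<Rightarrow> 'k poly) \<Rightarrow> bool" where
  "indep J b \<longleftrightarrow> (\<forall>x. (\<forall>i\<le>q+1. (\<Sum>j\<in>J. smult (x j) (b j i)) = 0) \<longrightarrow> (\<forall>j\<in>J. x j = 0))"

text \<open>The coordinate \<open>q - 1\<close> of a solution of
  \<open>\<Sum> F i ^ q * v i = H ^ q * t ^ (q - 1)\<close> solves the equation for
  \<open>H\<close>. At this coordinate the degree bound \<open>e - 1\<close> of the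
  \<open>v i\<close> becomes \<open>m - 1\<close> whatever \<open>r\<close> is.\<close>

lemma surj_low:
  assumes "degree H < e + m"
  shows "\<exists>B. (\<forall>i\<le>q+1. \<forall>k\<ge>m. coeff (B i) k = 0) \<and> (\<Sum>i\<le>q+1. F i * B i) = H"
proof -
  have "degree (H ^ q * monom 1 (q - 1)) \<le> degree (H ^ q) + (q - 1)"
    by (rule order.trans[OF degree_mult_le]) (simp add: degree_monom_eq)
  also have "\<dots> \<le> q * (e + m - 1) + (q - 1)"
    using degree_power_le[of H q] assms
    by (intro add_mono order.trans[OF degree_power_le]) (auto simp: mult.commute intro: mult_le_mono)
  \<comment> \<open>The left side is \<open>q * e + q * m - 1\<close>, so this is
    \<open>q * m \<le> e\<close>.\<close>
  also have "\<dots> \<le> q * e + e - 1"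
  proof -
    obtain d where d: "e + m = Suc d" using e_pos by (cases "e + m") auto
    have "q * (e + m - 1) + q = q * (e + m)" unfolding d by simp
    then show ?thesis using e_eq q_gt_1 by (simp add: algebra_simps)
  qed
  finally obtain v where v: "\<forall>i\<le>q+1. \<forall>k\<ge>e. coeff (v i) k = 0"
    "(\<Sum>i\<le>q+1. F i ^ q * v i) = H ^ q * monom 1 (q - 1)" using surj by blast
  have q: "q - 1 < q" using q_gt_1 by simp
  have "(\<Sum>i\<le>q+1. F i * frob_coord q (q - 1) (v i)) = H"
    using arg_cong[OF v(2), of "frob_coord q (q - 1)"] q
    by (simp add: frob_coord_sum frob_coord_power_mult frob_coord_monom)
  moreover have "coeff (frob_coord q (q - 1) (v i)) k = 0" if "i \<le> q + 1" "k \<ge> m" for i k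
  proof -
    have "e \<le> k * q + (q - 1)"
      using mult_le_mono1[OF that(2), of q] r_less e_eq by linarith
    then show ?thesis using v(1) that by (simp add: coeff_frob_coord)
  qed
  ultimately show ?thesis
    by (intro exI[of _ "\<lambda>i. frob_coord q (q - 1) (v i)"] conjI allI impI)
qed

text \<open>A longer family, together with solutions \<open>B l\<close> for the monomials of degree
  below \<open>e + m\<close>, would exceed the dimension \<open>(q + 2) * m\<close> of the space of
  all tuples. Multiplying a dependency by the \<open>F i\<close> and summing kills the syzygies and
  leaves the monomials; so the coefficients of the \<open>B l\<close> vanish, and the family itself
  would be dependent.\<close>

lemma indep_syz_card:
  assumes J: "finite J" and syz: "\<And>j. j \<in> J \<Longrightarrow> syz (b j)" and ind: "indep J b"
  shows "card J + r \<le> m"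
proof (rule ccontr)
  assume "\<not> card J + r \<le> m"
  then have gt: "card J + e + m > (q + 2) * m" using e_eq by (simp add: algebra_simps)
  have "\<exists>B. (\<forall>i\<le>q+1. \<forall>k\<ge>m. coeff (B i) k = 0) \<and> (\<Sum>i\<le>q+1. F i * B i) = monom 1 l"
    if "l < e + m" for l using surj_low[of "monom 1 l"] that by (simp add: degree_monom_eq)
  then obtain B where B: "\<And>l i k. l < e + m \<Longrightarrow> i \<le> q + 1 \<Longrightarrow> k \<ge> m \<Longrightarrow> coeff (B l i) k = 0"
    "\<And>l. l < e + m \<Longrightarrow> (\<Sum>i\<le>q+1. F i * B l i) = monom 1 l" by metis
  \<comment> \<open>Rows are the positions \<open>(i, k)\<close> of coefficients; columns are the
    members of the family and the \<open>B l\<close>.\<close>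
  define A where "A = (\<lambda>(i, k). case_sum (\<lambda>j. coeff (b j i) k) (\<lambda>l. coeff (B l i) k))"
  have card: "card ({..q+1} \<times> {..<m}) < card (J <+> {..<e+m})"
    using gt J by (simp add: card_Plus card_cartesian_product)
  have "finite ({..q+1} \<times> {..<m})" "finite (J <+> {..<e+m})" using J by auto
  from homogeneous_system_solution[OF this card, of A] obtain x where
    x: "\<exists>j\<in>J <+> {..<e+m}. x j \<noteq> 0"
      "\<forall>ik\<in>{..q+1} \<times> {..<m}. (\<Sum>j\<in>J <+> {..<e+m}. A ik j * x j) = 0"
    by blast
  have zero: "(\<Sum>j\<in>J. smult (x (Inl j)) (b j i)) + (\<Sum>l<e+m. smult (x (Inr l)) (B l i)) = 0"
    if i: "i \<le> q + 1" for i
  proof (rule poly_eqI)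
    fix k
    show "coeff ((\<Sum>j\<in>J. smult (x (Inl j)) (b j i)) + (\<Sum>l<e+m. smult (x (Inr l)) (B l i))) k
        = coeff 0 k"
    proof (cases "k < m")
      case True
      then have "(\<Sum>j\<in>J <+> {..<e+m}. A (i, k) j * x j) = 0" using x(2) i by auto
      then show ?thesis using J by (simp add: sum.Plus A_def coeff_sum mult.commute)
    next
      case False
      then show ?thesis using syz B(1) i by (simp add: coeff_sum syz_def)
    qed
  qed
  have "(\<Sum>i\<le>q+1. F i * b j i) = 0" if "j \<in> J" for j using syz[OF that] by (simp add: syz_def)
  then have "0 = (\<Sum>j\<in>J. smult (x (Inl j)) (\<Sum>i\<le>q+1. F i * b j i))" by simp
  also have "\<dots> = (\<Sum>i\<le>q+1. F i * (\<Sum>j\<in>J. smult (x (Inl j)) (b j i)))"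
    by (subst sum_distrib_left, subst sum.swap) (simp add: smult_sum_right)
  also have "\<dots> = (\<Sum>i\<le>q+1. F i * - (\<Sum>l<e+m. smult (x (Inr l)) (B l i)))"
    using zero by (intro sum.cong refl arg_cong[of _ _ "\<lambda>y. _ * y"]) (auto simp: eq_neg_iff_add_eq_0)
  also have "\<dots> = - (\<Sum>l<e+m. smult (x (Inr l)) (\<Sum>i\<le>q+1. F i * B l i))"
    unfolding sum_distrib_left smult_sum_right mult_minus_right sum_negf
    by (subst sum.swap) simp
  also have "\<dots> = - (\<Sum>l<e+m. monom (x (Inr l)) l)" using B(2)
    by (intro arg_cong[of _ _ uminus] sum.cong) (auto simp: smult_monom)
  finally have c0: "coeff (\<Sum>l<e+m. monom (x (Inr l)) l) l = 0" for l by simp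
  have xr: "x (Inr l) = 0" if "l < e + m" for l
    using c0[of l] that by (simp add: coeff_sum)
  then have "\<forall>i\<le>q+1. (\<Sum>j\<in>J. smult (x (Inl j)) (b j i)) = 0" using zero by simp
  then have "\<forall>j\<in>J. x (Inl j) = 0"
    using ind[unfolded indep_def, rule_format, of "\<lambda>j. x (Inl j)"] by blast
  moreover from x(1) obtain y where "y \<in> J <+> {..<e+m}" "x y \<noteq> 0" by blast
  ultimately show False using xr by (cases y) auto
qed

text \<open>Independent families have bounded length, so a longest one exists, and maximality makes
  it generate. The bound is written without subtraction and thus includes
  \<open>r \<le> m\<close>.\<close>

lemma syz_basis:
  obtains K b where "K + r \<le> m" "\<And>j. j < K \<Longrightarrow> syz (b j)"
    "\<And>B. syz B \<Longrightarrow> \<exists>x. \<forall>i\<le>q+1. B i = (\<Sum>j<K. smult (x j) (b j i))"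
proof -
  define P where "P K \<longleftrightarrow> (\<exists>b. (\<forall>j<K. syz (b j)) \<and> indep {..<K} b)" for K :: nat
  have bound: "K + r \<le> m" if "P K" for K
    using that indep_syz_card[of "{..<K}"] by (auto simp: P_def)
  have "P 0" by (auto simp: P_def indep_def)
  then obtain K where K: "P K" "\<And>K'. P K' \<Longrightarrow> K' \<le> K"
    using ex_has_greatest_nat[of P 0 id m] bound by fastforce
  then obtain b where b: "\<forall>j<K. syz (b j)" "indep {..<K} b" by (auto simp: P_def)
  show ?thesis
  proof (rule that[OF bound[OF K(1)]])
    show "syz (b j)" if "j < K" for j using b that by blast
    fix B assume B: "syz B"
    define b' where "b' = b(K := B)"
    have "\<forall>j<Suc K. syz (b' j)" using b B by (auto simp: b'_def less_Suc_eq)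
    then have "\<not> indep {..<Suc K} b'" using K(2)[of "Suc K"] by (auto simp: P_def)
    then obtain x where x: "\<And>i. i \<le> q + 1 \<Longrightarrow> (\<Sum>j<Suc K. smult (x j) (b' j i)) = 0"
      "\<exists>j<Suc K. x j \<noteq> 0" unfolding indep_def by auto
    have eq: "(\<Sum>j<K. smult (x j) (b j i)) + smult (x K) (B i) = 0" if "i \<le> q + 1" for i
      using x(1)[OF that] by (simp add: b'_def)
    \<comment> \<open>Otherwise the dependency would be one of the longest family alone.\<close>
    have xK: "x K \<noteq> 0"
    proof
      assume "x K = 0"
      then have "\<forall>j<K. x j = 0" using b(2) eq unfolding indep_def by auto
      then show False using x(2) \<open>x K = 0\<close> by (auto simp: less_Suc_eq)
    qed
    have "B i = (\<Sum>j<K. smult (- x j / x K) (b j i))" if "i \<le> q + 1" for i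
    proof -
      have *: "smult (x K) (B i) = - (\<Sum>j<K. smult (x j) (b j i))"
        using eq[OF that] by (simp add: add_eq_0_iff)
      have "B i = smult (1 / x K) (smult (x K) (B i))" using xK by simp
      also have "\<dots> = (\<Sum>j<K. smult (- x j / x K) (b j i))"
        unfolding * smult_minus_right smult_sum_right by (simp flip: sum_negf)
      finally show ?thesis .
    qed
    then show "\<exists>x. \<forall>i\<le>q+1. B i = (\<Sum>j<K. smult (x j) (b j i))"
      by (intro exI[of _ "\<lambda>j. - x j / x K"] allI impI)
  qed
qed

lemma m_pos: "m > 0"
proof (rule ccontr)
  assume "\<not> m > 0"
  with surj_low[of 1] e_pos obtain B where B: "\<forall>i\<le>q+1. \<forall>k. coeff (B i) k = 0"
    "(\<Sum>i\<le>q+1. F i * B i) = 1" by auto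
  then have "B i = 0" if "i \<le> q + 1" for i using that by (simp add: poly_eq_iff)
  then have "(\<Sum>i\<le>q+1. F i * B i) = 0" by simp
  then show False using B(2) by simp
qed

lemma frob_coord_F_syz:
  assumes "r < c" "c < q"
  shows "syz (\<lambda>i. frob_coord q c (F i))"
  unfolding syz_def
proof (intro conjI allI impI)
  have "(\<Sum>i\<le>q+1. F i ^ q * F i) = 0" using fermat by (simp only: power_add power_one_right)
  from arg_cong[OF this, of "frob_coord q c"] assms
  show "(\<Sum>i\<le>q+1. F i * frob_coord q c (F i)) = 0"
    by (simp add: frob_coord_sum frob_coord_power_mult)
  fix i k assume "i \<le> q + 1" "k \<ge> m"
  \<comment> \<open>Already the exponent \<open>m * q + c\<close> exceeds
    \<open>e = m * q + r\<close>, which lowers the degree bound from \<open>m\<close> to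
    \<open>m - 1\<close>.\<close>
  then have "e < k * q + c" using assms e_eq mult_le_mono1[of m k q] by linarith
  then show "coeff (frob_coord q c (F i)) k = 0"
    using deg_F \<open>i \<le> q + 1\<close> by (simp add: coeff_frob_coord)
qed

text \<open>With \<open>c\<^sub>i = d\<^sub>i\<^sup>q\<close>, the relation \<open>\<Sum> c\<^sub>i F\<^sub>i = 0\<close> is a system of linear equations for \<open>d\<close>. The
  coordinates \<open>frob_coord q c (F i)\<close> contribute \<open>m + 1\<close> equations for each \<open>c \<le> r\<close>. For \<open>c > r\<close>
  they are syzygies, and \<open>m\<close> equations for each basis element suffice.\<close>

lemma linear_relation_exists:
  assumes "l + (m\<^sup>2 + m + r + 1) < q + 2" "l \<le> 1"
  shows "\<exists>d. (\<exists>i\<le>q+1. d i \<noteq> 0) \<and> (l = 1 \<longrightarrow> d i0 = 0 \<or> i0 > q + 1) \<and>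
    (\<Sum>i\<le>q+1. smult (d i) (F i)) = 0"
proof -
  obtain K b where b: "K + r \<le> m" "\<And>j. j < K \<Longrightarrow> syz (b j)"
    "\<And>B. syz B \<Longrightarrow> \<exists>x. \<forall>i\<le>q+1. B i = (\<Sum>j<K. smult (x j) (b j i))" by (rule syz_basis) blast
  \<comment> \<open>One equation for each coefficient of the coordinates with
    \<open>c \<le> r\<close>, one for each coefficient of the generating syzygies, and for
    \<open>l = 1\<close> the extra equation \<open>x i0 = 0\<close>, which serves to find a second
    relation independent of a given one.\<close>
  define I where "I = ({..r} \<times> {..m}) <+> (({..<K} \<times> {..<m}) <+> {..<l})"
  define A where "A = case_sum (\<lambda>(c, k) i. coeff (frob_coord q c (F i)) k)
    (case_sum (\<lambda>(j, k) i. coeff (b j i) k) (\<lambda>(_::nat) i. if i = i0 then 1 else 0))"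
  have fin: "finite I" by (simp add: I_def)
  have "card I = (r + 1) * (m + 1) + K * m + l"
    unfolding I_def by (simp add: card_Plus card_cartesian_product)
  also have "\<dots> \<le> (r + 1) * (m + 1) + (m - r) * m + l"
    using b(1) by (intro add_right_mono add_left_mono mult_le_mono1) simp
  also have "\<dots> = m\<^sup>2 + m + r + 1 + l"
  proof -
    obtain d where "m = d + r" using b(1) by (metis add.commute le_Suc_ex add_leD2)
    then show ?thesis by (simp add: power2_eq_square algebra_simps)
  qed
  finally have "card I < card {..q+1}" using assms by simp
  from homogeneous_system_solution[OF fin _ this, of A] obtain x where
    x: "\<exists>i\<le>q+1. x i \<noteq> 0" "\<And>\<iota>. \<iota> \<in> I \<Longrightarrow> (\<Sum>i\<le>q+1. A \<iota> i * x i) = 0" by auto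
  have low: "(\<Sum>i\<le>q+1. x i * coeff (frob_coord q c (F i)) k) = 0" if "c \<le> r" "k \<le> m" for c k
    using x(2)[of "Inl (c, k)"] that by (auto simp: I_def A_def mult.commute)
  have high: "(\<Sum>i\<le>q+1. x i * coeff (b j i) k) = 0" if "j < K" "k < m" for j k
    using x(2)[of "Inr (Inl (j, k))"] that by (auto simp: I_def A_def mult.commute)
  have high': "(\<Sum>i\<le>q+1. smult (x i) (b j i)) = 0" if "j < K" for j
  proof (rule poly_eqI)
    fix k show "coeff (\<Sum>i\<le>q+1. smult (x i) (b j i)) k = coeff 0 k"
    proof (cases "k < m")
      case False
      then show ?thesis using b(2)[OF that] by (simp add: coeff_sum syz_def)
    qed (use high that in \<open>simp add: coeff_sum\<close>)
  qed
  have "(\<Sum>i\<le>q+1. smult (x i) (frob_coord q c (F i))) = 0" if "c < q" for c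
  proof (cases "c \<le> r")
    case True
    show ?thesis
    proof (rule poly_eqI)
      fix k show "coeff (\<Sum>i\<le>q+1. smult (x i) (frob_coord q c (F i))) k = coeff 0 k"
      proof (cases "k \<le> m")
        case False
        then have "Suc m * q \<le> k * q" by (intro mult_le_mono1) simp
        then have "k * q + c > e" using e_eq r_less by simp
        then show ?thesis using deg_F by (simp add: coeff_sum coeff_frob_coord)
      qed (use low True in \<open>simp add: coeff_sum\<close>)
    qed
  next
    case False
    then obtain y where y: "\<forall>i\<le>q+1. frob_coord q c (F i) = (\<Sum>j<K. smult (y j) (b j i))"
      using b(3)[OF frob_coord_F_syz] \<open>c < q\<close> by (metis not_le)
    then have "(\<Sum>i\<le>q+1. smult (x i) (frob_coord q c (F i)))
        = (\<Sum>i\<le>q+1. smult (x i) (\<Sum>j<K. smult (y j) (b j i)))" by (intro sum.cong) auto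
    also have "\<dots> = (\<Sum>j<K. smult (y j) (\<Sum>i\<le>q+1. smult (x i) (b j i)))"
      unfolding smult_sum_right by (subst sum.swap) (simp add: mult.commute)
    also have "\<dots> = 0" using high' by simp
    finally show ?thesis .
  qed
  then have "frob_coord q c (\<Sum>i\<le>q+1. [:x i:] ^ q * F i) = 0" if "c < q" for c
    using that by (simp add: frob_coord_sum frob_coord_power_mult)
  then have "(\<Sum>i\<le>q+1. [:x i:] ^ q * F i) = 0" by (rule frob_coord_eq_0D)
  then have "(\<Sum>i\<le>q+1. smult (x i ^ q) (F i)) = 0"
    by (simp add: poly_const_pow)
  moreover have "\<exists>i\<le>q+1. x i ^ q \<noteq> 0" using x(1) q_gt_1 by auto
  moreover have "x i0 ^ q = 0" if "l = 1" "i0 \<le> q + 1"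
  proof -
    have "(\<Sum>i\<le>q+1. (if i = i0 then 1 else 0) * x i) = 0"
      using x(2)[of "Inr (Inr 0)"] that(1) by (auto simp: I_def A_def)
    then have "x i0 = 0" using that(2) by (simp add: if_distrib[of "\<lambda>y. y * _"] cong: if_cong)
    then show ?thesis using q_gt_1 by simp
  qed
  ultimately show ?thesis by (intro exI[of _ "\<lambda>i. x i ^ q"]) auto
qed

section \<open>Bounds on the number of linear relations\<close>

lemma monom_relation_syz:
  assumes "(\<Sum>i\<le>q+1. smult (d i) (F i)) = 0" "k < m"
  shows "syz (\<lambda>i. monom (d i) k)"
proof -
  have "(\<Sum>i\<le>q+1. F i * monom (d i) k) = monom 1 k * (\<Sum>i\<le>q+1. smult (d i) (F i))"
    unfolding sum_distrib_left
  proof (intro sum.cong refl)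
    fix i
    have "monom (d i) k = smult (d i) (monom 1 k)" by (simp add: smult_monom)
    then show "F i * monom (d i) k = monom 1 k * smult (d i) (F i)" by (simp add: mult.commute)
  qed
  then show ?thesis using assms by (simp add: syz_def)
qed

text \<open>The multiples by \<open>t ^ k\<close>, \<open>k < m\<close>, of one relation are
  independent syzygies. The conclusion means \<open>r = 0\<close>.\<close>

lemma relation_bound_1:
  assumes d: "(\<Sum>i\<le>q+1. smult (d i) (F i)) = 0" "i0 \<le> q + 1" "d i0 \<noteq> 0"
  shows "m + r \<le> m"
proof -
  have "indep {..<m} (\<lambda>k i. monom (d i) k)" unfolding indep_def
  proof (intro allI impI ballI)
    fix x j assume *: "\<forall>i\<le>q+1. (\<Sum>j<m. smult (x j) (monom (d i) j)) = 0" "j \<in> {..<m}"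
    then have "coeff (\<Sum>j<m. smult (x j) (monom (d i0) j)) j = 0" using d(2) by simp
    then show "x j = 0" using *(2) d(3)
      by (simp add: coeff_sum if_distrib[of "\<lambda>y. _ * y"] cong: if_cong)
  qed
  then show ?thesis
    using indep_syz_card[of "{..<m}" "\<lambda>k i. monom (d i) k"] monom_relation_syz[OF d(1)] by simp
qed

text \<open>The condition \<open>d' i0 = 0\<close> puts the two relations in echelon form, so that
  their \<open>2 * m\<close> multiples are independent. This contradicts
  \<open>2 * m + r \<le> m\<close> with \<open>m > 0\<close>.\<close>

lemma relation_bound_2:
  assumes d: "(\<Sum>i\<le>q+1. smult (d i) (F i)) = 0" "i0 \<le> q + 1" "d i0 \<noteq> 0"
    and d': "(\<Sum>i\<le>q+1. smult (d' i) (F i)) = 0" "i1 \<le> q + 1" "d' i1 \<noteq> 0" "d' i0 = 0"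
  shows False
proof -
  define b where "b = case_sum (\<lambda>k i. monom (d i) k) (\<lambda>k i. monom (d' i) k)"
  have "indep ({..<m} <+> {..<m}) b" unfolding indep_def
  proof (intro allI impI)
    fix x assume *: "\<forall>i\<le>q+1. (\<Sum>j\<in>{..<m} <+> {..<m}. smult (x j) (b j i)) = 0"
    have c: "x (Inl j) * d i + x (Inr j) * d' i = 0" if "i \<le> q + 1" "j < m" for i j
    proof -
      have "coeff (\<Sum>j\<in>{..<m} <+> {..<m}. smult (x j) (b j i)) j = 0" using * that by simp
      then show ?thesis using that
        by (simp add: sum.Plus b_def coeff_sum if_distrib[of "\<lambda>y. _ * y"] cong: if_cong)
    qed
    have l: "x (Inl j) = 0" if "j < m" for j using c[OF d(2) that] d(3) d'(4) by simp
    then have "x (Inr j) = 0" if "j < m" for j using c[OF d'(2) that] d'(3) that by simp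
    then show "\<forall>j\<in>{..<m} <+> {..<m}. x j = 0" using l by auto
  qed
  then have "card ({..<m} <+> {..<m}) + r \<le> m"
    using monom_relation_syz[OF d(1)] monom_relation_syz[OF d'(1)]
    by (intro indep_syz_card[of _ b]) (auto simp: b_def)
  then show False using m_pos by (simp add: card_Plus)
qed

lemma numerical_bound:
  "(r > 0 \<longrightarrow> q + 1 \<le> m\<^sup>2 + m + r) \<and> (r = 0 \<longrightarrow> q \<le> m\<^sup>2 + m)"
proof (intro conjI impI)
  assume "r > 0"
  show "q + 1 \<le> m\<^sup>2 + m + r"
  proof (rule ccontr)
    assume "\<not> ?thesis"
    then obtain d i0 where "(\<Sum>i\<le>q+1. smult (d i) (F i)) = 0" "i0 \<le> q + 1" "d i0 \<noteq> 0"
      using linear_relation_exists[of 0] by auto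
    then show False using relation_bound_1 \<open>r > 0\<close> by fastforce
  qed
next
  assume "r = 0"
  show "q \<le> m\<^sup>2 + m"
  proof (rule ccontr)
    assume *: "\<not> ?thesis"
    then obtain d i0 where d: "(\<Sum>i\<le>q+1. smult (d i) (F i)) = 0" "i0 \<le> q + 1" "d i0 \<noteq> 0"
      using linear_relation_exists[of 0] \<open>r = 0\<close> by auto
    \<comment> \<open>For \<open>r = 0\<close> one relation is permitted, but the negated bound
      leaves room for one more equation, \<open>d' i0 = 0\<close>.\<close>
    moreover obtain d' i1 where "(\<Sum>i\<le>q+1. smult (d' i) (F i)) = 0" "i1 \<le> q + 1" "d' i1 \<noteq> 0" "d' i0 = 0"
      using linear_relation_exists[of 1 i0] * \<open>r = 0\<close> d(2) by auto
    ultimately show False by (rule relation_bound_2)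
  qed
qed

end

section \<open>Sections of the twisting sheaves\<close>

lemma cone_iff: "x \<in> \<Union>(proj_space n) \<longleftrightarrow> (\<exists>i. x i \<noteq> 0) \<and> (\<forall>i>n. x i = 0)"
proof
  assume "x \<in> \<Union>(proj_space n)"
  then obtain y c where "(\<exists>i. y i \<noteq> 0) \<and> (\<forall>i>n. y i = 0)" "x = (\<lambda>i. c * y i)" "c \<noteq> 0"
    unfolding proj_space_def line_def by blast
  then show "(\<exists>i. x i \<noteq> 0) \<and> (\<forall>i>n. x i = 0)" by auto
next
  assume *: "(\<exists>i. x i \<noteq> 0) \<and> (\<forall>i>n. x i = 0)"
  then have "line x \<in> proj_space n" unfolding proj_space_def by blast
  moreover have "x \<in> line x" unfolding line_def by (intro CollectI exI[of _ 1]) auto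
  ultimately show "x \<in> \<Union>(proj_space n)" by blast
qed

lemma line_self: "x \<in> line x"
  unfolding line_def by (intro CollectI exI[of _ 1]) auto

lemma line_scale: "c \<noteq> 0 \<Longrightarrow> line (\<lambda>i. c * x i) = line x"
proof -
  assume c: "c \<noteq> 0"
  have "(\<lambda>i. d * x i) \<in> line (\<lambda>i. c * x i)" if "d \<noteq> 0" for d
    unfolding line_def using c that by (intro CollectI exI[of _ "d / c"]) auto
  moreover have "(\<lambda>i. d * (c * x i)) \<in> line x" if "d \<noteq> 0" for d
    unfolding line_def using c that by (intro CollectI exI[of _ "d * c"]) (auto simp: mult.assoc)
  ultimately show ?thesis unfolding line_def by blast
qed

lemma line_eqI: "v \<in> line u \<Longrightarrow> line v = line u"
  by (auto simp: line_def[of u] line_scale)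

lemma proj_space_eq_line: "y \<in> proj_space n \<Longrightarrow> v \<in> y \<Longrightarrow> y = line v"
  using line_eqI unfolding proj_space_def by blast

lemma line_in_proj_space: "u \<in> \<Union>(proj_space n) \<Longrightarrow> line u \<in> proj_space n"
  using proj_space_eq_line by blast

lemma form_scale: "form n d P \<Longrightarrow> P (\<lambda>i. c * x i) = c ^ d * P x"
  by (induction rule: form.induct) (auto simp: algebra_simps power_add)

lemma mem_Union_iff: "U \<subseteq> proj_space n \<Longrightarrow> u \<in> \<Union>U \<longleftrightarrow> u \<in> \<Union>(proj_space n) \<and> line u \<in> U"
  using proj_space_eq_line line_self by blast

lemma zariski_open_subset: "zariski_open n U \<Longrightarrow> U \<subseteq> proj_space n"
  unfolding zariski_open_def by blast

text \<open>By homogeneity, a form that is nonzero at one vector of a line is nonzero at all of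
  them. A defining form of \<open>U\<close> therefore gives a principal open neighbourhood of
  \<open>u\<close>.\<close>

lemma zariski_openD:
  assumes "zariski_open n U" "u \<in> \<Union>U"
  obtains d P where "form n d P" "P u \<noteq> 0"
    "\<And>v. v \<in> \<Union>(proj_space n) \<Longrightarrow> P v \<noteq> 0 \<Longrightarrow> v \<in> \<Union>U"
proof -
  obtain S where S: "\<forall>P\<in>S. \<exists>d. form n d P" "U = {x \<in> proj_space n. \<exists>P\<in>S. \<exists>v\<in>x. P v \<noteq> 0}"
    using assms(1) unfolding zariski_open_def by blast
  from assms(2) obtain P v x where *: "x \<in> proj_space n" "u \<in> x" "P \<in> S" "v \<in> x" "P v \<noteq> 0"
    unfolding S(2) by blast
  obtain d where d: "form n d P" using S * by blast
  have "v \<in> line u" using * proj_space_eq_line by metis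
  then have "P u \<noteq> 0" using *(5) by (auto simp: line_def form_scale[OF d])
  then show ?thesis using d that[of d P] \<open>P \<in> S\<close> unfolding S(2) by blast
qed

text \<open>All forms whose nonvanishing locus lies in \<open>U\<close> serve as the defining set
  \<open>S\<close>.\<close>

lemma zariski_openI:
  assumes "U \<subseteq> proj_space n"
    and "\<And>u. u \<in> \<Union>U \<Longrightarrow> \<exists>d P. form n d P \<and> P u \<noteq> 0 \<and>
      (\<forall>v\<in>\<Union>(proj_space n). P v \<noteq> 0 \<longrightarrow> v \<in> \<Union>U)"
  shows "zariski_open n U"
proof -
  define S where "S = {P. (\<exists>d. form n d P) \<and> (\<forall>v\<in>\<Union>(proj_space n). P v \<noteq> 0 \<longrightarrow> v \<in> \<Union>U)}"
  have "U = {x \<in> proj_space n. \<exists>P\<in>S. \<exists>v\<in>x. P v \<noteq> 0}"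
  proof (intro equalityI subsetI)
    fix x assume "x \<in> U"
    moreover then obtain u where "x = line u" using assms(1) unfolding proj_space_def by blast
    ultimately have u: "u \<in> x" "u \<in> \<Union>U" "x \<in> proj_space n" using line_self assms(1) by blast+
    then obtain P where "P \<in> S" "P u \<noteq> 0" using assms(2)[OF u(2)] unfolding S_def by blast
    then show "x \<in> {x \<in> proj_space n. \<exists>P\<in>S. \<exists>v\<in>x. P v \<noteq> 0}" using u by blast
  next
    fix x assume "x \<in> {x \<in> proj_space n. \<exists>P\<in>S. \<exists>v\<in>x. P v \<noteq> 0}"
    then obtain P v where *: "x \<in> proj_space n" "P \<in> S" "v \<in> x" "P v \<noteq> 0" by blast
    then have "v \<in> \<Union>U" unfolding S_def by blast
    then show "x \<in> U" using * proj_space_eq_line mem_Union_iff[OF assms(1)] by metis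
  qed
  moreover have "\<forall>P\<in>S. \<exists>d. form n d P" unfolding S_def by blast
  ultimately show ?thesis unfolding zariski_open_def by (intro exI[of _ S] conjI)
qed

definition basic_open :: "nat \<Rightarrow> ('k::field vec \<Rightarrow> 'k) \<Rightarrow> 'k point set" where
  "basic_open n P = {line u | u. u \<in> \<Union>(proj_space n) \<and> P u \<noteq> 0}"

lemma basic_open_subset: "basic_open n P \<subseteq> proj_space n"
  unfolding basic_open_def using line_in_proj_space by blast

lemma cone_basic_open:
  assumes "form n d P" shows "u \<in> \<Union>(basic_open n P) \<longleftrightarrow> u \<in> \<Union>(proj_space n) \<and> P u \<noteq> 0"
proof
  assume "u \<in> \<Union>(basic_open n P)"
  then obtain v where v: "u \<in> line v" "v \<in> \<Union>(proj_space n)" "P v \<noteq> 0"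
    unfolding basic_open_def by blast
  have "P u \<noteq> 0" using v by (auto simp: line_def form_scale[OF assms])
  then show "u \<in> \<Union>(proj_space n) \<and> P u \<noteq> 0"
    using v line_in_proj_space by blast
next
  assume "u \<in> \<Union>(proj_space n) \<and> P u \<noteq> 0"
  then show "u \<in> \<Union>(basic_open n P)" unfolding basic_open_def using line_self by blast
qed

lemma zariski_open_basic:
  assumes "form n d P" shows "zariski_open n (basic_open n P)"
proof (rule zariski_openI[OF basic_open_subset])
  fix u assume "u \<in> \<Union>(basic_open n P)"
  then show "\<exists>d' P'. form n d' P' \<and> P' u \<noteq> 0 \<and>
      (\<forall>v\<in>\<Union>(proj_space n). P' v \<noteq> 0 \<longrightarrow> v \<in> \<Union>(basic_open n P))"
    using assms unfolding cone_basic_open[OF assms] by (intro exI[of _ d] exI[of _ P]) blast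
qed

lemma zariski_open_UNIV: "zariski_open n (proj_space n)"
proof (rule zariski_openI)
  fix u :: "'a vec"
  show "\<exists>d P. form n d P \<and> P u \<noteq> 0 \<and>
      (\<forall>v\<in>\<Union>(proj_space n). P v \<noteq> 0 \<longrightarrow> v \<in> \<Union>(proj_space n))"
    by (intro exI[of _ 0] exI[of _ "\<lambda>_. 1"] conjI form_const) simp_all
qed simp

lemma Union_Int_open:
  assumes "U \<subseteq> proj_space n" "V \<subseteq> proj_space n"
  shows "\<Union>(U \<inter> V) = \<Union>U \<inter> \<Union>V"
proof (intro equalityI subsetI)
  fix x assume "x \<in> \<Union>U \<inter> \<Union>V"
  then obtain y z where "y \<in> U" "x \<in> y" "z \<in> V" "x \<in> z" by blast
  moreover from this have "y = z" using assms proj_space_eq_line[of _ n x] by blast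
  ultimately show "x \<in> \<Union>(U \<inter> V)" by blast
qed blast

lemma zariski_open_Int:
  assumes "zariski_open n U" "zariski_open n V"
  shows "zariski_open n (U \<inter> V)"
proof (rule zariski_openI)
  note sub = zariski_open_subset[OF assms(1)] zariski_open_subset[OF assms(2)]
  show "U \<inter> V \<subseteq> proj_space n" using sub by blast
  fix u assume "u \<in> \<Union>(U \<inter> V)"
  then have u: "u \<in> \<Union>U" "u \<in> \<Union>V" by auto
  obtain d P where P: "form n d P" "P u \<noteq> 0"
    "\<And>v. v \<in> \<Union>(proj_space n) \<Longrightarrow> P v \<noteq> 0 \<Longrightarrow> v \<in> \<Union>U" using zariski_openD[OF assms(1) u(1)] by metis
  obtain d' P' where P': "form n d' P'" "P' u \<noteq> 0"
    "\<And>v. v \<in> \<Union>(proj_space n) \<Longrightarrow> P' v \<noteq> 0 \<Longrightarrow> v \<in> \<Union>V" using zariski_openD[OF assms(2) u(2)] by metis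
  show "\<exists>d P. form n d P \<and> P u \<noteq> 0 \<and> (\<forall>v\<in>\<Union>(proj_space n). P v \<noteq> 0 \<longrightarrow> v \<in> \<Union>(U \<inter> V))"
    unfolding Union_Int_open[OF sub]
    by (intro exI[of _ "d + d'"] exI[of _ "\<lambda>x. P x * P' x"]) (use P P' form_mult in auto)
qed

section \<open>Sections of O(d) as local fractions\<close>

text \<open>Numerator and denominator are expanded by \<open>P * x i\<close>, where \<open>P\<close>
  cuts out a neighbourhood and \<open>x i\<close> excludes the zero vector. After that a nonzero
  denominator alone guarantees that \<open>v\<close> lies in the cone over \<open>U\<close>, so that
  charts and arcs can be substituted without further conditions.\<close>

lemma twistD:
  assumes "s \<in> twist n d U" "u \<in> \<Union>U"
  obtains a b G H where "form n a G" "form n b H" "int a - int b = d" "H u \<noteq> 0"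
    "\<And>v. (\<And>i. i > n \<Longrightarrow> v i = 0) \<Longrightarrow> H v \<noteq> 0 \<Longrightarrow> v \<in> \<Union>U \<and> s v = G v / H v"
proof -
  obtain y where y: "y \<in> U" "u \<in> y" using assms(2) by blast
  then obtain W a b G H where W: "zariski_open n W" "y \<in> W" "W \<subseteq> U"
      "form n a G" "form n b H" "int a - int b = d" "\<forall>v\<in>\<Union>W. H v \<noteq> 0 \<and> s v = G v / H v"
    using assms(1) unfolding twist_def by blast
  have uW: "u \<in> \<Union>W" using W y by blast
  then obtain c P where P: "form n c P" "P u \<noteq> 0"
    "\<And>v. v \<in> \<Union>(proj_space n) \<Longrightarrow> P v \<noteq> 0 \<Longrightarrow> v \<in> \<Union>W" using zariski_openD[OF W(1)] by metis
  have "u \<in> \<Union>(proj_space n)" using uW zariski_open_subset[OF W(1)] by blast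
  then obtain i where i: "i \<le> n" "u i \<noteq> 0" unfolding cone_iff by (metis not_le)
  define R where "R = (\<lambda>x. P x * x i)"
  have R: "form n (c + 1) R" unfolding R_def using P(1) i(1) by (intro form_mult form_var)
  show ?thesis
  proof (rule that[OF form_mult[OF W(4) R] form_mult[OF W(5) R]])
    show "int (a + (c + 1)) - int (b + (c + 1)) = d" using W(6) by simp
    show "H u * R u \<noteq> 0" using W(7) uW P(2) i by (auto simp: R_def)
    fix v assume v: "\<And>i. i > n \<Longrightarrow> v i = 0" "H v * R v \<noteq> 0"
    then have "v i \<noteq> 0" "P v \<noteq> 0" by (auto simp: R_def)
    then have "v \<in> \<Union>W" using P(3) v unfolding cone_iff by blast
    then show "v \<in> \<Union>U \<and> s v = G v * R v / (H v * R v)" using W(3,7) v(2) by auto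
  qed
qed

lemma twistI:
  assumes "\<And>u. u \<in> \<Union>U \<Longrightarrow> \<exists>a b G H. form n a G \<and> form n b H \<and> int a - int b = d \<and> H u \<noteq> 0 \<and>
    (\<forall>v\<in>\<Union>(proj_space n). H v \<noteq> 0 \<longrightarrow> v \<in> \<Union>U \<and> s v = G v / H v)"
    and U: "U \<subseteq> proj_space n"
  shows "s \<in> twist n d U"
  unfolding twist_def
proof (intro CollectI ballI)
  fix y assume y: "y \<in> U"
  then obtain u where u: "y = line u" "u \<in> y" using U line_self unfolding proj_space_def by blast
  then obtain a b G H where *: "form n a G" "form n b H" "int a - int b = d" "H u \<noteq> 0"
    "\<forall>v\<in>\<Union>(proj_space n). H v \<noteq> 0 \<longrightarrow> v \<in> \<Union>U \<and> s v = G v / H v"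
    using assms(1)[of u] y by blast
  have "y \<in> basic_open n H" unfolding basic_open_def using u y U * by blast
  moreover have "basic_open n H \<subseteq> U"
    unfolding basic_open_def using *(5) mem_Union_iff[OF U] by blast
  moreover have "\<forall>v\<in>\<Union>(basic_open n H). H v \<noteq> 0 \<and> s v = G v / H v"
  proof
    fix v assume "v \<in> \<Union>(basic_open n H)"
    then show "H v \<noteq> 0 \<and> s v = G v / H v"
      using *(5) unfolding cone_basic_open[OF *(2)] by blast
  qed
  ultimately show "\<exists>W a b G H. zariski_open n W \<and> y \<in> W \<and> W \<subseteq> U \<and>
      form n a G \<and> form n b H \<and> int a - int b = d \<and> (\<forall>v\<in>\<Union>W. H v \<noteq> 0 \<and> s v = G v / H v)"
    using *(1-3) zariski_open_basic[OF *(2)]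
    by (intro exI[of _ "basic_open n H"]) (rule exI[of _ a], rule exI[of _ b], fast)
qed

lemma fraction_exI:
  assumes "form n a G" "form n b H" "int a - int b = d" "H u \<noteq> 0"
    and "\<And>v. v \<in> \<Union>(proj_space n) \<Longrightarrow> H v \<noteq> 0 \<Longrightarrow> v \<in> \<Union>U \<and> s v = G v / H v"
  shows "\<exists>a b G H. form n a G \<and> form n b H \<and> int a - int b = d \<and> H u \<noteq> 0 \<and>
    (\<forall>v\<in>\<Union>(proj_space n). H v \<noteq> 0 \<longrightarrow> v \<in> \<Union>U \<and> s v = G v / H v)"
  using assms by (intro exI[of _ a] exI[of _ b] exI[of _ G] exI[of _ H]) blast

lemma twist_local:
  assumes "\<And>u. u \<in> \<Union>U \<Longrightarrow> \<exists>W. u \<in> \<Union>W \<and> W \<subseteq> U \<and> s \<in> twist n d W" and U: "U \<subseteq> proj_space n"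
  shows "s \<in> twist n d U"
proof (rule twistI[OF _ U])
  fix u assume "u \<in> \<Union>U"
  from assms(1)[OF this] obtain W where W: "u \<in> \<Union>W" "W \<subseteq> U" "s \<in> twist n d W"
    by (elim exE conjE)
  obtain a b G H where *: "form n a G" "form n b H" "int a - int b = d" "H u \<noteq> 0"
    "\<And>v. (\<And>i. i > n \<Longrightarrow> v i = 0) \<Longrightarrow> H v \<noteq> 0 \<Longrightarrow> v \<in> \<Union>W \<and> s v = G v / H v"
    using twistD[OF W(3,1)] by metis
  show "\<exists>a b G H. form n a G \<and> form n b H \<and> int a - int b = d \<and> H u \<noteq> 0 \<and>
    (\<forall>v\<in>\<Union>(proj_space n). H v \<noteq> 0 \<longrightarrow> v \<in> \<Union>U \<and> s v = G v / H v)"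
  proof (rule fraction_exI[OF *(1-4)])
    fix v assume "v \<in> \<Union>(proj_space n)" "H v \<noteq> 0"
    then have "v \<in> \<Union>W \<and> s v = G v / H v" using *(5)[of v] unfolding cone_iff by simp
    then show "v \<in> \<Union>U \<and> s v = G v / H v" using W(2) by blast
  qed
qed

lemma twist_restrict:
  assumes "s \<in> twist n d U" "zariski_open n W" "W \<subseteq> U"
  shows "s \<in> twist n d W"
proof (rule twistI[OF _ zariski_open_subset[OF assms(2)]])
  fix u assume u: "u \<in> \<Union>W"
  then have "u \<in> \<Union>U" using assms by blast
  then obtain a b G H where *: "form n a G" "form n b H" "int a - int b = d" "H u \<noteq> 0"
    "\<And>v. (\<And>i. i > n \<Longrightarrow> v i = 0) \<Longrightarrow> H v \<noteq> 0 \<Longrightarrow> v \<in> \<Union>U \<and> s v = G v / H v"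
    using twistD[OF assms(1)] by metis
  obtain c P where P: "form n c P" "P u \<noteq> 0"
    "\<And>v. v \<in> \<Union>(proj_space n) \<Longrightarrow> P v \<noteq> 0 \<Longrightarrow> v \<in> \<Union>W" using zariski_openD[OF assms(2) u] by metis
  have "v \<in> \<Union>W \<and> s v = G v * P v / (H v * P v)" if "v \<in> \<Union>(proj_space n)" "H v * P v \<noteq> 0" for v
    using *(5)[of v] P(3)[of v] that unfolding cone_iff by auto
  then show "\<exists>a b G H. form n a G \<and> form n b H \<and> int a - int b = d \<and> H u \<noteq> 0 \<and>
    (\<forall>v\<in>\<Union>(proj_space n). H v \<noteq> 0 \<longrightarrow> v \<in> \<Union>W \<and> s v = G v / H v)"
    using form_mult[OF *(1) P(1)] form_mult[OF *(2) P(1)] *(3,4) P(2)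
    by (intro fraction_exI[of n "a + c" "\<lambda>v. G v * P v" "b + c" "\<lambda>v. H v * P v"]) auto
qed

lemma twist_cong:
  assumes "s \<in> twist n d U" "\<And>u. u \<in> \<Union>U \<Longrightarrow> s u = s' u"
  shows "s' \<in> twist n d U"
  unfolding twist_def
proof (intro CollectI ballI)
  fix x assume "x \<in> U"
  then obtain W a b G H where W: "zariski_open n W" "x \<in> W" "W \<subseteq> U"
      "form n a G" "form n b H" "int a - int b = d" "\<forall>v\<in>\<Union>W. H v \<noteq> 0 \<and> s v = G v / H v"
    using assms(1) unfolding twist_def by blast
  have "\<forall>v\<in>\<Union>W. H v \<noteq> 0 \<and> s' v = G v / H v" using W(3,7) assms(2) by fastforce
  with W show "\<exists>W a b G H. zariski_open n W \<and> x \<in> W \<and> W \<subseteq> U \<and>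
      form n a G \<and> form n b H \<and> int a - int b = d \<and> (\<forall>v\<in>\<Union>W. H v \<noteq> 0 \<and> s' v = G v / H v)"
    by (intro exI[of _ W] exI[of _ a] exI[of _ b] exI[of _ G] exI[of _ H]) auto
qed

lemma twist_form: "form n a G \<Longrightarrow> zariski_open n U \<Longrightarrow> G \<in> twist n (int a) U"
proof -
  assume G: "form n a G" and U: "zariski_open n U"
  have "G \<in> twist n (int a) (proj_space n)"
    by (intro twistI fraction_exI[OF G form_const[of n 1]]) auto
  then show ?thesis using U zariski_open_subset[OF U] by (rule twist_restrict)
qed

lemma twist_zero:
  assumes U: "zariski_open n U"
  shows "(\<lambda>_. 0 :: 'k::field) \<in> twist n d U"
proof -
  have "(\<lambda>_. 0 :: 'k) \<in> twist n d (proj_space n)"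
  proof (rule twistI)
    fix u :: "'k vec" assume "u \<in> \<Union>(proj_space n)"
    then obtain i where i: "u i \<noteq> 0" "i \<le> n" unfolding cone_iff by (metis not_le)
    \<comment> \<open>Even the zero section needs a fraction with degree difference
      \<open>d\<close>; for negative \<open>d\<close> the denominator is a power of a nonvanishing
      coordinate.\<close>
    have T: "form n (nat (- d)) (\<lambda>x::'k vec. x i ^ nat (- d))"
      using form_power[OF form_var[OF i(2)], of "nat (- d)"] by simp
    show "\<exists>a b G H. form n a G \<and> form n b H \<and> int a - int b = d \<and> H u \<noteq> 0 \<and>
      (\<forall>v\<in>\<Union>(proj_space n). H v \<noteq> 0 \<longrightarrow> v \<in> \<Union>(proj_space n) \<and> 0 = G v / H v)"
      by (rule fraction_exI[OF form_zero[of n "nat d"] T]) (use i in auto)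
  qed simp
  then show ?thesis using U zariski_open_subset[OF U] by (rule twist_restrict)
qed

lemma twist_mult:
  assumes "s \<in> twist n d U" "t \<in> twist n d' U" "d'' = d + d'" and U: "zariski_open n U"
  shows "(\<lambda>u. s u * t u) \<in> twist n d'' U"
proof (rule twistI[OF _ zariski_open_subset[OF U]])
  fix u assume u: "u \<in> \<Union>U"
  obtain a b G H where *: "form n a G" "form n b H" "int a - int b = d" "H u \<noteq> 0"
    "\<And>v. (\<And>i. i > n \<Longrightarrow> v i = 0) \<Longrightarrow> H v \<noteq> 0 \<Longrightarrow> v \<in> \<Union>U \<and> s v = G v / H v"
    using twistD[OF assms(1) u] by metis
  obtain a' b' G' H' where **: "form n a' G'" "form n b' H'" "int a' - int b' = d'" "H' u \<noteq> 0"
    "\<And>v. (\<And>i. i > n \<Longrightarrow> v i = 0) \<Longrightarrow> H' v \<noteq> 0 \<Longrightarrow> v \<in> \<Union>U \<and> t v = G' v / H' v"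
    using twistD[OF assms(2) u] by metis
  have "v \<in> \<Union>U \<and> s v * t v = G v * G' v / (H v * H' v)"
    if "v \<in> \<Union>(proj_space n)" "H v * H' v \<noteq> 0" for v
    using *(5)[of v] **(5)[of v] that unfolding cone_iff by auto
  then show "\<exists>a b G H. form n a G \<and> form n b H \<and> int a - int b = d'' \<and> H u \<noteq> 0 \<and>
    (\<forall>v\<in>\<Union>(proj_space n). H v \<noteq> 0 \<longrightarrow> v \<in> \<Union>U \<and> s v * t v = G v / H v)"
    using form_mult[OF *(1) **(1)] form_mult[OF *(2) **(2)] *(3,4) **(3,4) assms(3)
    by (intro fraction_exI[of n "a + a'" "\<lambda>v. G v * G' v" "b + b'" "\<lambda>v. H v * H' v"]) auto
qed

lemma twist_add:
  assumes "s \<in> twist n d U" "t \<in> twist n d U" and U: "zariski_open n U"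
  shows "(\<lambda>u. s u + t u) \<in> twist n d U"
proof (rule twistI[OF _ zariski_open_subset[OF U]])
  fix u assume u: "u \<in> \<Union>U"
  obtain a b G H where *: "form n a G" "form n b H" "int a - int b = d" "H u \<noteq> 0"
    "\<And>v. (\<And>i. i > n \<Longrightarrow> v i = 0) \<Longrightarrow> H v \<noteq> 0 \<Longrightarrow> v \<in> \<Union>U \<and> s v = G v / H v"
    using twistD[OF assms(1) u] by metis
  obtain a' b' G' H' where **: "form n a' G'" "form n b' H'" "int a' - int b' = d" "H' u \<noteq> 0"
    "\<And>v. (\<And>i. i > n \<Longrightarrow> v i = 0) \<Longrightarrow> H' v \<noteq> 0 \<Longrightarrow> v \<in> \<Union>U \<and> t v = G' v / H' v"
    using twistD[OF assms(2) u] by metis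
  have "a' + b = a + b'" using *(3) **(3) by simp
  then have num: "form n (a + b') (\<lambda>v. G v * H' v + G' v * H v)"
    using form_add[OF form_mult[OF *(1) **(2)], of "\<lambda>v. G' v * H v"] form_mult[OF **(1) *(2)] by simp
  have "v \<in> \<Union>U \<and> s v + t v = (G v * H' v + G' v * H v) / (H v * H' v)"
    if "v \<in> \<Union>(proj_space n)" "H v * H' v \<noteq> 0" for v
    using *(5)[of v] **(5)[of v] that unfolding cone_iff by (auto simp: add_frac_eq)
  then show "\<exists>a b G H. form n a G \<and> form n b H \<and> int a - int b = d \<and> H u \<noteq> 0 \<and>
    (\<forall>v\<in>\<Union>(proj_space n). H v \<noteq> 0 \<longrightarrow> v \<in> \<Union>U \<and> s v + t v = G v / H v)"
    using num form_mult[OF *(2) **(2)] *(3,4) **(3,4)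
    by (intro fraction_exI[of n "a + b'" "\<lambda>v. G v * H' v + G' v * H v" "b + b'" "\<lambda>v. H v * H' v"]) auto
qed

text \<open>The fraction \<open>H / G\<close> is expanded by \<open>H\<close>, so that a nonzero
  denominator still keeps \<open>v\<close> in the cone over \<open>U\<close>.\<close>

lemma twist_inverse:
  assumes "s \<in> twist n d U" "\<And>u. u \<in> \<Union>U \<Longrightarrow> s u \<noteq> 0" and U: "zariski_open n U"
  shows "(\<lambda>u. inverse (s u)) \<in> twist n (- d) U"
proof (rule twistI[OF _ zariski_open_subset[OF U]])
  fix u assume u: "u \<in> \<Union>U"
  obtain a b G H where *: "form n a G" "form n b H" "int a - int b = d" "H u \<noteq> 0"
    "\<And>v. (\<And>i. i > n \<Longrightarrow> v i = 0) \<Longrightarrow> H v \<noteq> 0 \<Longrightarrow> v \<in> \<Union>U \<and> s v = G v / H v"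
    using twistD[OF assms(1) u] by metis
  have "u \<in> \<Union>(proj_space n)" using u zariski_open_subset[OF U] by blast
  then have "G u \<noteq> 0" using *(5)[of u] assms(2)[OF u] *(4) unfolding cone_iff by auto
  have "v \<in> \<Union>U \<and> inverse (s v) = H v * H v / (G v * H v)"
    if "v \<in> \<Union>(proj_space n)" "G v * H v \<noteq> 0" for v
    using *(5)[of v] that unfolding cone_iff by auto
  then show "\<exists>a b G H. form n a G \<and> form n b H \<and> int a - int b = - d \<and> H u \<noteq> 0 \<and>
    (\<forall>v\<in>\<Union>(proj_space n). H v \<noteq> 0 \<longrightarrow> v \<in> \<Union>U \<and> inverse (s v) = G v / H v)"
    using form_mult[OF *(2) *(2)] form_mult[OF *(1) *(2)] *(3,4) \<open>G u \<noteq> 0\<close>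
    by (intro fraction_exI[of n "b + b" "\<lambda>v. H v * H v" "a + b" "\<lambda>v. G v * H v"]) auto
qed

lemma twist_const_mult:
  assumes "s \<in> twist n d U" "zariski_open n U" shows "(\<lambda>u. c * s u) \<in> twist n d U"
  using twist_mult[OF twist_form[OF form_const[of n c] assms(2)] assms(1) _ assms(2)] by simp

lemma twist_uminus:
  assumes "s \<in> twist n d U" "zariski_open n U" shows "(\<lambda>u. - s u) \<in> twist n d U"
  using twist_const_mult[OF assms, of "-1"] by simp

lemma twist_diff:
  assumes "s \<in> twist n d U" "t \<in> twist n d U" "zariski_open n U"
  shows "(\<lambda>u. s u - t u) \<in> twist n d U"
  using twist_add[OF assms(1) twist_uminus[OF assms(2,3)] assms(3)] by simp

lemma twist_sum:
  assumes "zariski_open n U" "\<And>i. i \<in> I \<Longrightarrow> s i \<in> twist n d U"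
  shows "(\<lambda>u. \<Sum>i\<in>I. s i u) \<in> twist n d U"
  using assms(2)
  by (induction I rule: infinite_finite_induct) (auto intro: twist_zero twist_add assms(1))

lemma twist_scale:
  assumes "s \<in> twist n d U" "u \<in> \<Union>U" "c \<noteq> 0" "U \<subseteq> proj_space n"
  shows "s (\<lambda>i. c * u i) = c powi d * s u"
proof -
  obtain a b G H where *: "form n a G" "form n b H" "int a - int b = d" "H u \<noteq> 0"
    "\<And>v. (\<And>i. i > n \<Longrightarrow> v i = 0) \<Longrightarrow> H v \<noteq> 0 \<Longrightarrow> v \<in> \<Union>U \<and> s v = G v / H v"
    using twistD[OF assms(1,2)] by metis
  have u: "\<And>i. i > n \<Longrightarrow> u i = 0" using assms(2,4) cone_iff by blast
  have "H (\<lambda>i. c * u i) \<noteq> 0" using * assms(3) by (simp add: form_scale[OF *(2)])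
  then have "s (\<lambda>i. c * u i) = c ^ a * G u / (c ^ b * H u)"
    using *(5)[of "\<lambda>i. c * u i"] u by (simp add: form_scale[OF *(1)] form_scale[OF *(2)])
  also have "\<dots> = c powi d * s u"
    using *(5)[of u] u *(3,4) assms(3) by (auto simp: power_int_diff)
  finally show ?thesis .
qed

section \<open>Sections over the charts of the projective line\<close>

text \<open>Serves both for the charts of the projective line and for derivatives along
  arcs.\<close>

lemma form_along_line: "form n d P \<Longrightarrow> \<exists>p. \<forall>z. P (\<lambda>i. x i + z * w i) = poly p z"
proof (induction rule: form.induct)
  case (form_const c)
  show ?case by (intro exI[of _ "[:c:]"]) simp
next
  case (form_var i)
  show ?case by (intro exI[of _ "[:x i, w i:]"]) simp
next
  case (form_add d P Q)
  then obtain p q where "\<forall>z. P (\<lambda>i. x i + z * w i) = poly p z" "\<forall>z. Q (\<lambda>i. x i + z * w i) = poly q z"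
    by blast
  then show ?case by (intro exI[of _ "p + q"]) simp
next
  case (form_mult a P b Q)
  then obtain p q where "\<forall>z. P (\<lambda>i. x i + z * w i) = poly p z" "\<forall>z. Q (\<lambda>i. x i + z * w i) = poly q z"
    by blast
  then show ?case by (intro exI[of _ "p * q"]) simp
qed

text \<open>A denominator of minimal degree divides every other denominator, so it has no roots.\<close>

lemma poly_of_locally_rational:
  fixes \<gamma> :: "'k::alg_closed_field \<Rightarrow> 'k"
  assumes "\<And>t0. \<exists>g h. poly h t0 \<noteq> 0 \<and> (\<forall>t. poly h t \<noteq> 0 \<longrightarrow> \<gamma> t * poly h t = poly g t)"
  shows "\<exists>p. \<forall>t. \<gamma> t = poly p t"
proof -
  define valid where "valid g h \<longleftrightarrow> h \<noteq> 0 \<and> (\<forall>t. poly h t \<noteq> 0 \<longrightarrow> \<gamma> t * poly h t = poly g t)" for g h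
  have "\<exists>h g. valid g h" using assms[of 0] unfolding valid_def by (metis poly_0)
  then obtain h0 where h0: "\<exists>g. valid g h0" and min: "\<And>h. \<exists>g. valid g h \<Longrightarrow> degree h0 \<le> degree h"
    using ex_has_least_nat[of "\<lambda>h. \<exists>g. valid g h" _ degree] by blast
  then obtain g0 where g0: "valid g0 h0" by blast
  have dvd: "h0 dvd h" if gh: "valid g h" for g h
  proof -
    \<comment> \<open>Two fractions for the same function agree where both denominators are nonzero,
      hence identically.\<close>
    have cross: "g * h0 = g0 * h"
    proof (rule poly_eq_of_dense[of "h * h0"])
      show "h * h0 \<noteq> 0" using gh g0 by (simp add: valid_def)
      fix x assume "poly (h * h0) x \<noteq> 0"
      then have "\<gamma> x * poly h x = poly g x" "\<gamma> x * poly h0 x = poly g0 x"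
        using gh g0 by (auto simp: valid_def)
      then show "poly (g * h0) x = poly (g0 * h) x" by (simp flip: \<open>_ = poly g x\<close> \<open>_ = poly g0 x\<close>)
    qed
    \<comment> \<open>The numerator that makes \<open>h mod h0\<close>, if nonzero, a denominator as
      well; by minimality of \<open>h0\<close> the remainder must be zero.\<close>
    define s where "s = g - g0 * (h div h0)"
    have hmod: "h = h0 * (h div h0) + h mod h0" by simp
    have s: "s * h0 = g0 * (h mod h0)"
    proof -
      have "h mod h0 = h - h0 * (h div h0)" by (simp add: minus_mult_div_eq_mod)
      then show ?thesis by (simp add: s_def left_diff_distrib cross right_diff_distrib mult_ac)
    qed
    have "\<gamma> t * poly (h mod h0) t = poly s t" if t: "poly (h mod h0) t \<noteq> 0" for t
    proof (cases "poly h0 t = 0")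
      case False
      then have A: "\<gamma> t * poly h0 t = poly g0 t" using g0 by (auto simp: valid_def)
      have B: "poly s t * poly h0 t = poly g0 t * poly (h mod h0) t"
        using arg_cong[OF s, of "\<lambda>p. poly p t"] by simp
      have "\<gamma> t * poly (h mod h0) t * poly h0 t = poly s t * poly h0 t"
        unfolding B A[symmetric] by (simp add: mult_ac)
      then show ?thesis using False by simp
    next
      \<comment> \<open>At a root of \<open>h0\<close> the fraction with denominator
        \<open>h0\<close> says nothing. There \<open>h\<close> and \<open>h mod h0\<close> agree,
        and the fraction with denominator \<open>h\<close> is used.\<close>
      case True
      have "poly s t * poly h0 t = poly g0 t * poly (h mod h0) t" using arg_cong[OF s, of "\<lambda>p. poly p t"] by simp
      then have "poly g0 t = 0" using True t by simp
      moreover have E: "poly h t = poly (h mod h0) t"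
        using True arg_cong[OF hmod, of "\<lambda>p. poly p t"]
        by (simp only: poly_add poly_mult mult_zero_left add_0_left)
      have "poly h t \<noteq> 0" using t by (simp only: E not_False_eq_True)
      then have "\<gamma> t * poly h t = poly g t" using gh unfolding valid_def by blast
      ultimately show ?thesis by (simp add: s_def E)
    qed
    then have "degree h0 \<le> degree (h mod h0)" if "h mod h0 \<noteq> 0"
      using that min[of "h mod h0"] unfolding valid_def by blast
    moreover have "degree (h mod h0) < degree h0" if "h mod h0 \<noteq> 0"
      using that degree_mod_less'[of h0 h] g0 by (simp add: valid_def)
    ultimately show ?thesis by (metis dvd_eq_mod_eq_0 not_le)
  qed
  have nz: "poly h0 t \<noteq> 0" for t
  proof -
    obtain g h where "poly h t \<noteq> 0" "\<forall>t. poly h t \<noteq> 0 \<longrightarrow> \<gamma> t * poly h t = poly g t"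
      using assms[of t] by blast
    moreover then have "h0 dvd h" by (intro dvd[of g]) (auto simp: valid_def)
    ultimately show ?thesis by (metis dvdE mult_eq_0_iff poly_mult)
  qed
  then have "degree h0 = 0" using alg_closed_imp_poly_has_root[of h0] by blast
  then obtain c where c: "h0 = [:c:]" using degree_eq_zeroE by blast
  then have "c \<noteq> 0" using nz[of 0] by simp
  have "\<gamma> t = poly (smult (1 / c) g0) t" for t
    using g0 \<open>c \<noteq> 0\<close> c by (auto simp: valid_def field_simps)
  then show ?thesis by blast
qed

text \<open>Written as a point on a straight line so that \<open>form_along_line\<close> applies.
  The parameter is the affine coordinate \<open>u j / u i\<close> of the chart where
  \<open>u i \<noteq> 0\<close>.\<close>

definition chart_pt :: "nat \<Rightarrow> nat \<Rightarrow> 'k::field \<Rightarrow> 'k vec" where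
  "chart_pt i j t = (\<lambda>l. (if l = i then 1 else 0) + t * (if l = j then 1 else 0))"

abbreviation chart :: "nat \<Rightarrow> 'k::field point set" where
  "chart i \<equiv> basic_open 1 (\<lambda>u. u i)"

lemma cone_chart: "i \<le> 1 \<Longrightarrow> u \<in> \<Union>(chart i) \<longleftrightarrow> u \<in> \<Union>(proj_space 1) \<and> u i \<noteq> 0"
  by (rule cone_basic_open[OF form_var])

lemma open_chart: "i \<le> 1 \<Longrightarrow> zariski_open 1 (chart i)"
  by (rule zariski_open_basic[OF form_var])

lemma chart_pt_cone:
  assumes "i \<le> 1" "j \<le> 1" "i \<noteq> j" shows "chart_pt i j t \<in> \<Union>(chart i)"
  unfolding cone_chart[OF assms(1)] cone_iff using assms
  by (auto simp: chart_pt_def intro!: exI[of _ i])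

lemma cone_eq_scale_chart_pt:
  assumes "i \<le> 1" "j \<le> 1" "i \<noteq> j" "u \<in> \<Union>(chart i)"
  shows "u = (\<lambda>l. u i * chart_pt i j (u j / u i) l)"
proof
  fix l
  have "u l = 0" if "l > 1" using that assms(4) unfolding cone_chart[OF assms(1)] cone_iff by blast
  moreover have "u i \<noteq> 0" using assms(4) unfolding cone_chart[OF assms(1)] by blast
  moreover have "l > 1 \<or> l = i \<or> l = j" using assms by linarith
  ultimately show "u l = u i * chart_pt i j (u j / u i) l"
    using assms by (auto simp: chart_pt_def)
qed

text \<open>On \<open>chart_pt i j t\<close> the section is locally rational in \<open>t\<close>,
  hence polynomial; homogeneity of degree \<open>d\<close> extends the formula to the whole
  cone.\<close>

lemma twist_chart_poly:
  fixes s :: "'k::alg_closed_field vec \<Rightarrow> 'k"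
  assumes ij: "i \<le> 1" "j \<le> 1" "i \<noteq> j" and s: "s \<in> twist 1 d (chart i)"
  shows "\<exists>p. \<forall>u\<in>\<Union>(chart i). s u = u i powi d * poly p (u j / u i)"
proof -
  have "\<exists>p. \<forall>t. s (chart_pt i j t) = poly p t"
  proof (rule poly_of_locally_rational)
    fix t0
    obtain a b G H where *: "form 1 a G" "form 1 b H" "H (chart_pt i j t0) \<noteq> 0"
      "\<And>v. (\<And>i. i > 1 \<Longrightarrow> v i = 0) \<Longrightarrow> H v \<noteq> 0 \<Longrightarrow> v \<in> \<Union>(chart i) \<and> s v = G v / H v"
      using twistD[OF s chart_pt_cone[OF ij]] by metis
    obtain g h where gh: "\<And>t. G (chart_pt i j t) = poly g t" "\<And>t. H (chart_pt i j t) = poly h t"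
      unfolding chart_pt_def using form_along_line[OF *(1)] form_along_line[OF *(2)] by metis
    have "chart_pt i j t l = 0" if "l > 1" for t and l :: nat using that ij by (auto simp: chart_pt_def)
    then have "s (chart_pt i j t) = poly g t / poly h t" if "poly h t \<noteq> 0" for t
      using *(4)[of "chart_pt i j t"] that gh by auto
    then show "\<exists>g h. poly h t0 \<noteq> 0 \<and> (\<forall>t. poly h t \<noteq> 0 \<longrightarrow> s (chart_pt i j t) * poly h t = poly g t)"
      using *(3) gh by (intro exI[of _ g] exI[of _ h]) auto
  qed
  then obtain p where p: "\<And>t. s (chart_pt i j t) = poly p t" by blast
  have "s u = u i powi d * poly p (u j / u i)" if u: "u \<in> \<Union>(chart i)" for u
  proof -
    have "u i \<noteq> 0" using u unfolding cone_chart[OF ij(1)] by blast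
    have "s u = s (\<lambda>l. u i * chart_pt i j (u j / u i) l)"
      using cone_eq_scale_chart_pt[OF ij u] by simp
    also have "\<dots> = u i powi d * s (chart_pt i j (u j / u i))"
      by (rule twist_scale[OF s chart_pt_cone[OF ij] \<open>u i \<noteq> 0\<close> basic_open_subset])
    finally show ?thesis using p by simp
  qed
  then show ?thesis by blast
qed

lemma poly_chart_twist:
  assumes ij: "i \<le> 1" "j \<le> 1"
  shows "(\<lambda>u. u i powi d * poly p (u j / u i)) \<in> twist 1 d (chart i)"
proof (induction p)
  case 0
  then show ?case using twist_zero[OF open_chart[OF ij(1)]] by simp
next
  case (pCons a p)
  note op = open_chart[OF ij(1)]
  have ui: "(\<lambda>u. u i) \<in> twist 1 1 (chart i)" using twist_form[OF form_var[OF ij(1)] op] by simp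
  have uj: "(\<lambda>u. u j) \<in> twist 1 1 (chart i)" using twist_form[OF form_var[OF ij(2)] op] by simp
  have nz: "\<And>u. u \<in> \<Union>(chart i) \<Longrightarrow> u i \<noteq> 0" unfolding cone_chart[OF ij(1)] by blast
  have pw: "form 1 k (\<lambda>u. u i ^ k)" for k using form_power[OF form_var[OF ij(1)], of k] by simp
  have "(\<lambda>u. u i powi d) \<in> twist 1 d (chart i)"
  proof (cases "d \<ge> 0")
    case True
    then show ?thesis using twist_form[OF pw[of "nat d"] op] by (simp add: power_int_def)
  next
    case False
    have "(\<lambda>u. inverse (u i ^ nat (- d))) \<in> twist 1 (- int (nat (- d))) (chart i)"
      using nz by (intro twist_inverse twist_form pw op) auto
    then show ?thesis using False by (simp add: power_int_def power_inverse)
  qed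
  then have 1: "(\<lambda>u. a * u i powi d) \<in> twist 1 d (chart i)" using op by (rule twist_const_mult)
  have "(\<lambda>u. inverse (u i)) \<in> twist 1 (- 1) (chart i)"
    by (rule twist_inverse[OF ui _ op]) (rule nz)
  then have "(\<lambda>u. u j * inverse (u i)) \<in> twist 1 0 (chart i)"
    using uj op by (intro twist_mult[of "\<lambda>u. u j" _ 1 _ _ "- 1"]) auto
  from twist_mult[OF this pCons.IH _ op]
  have 2: "(\<lambda>u. u j * inverse (u i) * (u i powi d * poly p (u j / u i))) \<in> twist 1 d (chart i)" by simp
  show ?case by (rule twist_cong[OF twist_add[OF 1 2 op]]) (simp add: field_simps)
qed

section \<open>Directional derivatives as tangent vectors\<close>

text \<open>The function is \<open>P / Q\<close> near \<open>0\<close>. Nothing is claimed where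
  \<open>Q\<close> vanishes, since there \<open>\<gamma>\<close> may take arbitrary values.\<close>

definition arc_rep :: "('k::field \<Rightarrow> 'k) \<Rightarrow> 'k poly \<Rightarrow> 'k poly \<Rightarrow> bool" where
  "arc_rep \<gamma> P Q \<longleftrightarrow> poly Q 0 \<noteq> 0 \<and> (\<forall>z. poly Q z \<noteq> 0 \<longrightarrow> \<gamma> z * poly Q z = poly P z)"

text \<open>By the quotient rule, \<open>d\<close> is the derivative of \<open>P / Q\<close> at \<open>0\<close>.\<close>

definition arc_deriv :: "('k::field \<Rightarrow> 'k) \<Rightarrow> 'k" where
  "arc_deriv \<gamma> = (SOME d. \<exists>P Q. arc_rep \<gamma> P Q \<and> d * coeff Q 0 = coeff P 1 - \<gamma> 0 * coeff Q 1)"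

lemma coeff_mult_1: "coeff (p * q) 1 = coeff p 0 * coeff q 1 + coeff p 1 * coeff q (0::nat)"
  for p q :: "'a::comm_semiring_0 poly"
  by (simp add: coeff_mult sum.atMost_Suc)

lemma arc_rep_coeff_0: "arc_rep \<gamma> P Q \<Longrightarrow> coeff P 0 = \<gamma> 0 * coeff Q 0 \<and> coeff Q 0 \<noteq> 0"
  unfolding arc_rep_def by (auto simp: poly_0_coeff_0 dest!: spec[of _ 0])

text \<open>Any two representations satisfy \<open>P * Q' = P' * Q\<close>. Its coefficients in
  degree 1, together with \<open>coeff P 0 = \<gamma> 0 * coeff Q 0\<close>, show that both give the
  same derivative.\<close>

lemma arc_deriv_eqI:
  fixes \<gamma> :: "'k::alg_closed_field \<Rightarrow> 'k"
  assumes rep: "arc_rep \<gamma> P Q" and d: "d * coeff Q 0 = coeff P 1 - \<gamma> 0 * coeff Q 1"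
  shows "arc_deriv \<gamma> = d"
  unfolding arc_deriv_def
proof (rule some_equality)
  show "\<exists>P Q. arc_rep \<gamma> P Q \<and> d * coeff Q 0 = coeff P 1 - \<gamma> 0 * coeff Q 1" using assms by blast
  fix d' assume "\<exists>P Q. arc_rep \<gamma> P Q \<and> d' * coeff Q 0 = coeff P 1 - \<gamma> 0 * coeff Q 1"
  then obtain P' Q' where rep': "arc_rep \<gamma> P' Q'"
    and d': "d' * coeff Q' 0 = coeff P' 1 - \<gamma> 0 * coeff Q' 1" by blast
  have "P * Q' = P' * Q"
  proof (rule poly_eq_of_dense[of "Q * Q'"])
    show "Q * Q' \<noteq> 0" using rep rep' by (auto simp: arc_rep_def)
    fix x assume "poly (Q * Q') x \<noteq> 0"
    then have "\<gamma> x * poly Q x = poly P x" "\<gamma> x * poly Q' x = poly P' x"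
      using rep rep' by (auto simp: arc_rep_def)
    then show "poly (P * Q') x = poly (P' * Q) x" by (simp flip: \<open>_ = poly P x\<close> \<open>_ = poly P' x\<close>)
  qed
  then have c: "coeff P 0 * coeff Q' 1 + coeff P 1 * coeff Q' 0
      = coeff P' 0 * coeff Q 1 + coeff P' 1 * coeff Q 0"
    using coeff_mult_1 by metis
  note z = arc_rep_coeff_0[OF rep] arc_rep_coeff_0[OF rep']
  have P1: "coeff P 1 = d * coeff Q 0 + \<gamma> 0 * coeff Q 1" using d by simp
  have P1': "coeff P' 1 = d' * coeff Q' 0 + \<gamma> 0 * coeff Q' 1" using d' by simp
  have "(d' - d) * (coeff Q 0 * coeff Q' 0) = 0"
    using c z unfolding P1 P1' by (simp add: algebra_simps)
  then show "d' = d" using z by simp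
qed

lemma arc_deriv_eq:
  fixes \<gamma> :: "'k::alg_closed_field \<Rightarrow> 'k"
  assumes "arc_rep \<gamma> P Q"
  shows "arc_deriv \<gamma> = (coeff P 1 - \<gamma> 0 * coeff Q 1) / coeff Q 0"
  by (rule arc_deriv_eqI[OF assms]) (use arc_rep_coeff_0[OF assms] in simp)

lemma arc_deriv_const: "arc_deriv (\<lambda>z. c :: 'k::alg_closed_field) = 0"
  using arc_deriv_eq[of "\<lambda>z. c" "[:c:]" 1] by (simp add: arc_rep_def)

lemma arc_deriv_add:
  fixes \<gamma> \<delta> :: "'k::alg_closed_field \<Rightarrow> 'k"
  assumes "arc_rep \<gamma> P Q" "arc_rep \<delta> R S"
  shows "arc_deriv (\<lambda>z. \<gamma> z + \<delta> z) = arc_deriv \<gamma> + arc_deriv \<delta>"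
proof (rule arc_deriv_eqI)
  show "arc_rep (\<lambda>z. \<gamma> z + \<delta> z) (P * S + R * Q) (Q * S)"
    unfolding arc_rep_def
  proof (intro conjI allI impI)
    show "poly (Q * S) 0 \<noteq> 0" using assms by (simp add: arc_rep_def)
    fix z assume "poly (Q * S) z \<noteq> 0"
    then have "\<gamma> z * poly Q z = poly P z" "\<delta> z * poly S z = poly R z"
      using assms by (auto simp: arc_rep_def)
    then show "(\<gamma> z + \<delta> z) * poly (Q * S) z = poly (P * S + R * Q) z"
      by (simp add: algebra_simps flip: \<open>_ = poly P z\<close> \<open>_ = poly R z\<close>)
  qed
  note z = arc_rep_coeff_0[OF assms(1)] arc_rep_coeff_0[OF assms(2)]
  show "(arc_deriv \<gamma> + arc_deriv \<delta>) * coeff (Q * S) 0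
      = coeff (P * S + R * Q) 1 - (\<gamma> 0 + \<delta> 0) * coeff (Q * S) 1"
    unfolding coeff_add coeff_mult_1 coeff_mult_0 arc_deriv_eq[OF assms(1)] arc_deriv_eq[OF assms(2)]
    using z by (simp add: field_simps)
qed

lemma arc_deriv_mult:
  fixes \<gamma> \<delta> :: "'k::alg_closed_field \<Rightarrow> 'k"
  assumes "arc_rep \<gamma> P Q" "arc_rep \<delta> R S"
  shows "arc_deriv (\<lambda>z. \<gamma> z * \<delta> z) = \<gamma> 0 * arc_deriv \<delta> + \<delta> 0 * arc_deriv \<gamma>"
proof (rule arc_deriv_eqI)
  show "arc_rep (\<lambda>z. \<gamma> z * \<delta> z) (P * R) (Q * S)"
    unfolding arc_rep_def
  proof (intro conjI allI impI)
    show "poly (Q * S) 0 \<noteq> 0" using assms by (simp add: arc_rep_def)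
    fix z assume "poly (Q * S) z \<noteq> 0"
    then have "\<gamma> z * poly Q z = poly P z" "\<delta> z * poly S z = poly R z"
      using assms by (auto simp: arc_rep_def)
    then show "(\<gamma> z * \<delta> z) * poly (Q * S) z = poly (P * R) z"
      by (simp add: mult_ac flip: \<open>_ = poly P z\<close> \<open>_ = poly R z\<close>)
  qed
  note z = arc_rep_coeff_0[OF assms(1)] arc_rep_coeff_0[OF assms(2)]
  show "(\<gamma> 0 * arc_deriv \<delta> + \<delta> 0 * arc_deriv \<gamma>) * coeff (Q * S) 0
      = coeff (P * R) 1 - (\<gamma> 0 * \<delta> 0) * coeff (Q * S) 1"
    unfolding coeff_mult_1 coeff_mult_0 arc_deriv_eq[OF assms(1)] arc_deriv_eq[OF assms(2)]
    using z by (simp add: field_simps)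
qed

lemma arc_rep_cong:
  fixes \<gamma> \<delta> :: "'k::alg_closed_field \<Rightarrow> 'k"
  assumes "arc_rep \<gamma> P Q" "poly R 0 \<noteq> 0" "\<And>z. poly R z \<noteq> 0 \<Longrightarrow> \<gamma> z = \<delta> z"
  shows "arc_rep \<delta> (P * R) (Q * R)"
  using assms by (auto simp: arc_rep_def)

lemma arc_deriv_cong:
  fixes \<gamma> \<delta> :: "'k::alg_closed_field \<Rightarrow> 'k"
  assumes "arc_rep \<gamma> P Q" "poly R 0 \<noteq> 0" "\<And>z. poly R z \<noteq> 0 \<Longrightarrow> \<gamma> z = \<delta> z"
  shows "arc_deriv \<delta> = arc_deriv \<gamma>"
proof (rule arc_deriv_eqI[OF arc_rep_cong[OF assms]])
  note z = arc_rep_coeff_0[OF assms(1)]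
  have "\<delta> 0 = \<gamma> 0" using assms by simp
  then show "arc_deriv \<gamma> * coeff (Q * R) 0 = coeff (P * R) 1 - \<delta> 0 * coeff (Q * R) 1"
    unfolding coeff_mult_1 coeff_mult_0 arc_deriv_eq[OF assms(1)] using z by (simp add: field_simps)
qed

section \<open>Functions along straight arcs\<close>

abbreviation arc :: "'k::field vec \<Rightarrow> 'k vec \<Rightarrow> 'k \<Rightarrow> 'k vec" where
  "arc x w z \<equiv> (\<lambda>i. x i + z * w i)"

lemma arc_rep_twist:
  assumes "s \<in> twist n d U" "x \<in> \<Union>U" "U \<subseteq> proj_space n" "\<And>i. i > n \<Longrightarrow> w i = 0"
  shows "\<exists>P Q. arc_rep (\<lambda>z. s (arc x w z)) P Q"
proof -
  obtain a b G H where *: "form n a G" "form n b H" "H x \<noteq> 0"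
    "\<And>v. (\<And>i. i > n \<Longrightarrow> v i = 0) \<Longrightarrow> H v \<noteq> 0 \<Longrightarrow> v \<in> \<Union>U \<and> s v = G v / H v"
    using twistD[OF assms(1,2)] by metis
  have x: "\<And>i. i > n \<Longrightarrow> x i = 0" using assms(2,3) cone_iff by blast
  obtain P Q where PQ: "\<And>z. G (arc x w z) = poly P z" "\<And>z. H (arc x w z) = poly Q z"
    using form_along_line[OF *(1), of x w] form_along_line[OF *(2), of x w] by blast
  have "arc_rep (\<lambda>z. s (arc x w z)) P Q"
    unfolding arc_rep_def
  proof (intro conjI allI impI)
    show "poly Q 0 \<noteq> 0" using PQ(2)[of 0] *(3) by simp
    fix z assume "poly Q z \<noteq> 0"
    then show "s (arc x w z) * poly Q z = poly P z"
      using *(4)[of "arc x w z"] x assms(4) unfolding PQ by simp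
  qed
  then show ?thesis by blast
qed

text \<open>Besides the form that cuts out a neighbourhood, \<open>R\<close> contains the factor
  \<open>[:x i, w i:]\<close>, which keeps coordinate \<open>i\<close> of the arc nonzero and hence
  the arc in the punctured cone.\<close>

lemma open_along_arc:
  assumes "zariski_open n U" "x \<in> \<Union>U" "\<And>i. i > n \<Longrightarrow> w i = 0"
  shows "\<exists>R. poly R 0 \<noteq> 0 \<and> (\<forall>z. poly R z \<noteq> 0 \<longrightarrow> arc x w z \<in> \<Union>U)"
proof -
  obtain d P where P: "form n d P" "P x \<noteq> 0"
    "\<And>v. v \<in> \<Union>(proj_space n) \<Longrightarrow> P v \<noteq> 0 \<Longrightarrow> v \<in> \<Union>U" using zariski_openD[OF assms(1,2)] by metis
  have "x \<in> \<Union>(proj_space n)" using assms(1,2) zariski_open_subset by blast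
  then obtain i where i: "x i \<noteq> 0" and x: "\<And>i. i > n \<Longrightarrow> x i = 0" unfolding cone_iff by blast
  obtain p where p: "\<And>z. P (arc x w z) = poly p z" using form_along_line[OF P(1), of x w] by blast
  have "poly (p * [:x i, w i:]) 0 \<noteq> 0" using i P(2) p[of 0] by simp
  moreover have "arc x w z \<in> \<Union>U" if "poly (p * [:x i, w i:]) z \<noteq> 0" for z
  proof (rule P(3))
    show "arc x w z \<in> \<Union>(proj_space n)"
      unfolding cone_iff
    proof (intro conjI exI[of _ i] allI impI)
      have "poly [:x i, w i:] z \<noteq> 0" using that by (metis mult_zero_right poly_mult)
      then show "arc x w z i \<noteq> 0" by simp
    qed (use x assms(3) in simp)
    show "P (arc x w z) \<noteq> 0" using that p by auto
  qed
  ultimately show ?thesis by blast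
qed

text \<open>Zero outside the stalk, as the normalisation in \<open>tangent_space\<close>
  demands.\<close>

definition dir_deriv :: "nat \<Rightarrow> 'k::field vec \<Rightarrow> 'k vec \<Rightarrow> ('k vec \<Rightarrow> 'k) \<Rightarrow> 'k" where
  "dir_deriv n x w g = (if g \<in> stalk n (line x) then arc_deriv (\<lambda>z. g (arc x w z)) else 0)"

lemma stalkD:
  assumes "g \<in> stalk n (line x)"
  obtains W where "zariski_open n W" "x \<in> \<Union>W" "g \<in> regular n W"
proof -
  obtain W where W: "zariski_open n W" "line x \<in> W" "g \<in> regular n W"
    using assms unfolding stalk_def by blast
  moreover from W(2) have "x \<in> \<Union>W" using line_self by blast
  ultimately show ?thesis using that by blast
qed

lemma stalk_common:
  assumes "g \<in> stalk n (line x)" "h \<in> stalk n (line x)"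
  obtains W where "zariski_open n W" "line x \<in> W" "g \<in> regular n W" "h \<in> regular n W"
proof -
  obtain W W' where W: "zariski_open n W" "line x \<in> W" "g \<in> regular n W"
    "zariski_open n W'" "line x \<in> W'" "h \<in> regular n W'"
    using assms unfolding stalk_def by blast
  show ?thesis
  proof (rule that[of "W \<inter> W'"])
    show op: "zariski_open n (W \<inter> W')" using W zariski_open_Int by blast
    show "g \<in> regular n (W \<inter> W')" "h \<in> regular n (W \<inter> W')"
      using twist_restrict[OF W(3) op] twist_restrict[OF W(6) op] by auto
  qed (use W in blast)
qed

lemma stalk_add:
  assumes "g \<in> stalk n (line x)" "h \<in> stalk n (line x)"
  shows "(\<lambda>v. g v + h v) \<in> stalk n (line x)"
proof -
  obtain W where "zariski_open n W" "line x \<in> W" "g \<in> regular n W" "h \<in> regular n W"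
    using stalk_common[OF assms] by metis
  then show ?thesis using twist_add[of g n 0 W h] unfolding stalk_def by auto
qed

lemma stalk_mult:
  assumes "g \<in> stalk n (line x)" "h \<in> stalk n (line x)"
  shows "(\<lambda>v. g v * h v) \<in> stalk n (line x)"
proof -
  obtain W where "zariski_open n W" "line x \<in> W" "g \<in> regular n W" "h \<in> regular n W"
    using stalk_common[OF assms] by metis
  then show ?thesis using twist_mult[of g n 0 W h 0 0] unfolding stalk_def by auto
qed

lemma stalk_const:
  assumes "x \<in> \<Union>(proj_space n)" shows "(\<lambda>v. c) \<in> stalk n (line x)"
proof -
  have "(\<lambda>v. c) \<in> regular n (proj_space n)"
    using twist_form[OF form_const[of n c] zariski_open_UNIV] by simp
  then show ?thesis
    using zariski_open_UNIV line_in_proj_space[OF assms] unfolding stalk_def by blast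
qed

lemma arc_rep_stalk:
  assumes "g \<in> stalk n (line x)" "\<And>i. i > n \<Longrightarrow> w i = 0"
  shows "\<exists>P Q. arc_rep (\<lambda>z. g (arc x w z)) P Q"
proof -
  obtain W where W: "zariski_open n W" "x \<in> \<Union>W" "g \<in> regular n W" using stalkD[OF assms(1)] by metis
  show ?thesis
    by (rule arc_rep_twist[of g n 0 W x w, OF W(3,2) zariski_open_subset[OF W(1)] assms(2)])
qed

text \<open>The conditions on \<open>P\<close> say that \<open>F\<close> vanishes to order at least
  two along the arc. By the product rule the derivative then kills all multiples of
  \<open>F\<close>.\<close>

lemma dir_deriv_tangent:
  fixes x w :: "'k::alg_closed_field vec"
  assumes x: "x \<in> \<Union>(proj_space n)" and w: "\<And>i. i > n \<Longrightarrow> w i = 0"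
    and F: "\<And>z. F (arc x w z) = poly P z" "coeff P 0 = 0" "coeff P 1 = 0"
  shows "dir_deriv n x w \<in> tangent_space n d F (line x)"
  unfolding tangent_space_def
proof (intro CollectI conjI ballI allI impI)
  fix g h assume g: "g \<in> stalk n (line x)" and h: "h \<in> stalk n (line x)"
  obtain P Q where P: "arc_rep (\<lambda>z. g (arc x w z)) P Q" using arc_rep_stalk[of g n x w, OF g w] by blast
  obtain R S where R: "arc_rep (\<lambda>z. h (arc x w z)) R S" using arc_rep_stalk[of h n x w, OF h w] by blast
  show "dir_deriv n x w (\<lambda>v. g v + h v) = dir_deriv n x w g + dir_deriv n x w h"
    using g h stalk_add[OF g h] arc_deriv_add[OF P R] by (simp add: dir_deriv_def)
  fix v assume v: "v \<in> line x"
  \<comment> \<open>Elements of the stalk are homogeneous of degree 0, hence constant on the line,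
    so the Leibniz rule at \<open>v\<close> is the one at \<open>x\<close>.\<close>
  have "g' v = g' x" if "g' \<in> stalk n (line x)" for g'
  proof -
    obtain W where W: "zariski_open n W" "x \<in> \<Union>W" "g' \<in> regular n W" using stalkD[OF \<open>g' \<in> _\<close>] by metis
    obtain c where "v = (\<lambda>i. c * x i)" "c \<noteq> 0" using v unfolding line_def by blast
    then show ?thesis using twist_scale[OF W(3,2) _ zariski_open_subset[OF W(1)]] by simp
  qed
  then have "g v = g x" "h v = h x" using g h by auto
  then show "dir_deriv n x w (\<lambda>v. g v * h v) = g v * dir_deriv n x w h + h v * dir_deriv n x w g"
    using g h stalk_mult[OF g h] arc_deriv_mult[OF P R] by (simp add: dir_deriv_def)
next
  fix c show "dir_deriv n x w (\<lambda>v. c) = 0" by (simp add: dir_deriv_def arc_deriv_const)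
next
  fix g h assume g: "g \<in> stalk n (line x)" and h: "h \<in> stalk n (line x)"
    and "\<exists>W. zariski_open n W \<and> line x \<in> W \<and> (\<forall>v\<in>\<Union>W. g v = h v)"
  then obtain W where W: "zariski_open n W" "line x \<in> W" "\<forall>v\<in>\<Union>W. g v = h v" by blast
  then have "x \<in> \<Union>W" using line_self by blast
  then obtain R where R: "poly R 0 \<noteq> 0" "\<And>z. poly R z \<noteq> 0 \<Longrightarrow> arc x w z \<in> \<Union>W"
    using open_along_arc[of n W x w, OF W(1) _ w] by blast
  obtain P Q where P: "arc_rep (\<lambda>z. g (arc x w z)) P Q" using arc_rep_stalk[of g n x w, OF g w] by blast
  have "arc_deriv (\<lambda>z. h (arc x w z)) = arc_deriv (\<lambda>z. g (arc x w z))"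
    by (rule arc_deriv_cong[OF P R(1)]) (use R(2) W(3) in blast)
  then show "dir_deriv n x w g = dir_deriv n x w h" using g h by (simp add: dir_deriv_def)
next
  fix g assume "g \<in> ideal_stalk n d F (line x)"
  then obtain W s where W: "zariski_open n W" "line x \<in> W" "s \<in> twist n (- int d) W"
    "\<forall>v\<in>\<Union>W. g v = F v * s v" unfolding ideal_stalk_def by blast
  then have xW: "x \<in> \<Union>W" using line_self by blast
  then obtain R where R: "poly R 0 \<noteq> 0" "\<And>z. poly R z \<noteq> 0 \<Longrightarrow> arc x w z \<in> \<Union>W"
    using open_along_arc[of n W x w, OF W(1) _ w] by blast
  obtain P' Q' where s: "arc_rep (\<lambda>z. s (arc x w z)) P' Q'"
    using arc_rep_twist[of s n _ W x w, OF W(3) xW zariski_open_subset[OF W(1)] w] by blast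
  have FP: "arc_rep (\<lambda>z. F (arc x w z)) P 1" using F by (simp add: arc_rep_def)
  have F0: "F (arc x w 0) = 0" unfolding F(1) by (simp add: poly_0_coeff_0 F(2))
  have "arc_deriv (\<lambda>z. F (arc x w z)) = 0" using arc_deriv_eq[OF FP] F by simp
  then have "arc_deriv (\<lambda>z. F (arc x w z) * s (arc x w z)) = 0"
    using arc_deriv_mult[OF FP s] F0 by simp
  moreover have "arc_rep (\<lambda>z. F (arc x w z) * s (arc x w z)) (P * P') (1 * Q')"
    using s F by (auto simp: arc_rep_def mult_ac)
  then have "arc_deriv (\<lambda>z. g (arc x w z)) = arc_deriv (\<lambda>z. F (arc x w z) * s (arc x w z))"
    by (rule arc_deriv_cong[OF _ R(1)]) (rule W(4)[rule_format, OF R(2), symmetric])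
  ultimately show "dir_deriv n x w g = 0" by (simp add: dir_deriv_def)
next
  fix g assume "g \<notin> stalk n (line x)" then show "dir_deriv n x w g = 0" by (simp add: dir_deriv_def)
qed

section \<open>Directional derivatives varying with the point of the curve\<close>

lemma form_comp_twist:
  assumes "form n a G" "zariski_open m U" "\<And>i. i \<le> n \<Longrightarrow> (\<lambda>u. f u i) \<in> twist m e U"
  shows "(\<lambda>u. G (f u)) \<in> twist m (int a * e) U"
  using assms(1)
proof (induction rule: form.induct)
  case (form_const c)
  then show ?case using twist_form[OF form.form_const assms(2)] by simp
next
  case (form_var i)
  then show ?case using assms(3) by simp
next
  case (form_add d P Q)
  then show ?case using twist_add assms(2) by blast
next
  case (form_mult a P b Q)
  then show ?case using assms(2) by (auto intro!: twist_mult simp: algebra_simps)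
qed

text \<open>The product rule, by induction on the form. Differentiation replaces one factor
  \<open>f u i\<close> of degree \<open>e\<close> by \<open>V u i\<close> of degree
  \<open>e + c\<close>, which raises the degree \<open>a * e\<close> of the composition by
  \<open>c\<close>.\<close>

lemma form_deriv_twist:
  assumes "form n a G" "zariski_open m U" "\<And>i. i \<le> n \<Longrightarrow> (\<lambda>u. f u i) \<in> twist m e U"
    "\<And>i. i \<le> n \<Longrightarrow> (\<lambda>u. V u i) \<in> twist m (e + c) U"
  shows "\<exists>\<delta>\<in>twist m (int a * e + c) U. \<forall>u. \<exists>P. (\<forall>z. G (arc (f u) (V u) z) = poly P z) \<and> coeff P 1 = \<delta> u"
  using assms(1)
proof (induction rule: form.induct)
  case (form_const k)
  then show ?case using twist_zero[OF assms(2), of "int 0 * e + c"]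
    by (intro bexI[of _ "\<lambda>_. 0"]) (auto intro!: exI[of _ "[:k:]"])
next
  case (form_var i)
  show ?case using assms(4)[OF form_var]
    by (intro bexI[of _ "\<lambda>u. V u i"]) (auto intro!: exI[of _ "[:f _ i, V _ i:]"])
next
  case (form_add d P Q)
  then obtain \<delta> \<delta>' where *: "\<delta>\<in>twist m (int d * e + c) U" "\<delta>'\<in>twist m (int d * e + c) U"
    "\<And>u. \<exists>p. (\<forall>z. P (arc (f u) (V u) z) = poly p z) \<and> coeff p 1 = \<delta> u"
    "\<And>u. \<exists>p. (\<forall>z. Q (arc (f u) (V u) z) = poly p z) \<and> coeff p 1 = \<delta>' u" by blast
  show ?case
  proof (rule bexI[OF _ twist_add[OF *(1,2) assms(2)]], rule allI)
    fix u
    obtain p p' where "\<forall>z. P (arc (f u) (V u) z) = poly p z" "coeff p 1 = \<delta> u"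
      "\<forall>z. Q (arc (f u) (V u) z) = poly p' z" "coeff p' 1 = \<delta>' u" using *(3,4) by meson
    then show "\<exists>p. (\<forall>z. P (arc (f u) (V u) z) + Q (arc (f u) (V u) z) = poly p z) \<and> coeff p 1 = \<delta> u + \<delta>' u"
      by (intro exI[of _ "p + p'"]) auto
  qed
next
  case (form_mult a P b Q)
  then obtain \<delta> \<delta>' where *: "\<delta>\<in>twist m (int a * e + c) U" "\<delta>'\<in>twist m (int b * e + c) U"
    "\<And>u. \<exists>p. (\<forall>z. P (arc (f u) (V u) z) = poly p z) \<and> coeff p 1 = \<delta> u"
    "\<And>u. \<exists>p. (\<forall>z. Q (arc (f u) (V u) z) = poly p z) \<and> coeff p 1 = \<delta>' u" by blast
  note comp = form_comp_twist[of n a P m U f e, OF form_mult(1) assms(2,3)]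
    form_comp_twist[of n b Q m U f e, OF form_mult(2) assms(2,3)]
  have "(\<lambda>u. P (f u) * \<delta>' u + \<delta> u * Q (f u)) \<in> twist m (int (a + b) * e + c) U"
    by (intro twist_add twist_mult[OF comp(1) *(2)] twist_mult[OF *(1) comp(2)] assms(2))
      (auto simp: algebra_simps)
  then show ?case
  proof (rule bexI[rotated], intro allI)
    fix u
    obtain p p' where p: "\<And>z. P (arc (f u) (V u) z) = poly p z" "coeff p 1 = \<delta> u"
      "\<And>z. Q (arc (f u) (V u) z) = poly p' z" "coeff p' 1 = \<delta>' u" using *(3,4) by meson
    have "coeff p 0 = P (f u)" "coeff p' 0 = Q (f u)"
      using p(1)[of 0] p(3)[of 0] by (auto simp: poly_0_coeff_0)
    then show "\<exists>p. (\<forall>z. P (arc (f u) (V u) z) * Q (arc (f u) (V u) z) = poly p z) \<and>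
        coeff p 1 = P (f u) * \<delta>' u + \<delta> u * Q (f u)"
      using p by (intro exI[of _ "p * p'"]) (simp add: coeff_mult_1[unfolded One_nat_def])
  qed
qed

text \<open>The quotient rule for \<open>g = G / H\<close>: as \<open>G\<close> and \<open>H\<close>
  have equal degree, the quotient of \<open>\<delta>G * H - G * \<delta>H\<close> by the square of
  \<open>H\<close> is homogeneous of degree \<open>c\<close> in \<open>u\<close>.\<close>

lemma arc_deriv_twist:
  fixes f V :: "'k::alg_closed_field vec \<Rightarrow> 'k vec"
  assumes g: "g \<in> regular n V'" and U: "zariski_open m U"
    and f: "\<And>i. i \<le> n \<Longrightarrow> (\<lambda>u. f u i) \<in> twist m e U" "\<And>u. u \<in> \<Union>U \<Longrightarrow> f u \<in> \<Union>V'"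
      "\<And>u i. u \<in> \<Union>U \<Longrightarrow> i > n \<Longrightarrow> f u i = 0"
    and V: "\<And>i. i \<le> n \<Longrightarrow> (\<lambda>u. V u i) \<in> twist m (e + c) U" "\<And>u i. u \<in> \<Union>U \<Longrightarrow> i > n \<Longrightarrow> V u i = 0"
  shows "(\<lambda>u. arc_deriv (\<lambda>z. g (arc (f u) (V u) z))) \<in> twist m c U"
proof (rule twist_local[OF _ zariski_open_subset[OF U]])
  fix u0 assume u0: "u0 \<in> \<Union>U"
  obtain a b G H where *: "form n a G" "form n b H" "int a - int b = 0" "H (f u0) \<noteq> 0"
    "\<And>v. (\<And>i. i > n \<Longrightarrow> v i = 0) \<Longrightarrow> H v \<noteq> 0 \<Longrightarrow> v \<in> \<Union>V' \<and> g v = G v / H v"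
    using twistD[OF g f(2)[OF u0]] by metis
  have Hf: "(\<lambda>u. H (f u)) \<in> twist m (int b * e) U" by (rule form_comp_twist[OF *(2) U f(1)])
  obtain a' b' G' H' where h: "form m a' G'" "form m b' H'" "H' u0 \<noteq> 0"
    "\<And>v. (\<And>i. i > m \<Longrightarrow> v i = 0) \<Longrightarrow> H' v \<noteq> 0 \<Longrightarrow> v \<in> \<Union>U \<and> H (f v) = G' v / H' v"
    using twistD[OF Hf u0] by metis
  \<comment> \<open>Where \<open>G'\<close> and \<open>H'\<close> are both nonzero, \<open>u\<close>
    lies in the cone over \<open>U\<close> and \<open>H (f u) = G' u / H' u\<close> is
    nonzero.\<close>
  define W where "W = basic_open m (\<lambda>u. G' u * H' u)"
  note fW = form_mult[OF h(1,2)]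
  have op: "zariski_open m W" unfolding W_def by (rule zariski_open_basic[OF fW])
  have W: "u \<in> \<Union>U \<and> H (f u) \<noteq> 0" if "u \<in> \<Union>W" for u
    using that h(4)[of u] unfolding W_def cone_basic_open[OF fW] cone_iff by auto
  have WU: "W \<subseteq> U"
  proof
    fix y assume y: "y \<in> W"
    then obtain u where "u \<in> \<Union>W" "y = line u"
      using zariski_open_subset[OF op] line_self unfolding proj_space_def by blast
    then show "y \<in> U" using W mem_Union_iff[OF zariski_open_subset[OF U]] by blast
  qed
  have u0W: "u0 \<in> \<Union>W"
  proof -
    have cu0: "u0 \<in> \<Union>(proj_space m)" using u0 zariski_open_subset[OF U] by blast
    then have "H (f u0) = G' u0 / H' u0" using h(3) h(4)[of u0] unfolding cone_iff by blast
    then have "G' u0 * H' u0 \<noteq> 0" using h(3) *(4) by auto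
    then show ?thesis unfolding W_def cone_basic_open[OF fW] using cu0 by blast
  qed
  obtain \<delta>G where G: "\<delta>G \<in> twist m (int a * e + c) U"
    "\<And>u. \<exists>P. (\<forall>z. G (arc (f u) (V u) z) = poly P z) \<and> coeff P 1 = \<delta>G u"
    using form_deriv_twist[of n a G m U f e V c, OF *(1) U f(1) V(1)] by blast
  obtain \<delta>H where H: "\<delta>H \<in> twist m (int b * e + c) U"
    "\<And>u. \<exists>P. (\<forall>z. H (arc (f u) (V u) z) = poly P z) \<and> coeff P 1 = \<delta>H u"
    using form_deriv_twist[of n b H m U f e V c, OF *(2) U f(1) V(1)] by blast
  have eq: "arc_deriv (\<lambda>z. g (arc (f u) (V u) z))
      = (\<delta>G u * H (f u) - G (f u) * \<delta>H u) * (inverse (H (f u)) * inverse (H (f u)))" if u: "u \<in> \<Union>W" for u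
  proof -
    obtain P Q where P: "\<And>z. G (arc (f u) (V u) z) = poly P z" "coeff P 1 = \<delta>G u"
      "\<And>z. H (arc (f u) (V u) z) = poly Q z" "coeff Q 1 = \<delta>H u" using G(2)[of u] H(2)[of u] by blast
    note Wu = W[OF u]
    have g0: "g (f u) = G (f u) / H (f u)" using *(5)[of "f u"] Wu f(3) by blast
    have z0: "poly P 0 = G (f u)" "poly Q 0 = H (f u)" using P(1)[of 0] P(3)[of 0] by auto
    have "arc_rep (\<lambda>z. g (arc (f u) (V u) z)) P Q"
      unfolding arc_rep_def
    proof (intro conjI allI impI)
      show "poly Q 0 \<noteq> 0" using z0 Wu by simp
      fix z assume "poly Q z \<noteq> 0"
      then show "g (arc (f u) (V u) z) * poly Q z = poly P z"
        using *(5)[of "arc (f u) (V u) z"] f(3) V(2) Wu unfolding P by simp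
    qed
    from arc_deriv_eq[OF this] show ?thesis
      using z0 Wu P(2,4) g0 by (simp add: poly_0_coeff_0 field_simps)
  qed
  note r = twist_restrict[OF _ op WU]
  have iH: "(\<lambda>u. inverse (H (f u))) \<in> twist m (- (int b * e)) W"
    by (rule twist_inverse[OF r[OF Hf] _ op]) (use W in blast)
  have Gf: "(\<lambda>u. G (f u)) \<in> twist m (int a * e) W" by (rule r[OF form_comp_twist[of n a G m U f e, OF *(1) U f(1)]])
  have num: "(\<lambda>u. \<delta>G u * H (f u) - G (f u) * \<delta>H u) \<in> twist m (int a * e + int b * e + c) W"
    by (intro twist_diff twist_mult[OF r[OF G(1)] r[OF Hf]] twist_mult[OF Gf r[OF H(1)]] op) auto
  have "(\<lambda>u. (\<delta>G u * H (f u) - G (f u) * \<delta>H u) * (inverse (H (f u)) * inverse (H (f u)))) \<in> twist m c W"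
    by (rule twist_mult[OF num twist_mult[OF iH iH refl op] _ op]) (use *(3) in auto)
  then have "(\<lambda>u. arc_deriv (\<lambda>z. g (arc (f u) (V u) z))) \<in> twist m c W"
    by (rule twist_cong) (simp add: eq)
  then show "\<exists>W. u0 \<in> \<Union>W \<and> W \<subseteq> U \<and> (\<lambda>u. arc_deriv (\<lambda>z. g (arc (f u) (V u) z))) \<in> twist m c W"
    using u0W WU by blast
qed

section \<open>Gluing over the projective line\<close>

text \<open>The same binary form of degree \<open>d\<close> in the coordinate of the other chart. As
  \<open>reflect_poly\<close> reverses with respect to \<open>degree p\<close>, a power of
  \<open>t\<close> makes up the difference to \<open>d\<close>.\<close>

definition reverse_to :: "nat \<Rightarrow> 'k::field poly \<Rightarrow> 'k poly" where
  "reverse_to d p = monom 1 (d - degree p) * reflect_poly p"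

lemma poly_reverse_to:
  assumes "degree p \<le> d" "t \<noteq> 0"
  shows "poly (reverse_to d p) t = t ^ d * poly p (inverse t)"
  using assms by (simp add: reverse_to_def poly_monom poly_reflect_poly_nz flip: power_add)

text \<open>The hypothesis is the change of charts for \<open>O(e)\<close>: a global section is a
  form of degree \<open>e\<close>, and it is zero for \<open>e < 0\<close>. Powers of
  \<open>t\<close> clear the negative exponents on both sides, and then degrees are
  compared.\<close>

lemma degree_le_of_reflected:
  fixes p p' :: "'k::alg_closed_field poly"
  assumes "\<And>t. t \<noteq> 0 \<Longrightarrow> poly p t = t powi e * poly p' (inverse t)" and "p \<noteq> 0"
  shows "int (degree p) \<le> e"
proof -
  define N where "N = degree p'"
  have eq: "poly p t * t ^ N = t powi e * poly (reflect_poly p') t" if "t \<noteq> 0" for t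
    using assms(1)[OF that] that by (simp add: poly_reflect_poly_nz N_def)
  have "p * monom 1 (N + nat (- e)) = monom 1 (nat e) * reflect_poly p'"
  proof (rule poly_eq_of_dense[of "[:0, 1:]"])
    fix t :: 'k assume "poly [:0, 1:] t \<noteq> 0"
    then have t: "t \<noteq> 0" by simp
    have "t powi e * t ^ nat (- e) = t ^ nat e" using t by (simp add: power_int_def power_inverse)
    moreover have "poly p t * (t ^ N * t ^ nat (- e)) = t powi e * t ^ nat (- e) * poly (reflect_poly p') t"
      unfolding mult.assoc[symmetric] eq[OF t] by (simp only: mult_ac)
    ultimately show "poly (p * monom 1 (N + nat (- e))) t = poly (monom 1 (nat e) * reflect_poly p') t"
      by (simp add: poly_monom power_add)
  qed simp
  moreover have "degree (p * monom 1 (N + nat (- e))) = degree p + (N + nat (- e))"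
    using assms(2) by (subst degree_mult_eq) (auto simp: degree_monom_eq)
  moreover have "degree (monom 1 (nat e) * reflect_poly p') \<le> nat e + N"
    using degree_mult_le[of "monom 1 (nat e)" "reflect_poly p'"] degree_reflect_poly_le[of p']
    by (simp add: degree_monom_eq N_def)
  ultimately have "degree p + (N + nat (- e)) \<le> nat e + N" by simp
  then show ?thesis by linarith
qed

text \<open>A nonzero combination of least degree divides every \<open>F i\<close>, because
  remainders are combinations too. Hence it has no root and is a constant.\<close>

lemma poly_bezout:
  fixes F :: "nat \<Rightarrow> 'k::alg_closed_field poly"
  assumes "\<And>t. \<exists>i\<le>n. poly (F i) t \<noteq> 0"
  shows "\<exists>A. (\<Sum>i\<le>n. A i * F i) = 1"
proof -
  define I where "I p \<longleftrightarrow> p \<noteq> 0 \<and> (\<exists>A. p = (\<Sum>i\<le>n. A i * F i))" for p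
  have F: "F i = (\<Sum>j\<le>n. (if j = i then 1 else 0) * F j)" if "i \<le> n" for i
    using that by (simp add: if_distrib[of "\<lambda>y. y * _"] cong: if_cong)
  obtain i where i: "i \<le> n" "poly (F i) 0 \<noteq> 0" using assms[of 0] by blast
  then have "F i \<noteq> 0" by auto
  with F[OF i(1)] have "I (F i)" unfolding I_def by (intro conjI exI)
  then obtain d where d: "I d" "\<And>p. I p \<Longrightarrow> degree d \<le> degree p"
    using ex_has_least_nat[of I "F i" degree] by blast
  then obtain A where A: "d = (\<Sum>i\<le>n. A i * F i)" "d \<noteq> 0" unfolding I_def by blast
  have dvd: "d dvd F i" if i: "i \<le> n" for i
  proof (rule ccontr)
    assume "\<not> d dvd F i"
    then have nz: "F i mod d \<noteq> 0" by (simp add: dvd_eq_mod_eq_0)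
    have "F i mod d = F i - F i div d * d" by (simp add: minus_div_mult_eq_mod)
    also have "\<dots> = (\<Sum>j\<le>n. ((if j = i then 1 else 0) - F i div d * A j) * F j)"
      unfolding left_diff_distrib sum_subtractf F[OF i, symmetric] A(1)
      by (simp add: sum_distrib_left mult.assoc)
    finally have "I (F i mod d)" using nz unfolding I_def by (intro conjI exI)
    then show False using d(2) degree_mod_less'[OF A(2) nz] by fastforce
  qed
  have "poly d t \<noteq> 0" for t
    using assms[of t] dvd by (metis dvdE mult_eq_0_iff poly_mult)
  then have "degree d = 0" using alg_closed_imp_poly_has_root[of d] by blast
  then obtain c where c: "d = [:c:]" using degree_eq_zeroE by blast
  then have "c \<noteq> 0" using A(2) by simp
  have "(\<Sum>i\<le>n. smult (1 / c) (A i) * F i) = smult (1 / c) d"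
    unfolding A(1) smult_sum_right by simp
  also have "\<dots> = 1" using c \<open>c \<noteq> 0\<close> by simp
  finally show ?thesis by (rule exI[of _ "\<lambda>i. smult (1 / c) (A i)"])
qed

text \<open>A section of \<open>O(- 1)\<close> over the intersection of the two charts is a difference of sections
  over the charts; here the section is the factor \<open>c\<close> in the hypothesis, as a function of \<open>t\<close>.\<close>

lemma glue_modulo_multiple:
  fixes F F' c0 c1 A :: "nat \<Rightarrow> 'k::alg_closed_field poly"
  assumes e: "e > 0" and F': "\<And>i t. i \<le> n \<Longrightarrow> t \<noteq> 0 \<Longrightarrow> poly (F i) t = t ^ e * poly (F' i) (inverse t)"
    and A: "(\<Sum>i\<le>n. A i * F i) = 1"
    and c: "\<And>t. t \<noteq> 0 \<Longrightarrow> \<exists>c. \<forall>i\<le>n. t ^ (e - 1) * poly (c1 i) (inverse t) - poly (c0 i) t = c * poly (F i) t"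
  shows "\<exists>\<kappa>. \<forall>i\<le>n. \<forall>k\<ge>e. coeff (c0 i + \<kappa> * F i) k = 0"
proof -
  \<comment> \<open>Large enough for reversing all \<open>c1 i\<close>, and positive even if they
    are all constant, since \<open>M - 1\<close> is used as a degree below.\<close>
  define M where "M = Suc (Max ((\<lambda>i. degree (c1 i)) ` {..n}))"
  define R where "R i = reverse_to M (c1 i)" for i
  have "degree (c1 i) \<le> M" if "i \<le> n" for i
    unfolding M_def using that by (intro le_SucI Max_ge) auto
  then have R: "poly (R i) t = t ^ M * poly (c1 i) (inverse t)" if "i \<le> n" "t \<noteq> 0" for i t
    unfolding R_def using that by (intro poly_reverse_to) auto
  \<comment> \<open>The Bezout identity recovers \<open>t ^ M * c\<close> from the multiples
    \<open>c * F i\<close> and shows it to be a polynomial in \<open>t\<close>.\<close>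
  define \<Lambda> where "\<Lambda> = monom 1 (e - 1) * (\<Sum>i\<le>n. A i * R i) - monom 1 M * (\<Sum>i\<le>n. A i * c0 i)"
  have \<Lambda>: "t ^ M * (t ^ (e - 1) * poly (c1 i) (inverse t) - poly (c0 i) t) = poly \<Lambda> t * poly (F i) t"
    if t: "t \<noteq> 0" and i: "i \<le> n" for t i
  proof -
    obtain c where c: "\<And>i. i \<le> n \<Longrightarrow> t ^ (e - 1) * poly (c1 i) (inverse t) - poly (c0 i) t = c * poly (F i) t"
      using assms(4)[OF t] by blast
    have "c = c * poly (\<Sum>i\<le>n. A i * F i) t" unfolding A by simp
    also have "\<dots> = (\<Sum>i\<le>n. poly (A i) t * (c * poly (F i) t))"
      by (simp add: poly_sum sum_distrib_left mult_ac)
    also have "\<dots> = (\<Sum>i\<le>n. poly (A i) t * (t ^ (e - 1) * poly (c1 i) (inverse t) - poly (c0 i) t))"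
      using c by simp
    finally have "t ^ M * c = (\<Sum>i\<le>n. t ^ M * (poly (A i) t * (t ^ (e - 1) * poly (c1 i) (inverse t) - poly (c0 i) t)))"
      by (simp add: sum_distrib_left)
    also have "\<dots> = (\<Sum>i\<le>n. t ^ (e - 1) * (poly (A i) t * poly (R i) t) - t ^ M * (poly (A i) t * poly (c0 i) t))"
      using R t by (intro sum.cong) (auto simp: algebra_simps)
    also have "\<dots> = poly \<Lambda> t"
      by (simp add: \<Lambda>_def poly_sum poly_monom sum_subtractf sum_distrib_left)
    finally show ?thesis using c[OF i] by (simp add: mult.assoc[symmetric])
  qed
  \<comment> \<open>The vanishing of H^1(O(- 1)): the Laurent polynomial
    \<open>\<Lambda> / t ^ M\<close> is the sum of \<open>\<kappa>\<close>, a polynomial in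
    \<open>t\<close>, and of \<open>inverse t * poly \<mu>0 (inverse t)\<close>. The first part
    corrects \<open>c0\<close>, the second \<open>c1\<close>; the factor \<open>inverse t\<close> is
    what turns \<open>t ^ e\<close> into \<open>t ^ (e - 1)\<close>.\<close>
  define \<kappa> where "\<kappa> = \<Lambda> div monom 1 M"
  have split: "\<Lambda> = \<kappa> * monom 1 M + \<Lambda> mod monom 1 M"
    unfolding \<kappa>_def by (rule div_mult_mod_eq[symmetric])
  define \<mu>0 where "\<mu>0 = reverse_to (M - 1) (\<Lambda> mod monom 1 M)"
  have "degree (\<Lambda> mod monom 1 M) \<le> M - 1"
  proof (cases "\<Lambda> mod monom 1 M = 0")
    case False
    then have "degree (\<Lambda> mod monom 1 M) < degree (monom (1::'k) M)"
      by (intro degree_mod_less') auto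
    then show ?thesis by (simp add: degree_monom_eq)
  qed simp
  then have \<mu>0: "poly \<mu>0 t = t ^ (M - 1) * poly (\<Lambda> mod monom 1 M) (inverse t)" if "t \<noteq> 0" for t
    unfolding \<mu>0_def using that by (rule poly_reverse_to)
  have \<mu>: "poly (\<Lambda> mod monom 1 M) t = t ^ (M - 1) * poly \<mu>0 (inverse t)" if "t \<noteq> 0" for t
    using \<mu>0[of "inverse t"] that by (simp add: power_inverse)
  have M: "M = Suc (M - 1)" by (simp add: M_def)
  have "coeff (c0 i + \<kappa> * F i) k = 0" if i: "i \<le> n" and k: "k \<ge> e" for i k
  proof -
    have "poly (c0 i + \<kappa> * F i) t = t powi int (e - 1) * poly (c1 i - \<mu>0 * F' i) (inverse t)"
      if t: "t \<noteq> 0" for t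
    proof -
      have tM: "t ^ M = t ^ (M - 1) * t" by (subst M) simp
      have te: "t ^ e = t * t ^ (e - 1)" using e by (cases e) auto
      have "poly \<Lambda> t = poly \<kappa> t * t ^ M + t ^ (M - 1) * poly \<mu>0 (inverse t)"
        using arg_cong[OF split, of "\<lambda>p. poly p t"] \<mu>[OF t] by (simp only: poly_add poly_mult poly_monom mult_1)
      then have "t ^ M * (t ^ (e - 1) * poly (c1 i) (inverse t) - poly (c0 i) t)
          = (poly \<kappa> t * t ^ M + t ^ (M - 1) * poly \<mu>0 (inverse t)) * poly (F i) t"
        using \<Lambda>[OF t i] by simp
      also have "\<dots> = t ^ M * (poly \<kappa> t * poly (F i) t) + t ^ M * (t ^ (e - 1) * poly (\<mu>0 * F' i) (inverse t))"
        unfolding F'[OF i t] tM te by (simp add: algebra_simps)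
      finally have "t ^ M * (t ^ (e - 1) * poly (c1 i) (inverse t) - poly (c0 i) t)
          = t ^ M * (poly \<kappa> t * poly (F i) t + t ^ (e - 1) * poly (\<mu>0 * F' i) (inverse t))"
        by (simp add: distrib_left)
      then have "t ^ (e - 1) * poly (c1 i) (inverse t) - poly (c0 i) t
          = poly \<kappa> t * poly (F i) t + t ^ (e - 1) * poly (\<mu>0 * F' i) (inverse t)"
        using t by simp
      then show ?thesis by (simp add: algebra_simps)
    qed
    from degree_le_of_reflected[OF this] have "c0 i + \<kappa> * F i = 0 \<or> degree (c0 i + \<kappa> * F i) \<le> e - 1"
      by fastforce
    then show ?thesis
    proof
      assume "degree (c0 i + \<kappa> * F i) \<le> e - 1"
      then show ?thesis using k e by (intro coeff_eq_0) linarith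
    qed simp
  qed
  then show ?thesis by blast
qed

section \<open>Tangent vectors and Cech cocycles\<close>

lemma tangent_add:
  "D \<in> tangent_space n d F x \<Longrightarrow> g \<in> stalk n x \<Longrightarrow> h \<in> stalk n x \<Longrightarrow> D (\<lambda>v. g v + h v) = D g + D h"
  unfolding tangent_space_def by blast

lemma tangent_mult:
  "D \<in> tangent_space n d F x \<Longrightarrow> g \<in> stalk n x \<Longrightarrow> h \<in> stalk n x \<Longrightarrow> v \<in> x \<Longrightarrow>
    D (\<lambda>v. g v * h v) = g v * D h + h v * D g"
  unfolding tangent_space_def by blast

lemma tangent_const: "D \<in> tangent_space n d F x \<Longrightarrow> D (\<lambda>v. c) = 0"
  unfolding tangent_space_def by blast

lemma tangent_germ:
  "D \<in> tangent_space n d F x \<Longrightarrow> g \<in> stalk n x \<Longrightarrow> h \<in> stalk n x \<Longrightarrow>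
    zariski_open n W \<Longrightarrow> x \<in> W \<Longrightarrow> (\<And>v. v \<in> \<Union>W \<Longrightarrow> g v = h v) \<Longrightarrow> D g = D h"
  unfolding tangent_space_def by blast

lemma tangent_ideal: "D \<in> tangent_space n d F x \<Longrightarrow> g \<in> ideal_stalk n d F x \<Longrightarrow> D g = 0"
  unfolding tangent_space_def by blast

lemma tangent_outside: "D \<in> tangent_space n d F x \<Longrightarrow> g \<notin> stalk n x \<Longrightarrow> D g = 0"
  unfolding tangent_space_def by blast

lemma tangent_zero: "0 \<in> tangent_space n d F x"
  unfolding tangent_space_def by simp

text \<open>For the cocycle, which takes opposite values on the two orders of a pair of
  charts.\<close>

lemma tangent_uminus:
  assumes D: "D \<in> tangent_space n d F x" shows "- D \<in> tangent_space n d F x"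
  unfolding tangent_space_def
proof (intro CollectI conjI ballI allI impI)
  fix g h assume g: "g \<in> stalk n x" and h: "h \<in> stalk n x"
  show "(- D) (\<lambda>v. g v + h v) = (- D) g + (- D) h" using tangent_add[OF D g h] by simp
  show "(- D) (\<lambda>v. g v * h v) = g v * (- D) h + h v * (- D) g" if "v \<in> x" for v
    using tangent_mult[OF D g h that] by simp
  show "(- D) g = (- D) h" if "\<exists>W. zariski_open n W \<and> x \<in> W \<and> (\<forall>v\<in>\<Union>W. g v = h v)"
    using that tangent_germ[OF D g h] by auto
qed (simp_all add: tangent_const[OF D] tangent_ideal[OF D] tangent_outside[OF D])

abbreviation coord_open :: "nat \<Rightarrow> nat \<Rightarrow> 'k::field point set" where
  "coord_open n l \<equiv> basic_open n (\<lambda>v. v l)"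

abbreviation ratio :: "nat \<Rightarrow> nat \<Rightarrow> 'k::field vec \<Rightarrow> 'k" where
  "ratio k l \<equiv> \<lambda>v. v k / v l"

lemma line_mem_coord_open: "x \<in> \<Union>(proj_space n) \<Longrightarrow> x l \<noteq> 0 \<Longrightarrow> line x \<in> coord_open n l"
  unfolding basic_open_def by blast

lemma coord_twist:
  assumes "l \<le> n" "zariski_open n U" shows "(\<lambda>v. v l) \<in> twist n 1 U"
  using twist_form[OF form_var[OF assms(1)] assms(2)] by simp

lemma coord_inverse_twist:
  assumes l: "l \<le> n" shows "(\<lambda>v. inverse (v l)) \<in> twist n (- 1) (coord_open n l)"
proof -
  have op: "zariski_open n (coord_open n l)" by (rule zariski_open_basic[OF form_var[OF l]])
  show ?thesis
    by (rule twist_inverse[OF coord_twist[OF l op] _ op]) (use cone_basic_open[OF form_var[OF l]] in blast)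
qed

lemma ratio_regular:
  assumes "k \<le> n" and l: "l \<le> n" shows "ratio k l \<in> regular n (coord_open n l)"
proof -
  have op: "zariski_open n (coord_open n l)" by (rule zariski_open_basic[OF form_var[OF l]])
  have "(\<lambda>v. v k * inverse (v l)) \<in> regular n (coord_open n l)"
    by (rule twist_mult[OF coord_twist[OF assms(1) op] coord_inverse_twist[OF l] _ op]) simp
  then show ?thesis by (simp add: divide_inverse)
qed

lemma ratio_stalk:
  assumes "k \<le> n" "l \<le> n" "x \<in> \<Union>(proj_space n)" "x l \<noteq> 0"
  shows "ratio k l \<in> stalk n (line x)"
  using ratio_regular[OF assms(1,2)] line_mem_coord_open[OF assms(3,4)]
    zariski_open_basic[OF form_var[OF assms(2)]] unfolding stalk_def by blast

text \<open>The Euler sequence: a tangent vector at \<open>x\<close> lifts to a vector that is well-defined up to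
  multiples of \<open>x\<close>, and every coordinate \<open>l\<close> with \<open>x l \<noteq> 0\<close> gives a lift.\<close>

lemma tangent_lift_change:
  fixes x :: "'k::field vec"
  assumes D: "D \<in> tangent_space n d F (line x)" and x: "x \<in> \<Union>(proj_space n)"
    and l: "l \<le> n" "x l \<noteq> 0" "l' \<le> n" "x l' \<noteq> 0"
  shows "\<exists>c. \<forall>k\<le>n. x l' * D (ratio k l') = x l * D (ratio k l) + c * x k"
proof (intro exI[of _ "x l' / x l * D (ratio l l')"] allI impI)
  fix k assume k: "k \<le> n"
  note st = ratio_stalk[OF k l(1) x l(2)] ratio_stalk[OF l(1,3) x l(4)] ratio_stalk[OF k l(3) x l(4)]
  \<comment> \<open>The two functions agree where \<open>v l \<noteq> 0\<close>, hence as germs, but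
    not as functions.\<close>
  have "D (\<lambda>v. ratio k l v * ratio l l' v) = D (ratio k l')"
  proof (rule tangent_germ[OF D stalk_mult[OF st(1,2)] st(3)])
    show "zariski_open n (coord_open n l)" by (rule zariski_open_basic[OF form_var[OF l(1)]])
    show "line x \<in> coord_open n l" by (rule line_mem_coord_open[OF x l(2)])
    fix v :: "'k vec" assume "v \<in> \<Union>(coord_open n l)"
    then have "v l \<noteq> 0" using cone_basic_open[OF form_var[OF l(1)]] by blast
    then show "ratio k l v * ratio l l' v = ratio k l' v" by simp
  qed
  moreover have "D (\<lambda>v. ratio k l v * ratio l l' v) = ratio k l x * D (ratio l l') + ratio l l' x * D (ratio k l)"
    by (rule tangent_mult[OF D st(1,2) line_self])
  ultimately show "x l' * D (ratio k l') = x l * D (ratio k l) + x l' / x l * D (ratio l l') * x k"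
    using l by (simp add: field_simps)
qed

lemma stalk_sum:
  assumes "x \<in> \<Union>(proj_space n)" "\<And>i. i \<in> I \<Longrightarrow> g i \<in> stalk n (line x)"
  shows "(\<lambda>v. \<Sum>i\<in>I. g i v) \<in> stalk n (line x)"
  using assms(2)
  by (induction I rule: infinite_finite_induct) (auto intro: stalk_const stalk_add assms(1))

lemma tangent_sum:
  assumes D: "D \<in> tangent_space n d F (line x)" and x: "x \<in> \<Union>(proj_space n)"
    and "finite I" "\<And>i. i \<in> I \<Longrightarrow> g i \<in> stalk n (line x)"
  shows "D (\<lambda>v. \<Sum>i\<in>I. g i v) = (\<Sum>i\<in>I. D (g i))"
  using assms(3,4)
proof (induction I rule: finite_induct)
  case empty
  then show ?case using tangent_const[OF D] by simp
next
  case (insert i I)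
  then show ?case using tangent_add[OF D, of "g i" "\<lambda>v. \<Sum>i\<in>I. g i v"] stalk_sum[OF x, of I g] by simp
qed

lemma stalk_power:
  assumes "x \<in> \<Union>(proj_space n)" "g \<in> stalk n (line x)"
  shows "(\<lambda>v. g v ^ m) \<in> stalk n (line x)"
  by (induction m) (auto intro: stalk_const[OF assms(1)] stalk_mult assms(2))

text \<open>In the application \<open>m = q\<close>, and the factor \<open>q + 1\<close> is
  \<open>1\<close> in the field.\<close>

lemma tangent_power:
  assumes D: "D \<in> tangent_space n d F (line x)" and x: "x \<in> \<Union>(proj_space n)" and g: "g \<in> stalk n (line x)"
  shows "D (\<lambda>v. g v ^ Suc m) = of_nat (Suc m) * g x ^ m * D g"
proof (induction m)
  case (Suc m)
  have "D (\<lambda>v. g v * g v ^ Suc m) = g x * D (\<lambda>v. g v ^ Suc m) + g x ^ Suc m * D g"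
    by (rule tangent_mult[OF D g stalk_power[OF x g] line_self])
  then show ?case using Suc by (simp add: algebra_simps)
qed simp

text \<open>A section over the intersection is a cocycle for the cover by two sets, completed by
  \<open>- s\<close> for the reversed pair and \<open>0\<close> on the diagonal. If both sets are
  equal, this prescription breaks down, but the section is then defined on all of
  \<open>V\<close>.\<close>

lemma cech_two_charts:
  fixes \<F> :: "'k::field point set \<Rightarrow> ('k vec \<Rightarrow> 'v::ab_group_add) set"
  assumes H1: "H1_vanishes n \<F>" and U: "zariski_open n U" "zariski_open n V" "U \<union> V = proj_space n"
    and s: "s \<in> \<F> (U \<inter> V)" "- s \<in> \<F> (U \<inter> V)" "0 \<in> \<F> U" "0 \<in> \<F> V"
  shows "\<exists>a\<in>\<F> U. \<exists>b\<in>\<F> V. \<forall>u\<in>\<Union>(U \<inter> V). s u = b u - a u"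
proof (cases "U = V")
  case True
  then show ?thesis using s by (intro bexI[of _ 0] bexI[of _ s]) auto
next
  case False
  define c where "c A B = (if A = B then 0 else if A = U then s else - s)" for A B :: "'k point set"
  have "\<forall>A\<in>{U, V}. zariski_open n A" "\<Union>{U, V} = proj_space n" using U by auto
  moreover have "\<forall>A\<in>{U, V}. \<forall>B\<in>{U, V}. c A B \<in> \<F> (A \<inter> B)"
    using s False by (auto simp: c_def Int_commute)
  moreover have "\<forall>A\<in>{U, V}. \<forall>B\<in>{U, V}. \<forall>C\<in>{U, V}. \<forall>u\<in>\<Union>(A \<inter> B \<inter> C). c A B u + c B C u = c A C u"
    using False by (auto simp: c_def)
  ultimately obtain b where b: "\<forall>A\<in>{U, V}. b A \<in> \<F> A"
    "\<forall>A\<in>{U, V}. \<forall>B\<in>{U, V}. \<forall>u\<in>\<Union>(A \<inter> B). c A B u = b B u - b A u"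
    using H1[unfolded H1_vanishes_def, rule_format, of "{U, V}" c] by blast
  have "c U V = s" using False by (simp add: c_def)
  then have "\<forall>u\<in>\<Union>(U \<inter> V). s u = b V u - b U u" using b(2) by auto
  moreover have "b U \<in> \<F> U" "b V \<in> \<F> V" using b(1) by auto
  ultimately show ?thesis by blast
qed

text \<open>The isomorphism \<open>s\<close> of \<open>O(e)\<close> with \<open>\<phi>\<^sup>*O(1)\<close> turns the coordinates into the sections
  \<open>f i\<close> of \<open>O(e)\<close>.\<close>

lemma degree_coordinates:
  fixes \<phi> :: "'k::field point \<Rightarrow> 'k point"
  assumes mor: "proj_morphism m n \<phi>" and s: "s \<in> pullback_twist m n \<phi> 1 (- e) (proj_space m)"
    and nz: "\<And>u v. u \<in> \<Union>(proj_space m) \<Longrightarrow> v \<in> \<phi> (line u) \<Longrightarrow> s u v \<noteq> 0"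
  shows "\<exists>f. (\<forall>i\<le>n. (\<lambda>u. f u i) \<in> twist m e (proj_space m)) \<and>
    (\<forall>u\<in>\<Union>(proj_space m). f u \<in> \<Union>(proj_space n) \<and> \<phi> (line u) = line (f u))"
proof -
  have phi: "\<phi> (line u) \<in> proj_space n" if "u \<in> \<Union>(proj_space m)" for u
    using mor line_in_proj_space[OF that] unfolding proj_morphism_def by blast
  have loc: "\<exists>W' V t g. zariski_open m W' \<and> line u \<in> W' \<and> W' \<subseteq> proj_space m \<and> zariski_open n V \<and>
      W' \<subseteq> preimage m \<phi> V \<and> t \<in> twist n 1 V \<and> g \<in> twist m (- e) W' \<and>
      (\<forall>u\<in>\<Union>W'. \<forall>v\<in>\<phi> (line u). s u v = g u * t v)" if "u \<in> \<Union>(proj_space m)" for u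
    using s line_in_proj_space[OF that] unfolding pullback_twist_def by blast
  \<comment> \<open>Locally \<open>s\<close> is a tensor with a section of \<open>O(1)\<close>,
    hence homogeneous of degree 1 in \<open>v\<close>.\<close>
  have scale: "s u (\<lambda>i. c * v i) = c * s u v"
    if u: "u \<in> \<Union>(proj_space m)" and v: "v \<in> \<phi> (line u)" and c: "c \<noteq> 0" for u v c
  proof -
    obtain W' :: "'k point set" and V :: "'k point set" and t g where *: "line u \<in> W'" "zariski_open n V" "W' \<subseteq> preimage m \<phi> V"
      "t \<in> twist n 1 V" "\<forall>u\<in>\<Union>W'. \<forall>v\<in>\<phi> (line u). s u v = g u * t v" using loc[OF u] by blast
    have "u \<in> \<Union>W'" using *(1) line_self by blast
    have vV: "v \<in> \<Union>V" using *(1,3) v unfolding preimage_def by blast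
    have "\<phi> (line u) = line v" using proj_space_eq_line[OF phi[OF u] v] .
    then have "(\<lambda>i. c * v i) \<in> \<phi> (line u)" using c unfolding line_def by blast
    then have "s u (\<lambda>i. c * v i) = g u * t (\<lambda>i. c * v i)" using *(5) \<open>u \<in> \<Union>W'\<close> by blast
    moreover have "t (\<lambda>i. c * v i) = c * t v"
      using twist_scale[OF *(4) vV c zariski_open_subset[OF *(2)]] by simp
    moreover have "s u v = g u * t v" using *(5) \<open>u \<in> \<Union>W'\<close> v by blast
    ultimately show ?thesis by (simp add: mult.left_commute)
  qed
  define v0 where "v0 u = (SOME v. v \<in> \<phi> (line u))" for u
  have v0: "v0 u \<in> \<phi> (line u)" if "u \<in> \<Union>(proj_space m)" for u
  proof -
    have "\<exists>v. v \<in> \<phi> (line u)" using phi[OF that] line_self unfolding proj_space_def by blast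
    then show ?thesis unfolding v0_def by (rule someI_ex)
  qed
  \<comment> \<open>On the cone, \<open>f u\<close> is the vector of the line
    \<open>\<phi> (line u)\<close> at which \<open>s u\<close> takes the value \<open>1\<close>; it
    does not depend on the choice of \<open>v0 u\<close>.\<close>
  define f where "f u = (\<lambda>i. inverse (s u (v0 u)) * v0 u i)" for u
  have f: "f u i = v i / s u v" if u: "u \<in> \<Union>(proj_space m)" and v: "v \<in> \<phi> (line u)" for u v i
  proof -
    have "\<phi> (line u) = line (v0 u)" using proj_space_eq_line[OF phi[OF u] v0[OF u]] .
    then obtain c where c: "v = (\<lambda>i. c * v0 u i)" "c \<noteq> 0" using v unfolding line_def by blast
    then show ?thesis using scale[OF u v0[OF u] c(2)] unfolding f_def c(1) by (simp add: divide_inverse)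
  qed
  have line_f: "\<phi> (line u) = line (f u)" if u: "u \<in> \<Union>(proj_space m)" for u
    using proj_space_eq_line[OF phi[OF u] v0[OF u]] nz[OF u v0[OF u]] by (simp add: f_def line_scale)
  have "(\<lambda>u. f u i) \<in> twist m e (proj_space m)" if i: "i \<le> n" for i
  proof (rule twist_local)
    fix u0 :: "'k vec" assume u0: "u0 \<in> \<Union>(proj_space m)"
    obtain W' :: "'k point set" and V :: "'k point set" and t g where *: "zariski_open m W'" "line u0 \<in> W'" "W' \<subseteq> proj_space m"
      "W' \<subseteq> preimage m \<phi> V" "t \<in> twist n 1 V" "g \<in> twist m (- e) W'"
      "\<forall>u\<in>\<Union>W'. \<forall>v\<in>\<phi> (line u). s u v = g u * t v" using loc[OF u0] by blast
    have gt: "s u v = g u * t v" "g u \<noteq> 0" "t v \<noteq> 0"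
      if "u \<in> \<Union>W'" "v \<in> \<phi> (line u)" for u v
    proof -
      show "s u v = g u * t v" using *(7) that by blast
      moreover have "s u v \<noteq> 0" using nz that *(3) by blast
      ultimately show "g u \<noteq> 0" "t v \<noteq> 0" by auto
    qed
    have u0W: "u0 \<in> \<Union>W'" using *(2) line_self by blast
    have "v0 u0 \<in> \<Union>V" using *(2,4) v0[OF u0] unfolding preimage_def by blast
    then obtain a b G H where GH: "form n a G" "form n b H" "int a - int b = 1" "H (v0 u0) \<noteq> 0"
      "\<And>v. (\<And>i. i > n \<Longrightarrow> v i = 0) \<Longrightarrow> H v \<noteq> 0 \<Longrightarrow> v \<in> \<Union>V \<and> t v = G v / H v"
      using twistD[OF *(5)] by metis
    have cone_v: "v \<in> \<Union>(proj_space n)" if "u \<in> \<Union>(proj_space m)" "v \<in> \<phi> (line u)" for u v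
      using phi that by blast
    have tGH: "t v = G v / H v" if "v \<in> \<Union>(proj_space n)" "H v \<noteq> 0" for v
      using GH(5)[of v] that unfolding cone_iff by blast
    define V' where "V' = basic_open n (\<lambda>v. G v * H v)"
    note fV' = form_mult[OF GH(1,2)]
    have opV': "zariski_open n V'" unfolding V'_def by (rule zariski_open_basic[OF fV'])
    have V': "G v \<noteq> 0" "H v \<noteq> 0" "v \<in> \<Union>(proj_space n)" if "v \<in> \<Union>V'" for v
      using that unfolding V'_def cone_basic_open[OF fV'] by auto
    \<comment> \<open>This function is \<open>v i / t v\<close>, a quotient of two sections of
      \<open>O(1)\<close>. Its pullback \<open>h\<close> is regular because \<open>\<phi>\<close> is
      a morphism, and \<open>h / g\<close> is the coordinate \<open>f u i\<close>.\<close>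
    have reg: "(\<lambda>v. v i * H v * inverse (G v)) \<in> regular n V'"
    proof (rule twist_mult[OF _ _ _ opV'])
      show "(\<lambda>v. v i * H v) \<in> twist n (1 + int b) V'"
        by (rule twist_mult[OF coord_twist[OF i opV'] twist_form[OF GH(2) opV'] refl opV'])
      show "(\<lambda>v. inverse (G v)) \<in> twist n (- int a) V'"
        using V'(1) by (intro twist_inverse twist_form[OF GH(1)] opV')
      show "0 = 1 + int b + - int a" using GH(3) by simp
    qed
    have "\<forall>g\<in>regular n V'. \<exists>h\<in>regular m (preimage m \<phi> V').
        \<forall>u\<in>\<Union>(preimage m \<phi> V'). \<forall>v\<in>\<phi> (line u). h u = g v"
      using mor opV' unfolding proj_morphism_def by blast
    from bspec[OF this reg] obtain h where h: "h \<in> regular m (preimage m \<phi> V')"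
      "\<forall>u\<in>\<Union>(preimage m \<phi> V'). \<forall>v\<in>\<phi> (line u). h u = v i * H v * inverse (G v)"
      by (elim bexE)
    have opP: "zariski_open m (preimage m \<phi> V')" using mor opV' unfolding proj_morphism_def by blast
    define W where "W = W' \<inter> preimage m \<phi> V'"
    have opW: "zariski_open m W" unfolding W_def by (rule zariski_open_Int[OF *(1) opP])
    have WW': "W \<subseteq> W'" "W \<subseteq> preimage m \<phi> V'" unfolding W_def by auto
    have hg: "(\<lambda>u. h u * inverse (g u)) \<in> twist m e W"
    proof (rule twist_mult[OF twist_restrict[OF h(1) opW WW'(2)] _ _ opW])
      show "(\<lambda>u. inverse (g u)) \<in> twist m (- (- e)) W"
      proof (rule twist_inverse[OF twist_restrict[OF *(6) opW WW'(1)] _ opW])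
        fix u assume "u \<in> \<Union>W"
        then have "u \<in> \<Union>W'" "u \<in> \<Union>(proj_space m)" using WW'(1) *(3) by blast+
        then show "g u \<noteq> 0" using gt(2) v0 by blast
      qed
    qed simp
    have "(\<lambda>u. f u i) \<in> twist m e W"
    proof (rule twist_cong[OF hg])
      fix u assume uW: "u \<in> \<Union>W"
      then have u: "u \<in> \<Union>W'" "u \<in> \<Union>(preimage m \<phi> V')" "u \<in> \<Union>(proj_space m)"
        using WW' *(3) by blast+
      have "line u \<in> preimage m \<phi> V'"
        using u(2) mem_Union_iff[OF zariski_open_subset[OF opP]] by blast
      then have "v0 u \<in> \<Union>V'" using v0[OF u(3)] unfolding preimage_def by blast
      note v = V'[OF this]
      have hu: "h u = v0 u i * H (v0 u) * inverse (G (v0 u))" using h(2) u(2) v0[OF u(3)] by blast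
      have su: "s u (v0 u) = g u * (G (v0 u) / H (v0 u))"
        using gt(1)[OF u(1) v0[OF u(3)]] tGH[OF v(3,2)] by simp
      show "h u * inverse (g u) = f u i"
        unfolding f[OF u(3) v0[OF u(3)]] hu su using v gt(2)[OF u(1) v0[OF u(3)]]
        by (simp add: field_simps)
    qed
    moreover have "u0 \<in> \<Union>W"
    proof -
      have cv: "v0 u0 \<in> \<Union>(proj_space n)" using cone_v[OF u0 v0[OF u0]] .
      have "t (v0 u0) = G (v0 u0) / H (v0 u0)" using tGH[OF cv GH(4)] .
      then have "G (v0 u0) \<noteq> 0" using gt(3)[OF u0W v0[OF u0]] by auto
      then have "line (v0 u0) \<in> V'" using GH(4) cv unfolding V'_def basic_open_def by auto
      then have "\<phi> (line u0) \<in> V'" using proj_space_eq_line[OF phi[OF u0] v0[OF u0]] by simp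
      then have "line u0 \<in> W" using *(2) line_in_proj_space[OF u0] unfolding W_def preimage_def by blast
      then show ?thesis using line_self by blast
    qed
    ultimately show "\<exists>W. u0 \<in> \<Union>W \<and> W \<subseteq> proj_space m \<and> (\<lambda>u. f u i) \<in> twist m e W"
      using zariski_open_subset[OF opW] by blast
  qed simp
  moreover have "f u \<in> \<Union>(proj_space n)" if u: "u \<in> \<Union>(proj_space m)" for u
    using line_f[OF u] phi[OF u] line_self by force
  ultimately show ?thesis using line_f by blast
qed

section \<open>Lifting tangent sections along the Euler sequence\<close>

lemma pullback_tangent_zero:
  assumes "proj_morphism m n \<phi>" "zariski_open m W"
  shows "0 \<in> pullback_tangent m n d F \<phi> b W"
proof -
  have "zariski_open m (W \<inter> preimage m \<phi> V)" if "zariski_open n V" for V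
    using assms that zariski_open_Int unfolding proj_morphism_def by blast
  then show ?thesis unfolding pullback_tangent_def
    by (auto simp: tangent_zero twist_zero)
qed

lemma pullback_tangent_uminus:
  assumes "proj_morphism m n \<phi>" "zariski_open m W" and s: "s \<in> pullback_tangent m n d F \<phi> b W"
  shows "- s \<in> pullback_tangent m n d F \<phi> b W"
proof -
  have "zariski_open m (W \<inter> preimage m \<phi> V)" if "zariski_open n V" for V
    using assms that zariski_open_Int unfolding proj_morphism_def by blast
  then have "(\<lambda>u. - s u g) \<in> twist m b (W \<inter> preimage m \<phi> V)"
    if "zariski_open n V" "g \<in> regular n V" for V g
    using that s twist_uminus unfolding pullback_tangent_def by blast
  moreover have "\<forall>u\<in>\<Union>W. - s u \<in> tangent_space n d F (\<phi> (line u))"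
    using s tangent_uminus unfolding pullback_tangent_def by blast
  ultimately show ?thesis unfolding pullback_tangent_def by simp
qed

text \<open>The number \<open>n\<close> is both the dimension of the ambient space and the degree of
  the Fermat form, which explains the repetition in \<open>pullback_tangent 1 n n\<close>. The
  vectors \<open>f u\<close> are homogeneous coordinates of \<open>\<phi>\<close>, of degree
  \<open>e\<close> in \<open>u\<close>.\<close>

locale fermat_map = frobenius q \<nu> ty for q \<nu> :: nat and ty :: "'k::alg_closed_field itself" +
  fixes \<phi> :: "'k point \<Rightarrow> 'k point" and f :: "'k vec \<Rightarrow> 'k vec" and e n :: nat
  assumes n_eq: "n = q + 1"
    and mor: "proj_morphism 1 n \<phi>"
    and f_twist: "\<And>i. i \<le> n \<Longrightarrow> (\<lambda>u. f u i) \<in> twist 1 (int e) (proj_space 1)"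
    and f_cone: "\<And>u. u \<in> \<Union>(proj_space 1) \<Longrightarrow> f u \<in> \<Union>(proj_space n)"
    and phi: "\<And>u. u \<in> \<Union>(proj_space 1) \<Longrightarrow> \<phi> (line u) = line (f u)"
    and fermat_f: "\<And>u. u \<in> \<Union>(proj_space 1) \<Longrightarrow> fermat_form q (f u) = 0"
    and e_pos: "e > 0"
begin

lemma fermat_sum: "fermat_form q T = (\<Sum>i\<le>n. T i ^ q * T i)"
  unfolding fermat_form_def n_eq by (simp add: mult.commute)

lemma f_sum: "u \<in> \<Union>(proj_space 1) \<Longrightarrow> (\<Sum>i\<le>n. f u i ^ q * f u i) = 0"
  using fermat_f fermat_sum by metis

lemma f_nonzero: "u \<in> \<Union>(proj_space 1) \<Longrightarrow> \<exists>l\<le>n. f u l \<noteq> 0"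
  using f_cone[of u] unfolding cone_iff by (metis not_le)

lemma open_preimage: "zariski_open n V \<Longrightarrow> zariski_open 1 (preimage 1 \<phi> V)"
  using mor unfolding proj_morphism_def by blast

lemma mem_preimage:
  assumes "zariski_open n V"
  shows "u \<in> \<Union>(preimage 1 \<phi> V) \<longleftrightarrow> u \<in> \<Union>(proj_space 1) \<and> f u \<in> \<Union>V"
proof -
  have "u \<in> \<Union>(preimage 1 \<phi> V) \<longleftrightarrow> u \<in> \<Union>(proj_space 1) \<and> line u \<in> preimage 1 \<phi> V"
    by (rule mem_Union_iff) (auto simp: preimage_def)
  also have "\<dots> \<longleftrightarrow> u \<in> \<Union>(proj_space 1) \<and> line (f u) \<in> V"
  proof (cases "u \<in> \<Union>(proj_space 1)")
    case True
    then show ?thesis using line_in_proj_space[OF True] phi[OF True]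
      by (simp only: preimage_def mem_Collect_eq simp_thms)
  qed (simp only: simp_thms)
  also have "\<dots> \<longleftrightarrow> u \<in> \<Union>(proj_space 1) \<and> f u \<in> \<Union>V"
    using mem_Union_iff[OF zariski_open_subset[OF assms], of "f u"] f_cone by blast
  finally show ?thesis .
qed

text \<open>Division by \<open>v l ^ n\<close> turns the Fermat form into the function
  \<open>\<Sum> ratio k l ^ (q + 1)\<close>, which lies in the ideal. Since \<open>q = 0\<close> in
  the field, its derivative is \<open>\<Sum> ratio k l ^ q * D (ratio k l)\<close>.\<close>

lemma tangent_fermat:
  fixes x :: "'k vec"
  assumes D: "D \<in> tangent_space n n (fermat_form q) (line x)" and x: "x \<in> \<Union>(proj_space n)"
    and l: "l \<le> n" "x l \<noteq> 0"
  shows "(\<Sum>k\<le>n. x k ^ q * D (ratio k l)) = 0"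
proof -
  have fl: "form n n (\<lambda>v::'k vec. v l ^ n)" using form_power[OF form_var[OF l(1)], of n] by simp
  have op: "zariski_open n (coord_open n l)" by (rule zariski_open_basic[OF form_var[OF l(1)]])
  have "(\<lambda>v::'k vec. inverse (v l ^ n)) \<in> twist n (- int n) (coord_open n l)"
  proof (rule twist_inverse[OF twist_form[OF fl op] _ op])
    fix u :: "'k vec" assume "u \<in> \<Union>(coord_open n l)"
    then show "u l ^ n \<noteq> 0" using cone_basic_open[OF form_var[OF l(1)]] by fastforce
  qed
  then have mem: "(\<lambda>v. fermat_form q v * inverse (v l ^ n)) \<in> ideal_stalk n n (fermat_form q) (line x)"
    using op line_mem_coord_open[OF x l(2)] unfolding ideal_stalk_def
    by (intro CollectI exI[of _ "coord_open n l"] conjI bexI[of _ "\<lambda>v. inverse (v l ^ n)"]) auto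
  have eq: "(\<lambda>v. fermat_form q v * inverse (v l ^ n)) = (\<lambda>v. \<Sum>k\<le>n. ratio k l v ^ Suc q)"
    unfolding fermat_form_def n_eq sum_distrib_right
    by (intro ext sum.cong refl) (simp add: divide_inverse power_mult_distrib power_inverse)
  have "0 = D (\<lambda>v. \<Sum>k\<le>n. ratio k l v ^ Suc q)"
    using tangent_ideal[OF D mem] unfolding eq by (rule sym)
  also have "\<dots> = (\<Sum>k\<le>n. D (\<lambda>v. ratio k l v ^ Suc q))"
    by (rule tangent_sum[OF D x]) (use l x in \<open>auto intro!: stalk_power ratio_stalk simp del: power_Suc\<close>)
  also have "\<dots> = (\<Sum>k\<le>n. ratio k l x ^ q * D (ratio k l))"
  proof (intro sum.cong refl)
    fix k assume "k \<in> {..n}"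
    then have "ratio k l \<in> stalk n (line x)" using l x by (intro ratio_stalk) auto
    from tangent_power[OF D x this, of q] show "D (\<lambda>v. ratio k l v ^ Suc q) = ratio k l x ^ q * D (ratio k l)"
      by (simp add: of_nat_q del: power_Suc)
  qed
  also have "\<dots> = inverse (x l ^ q) * (\<Sum>k\<le>n. x k ^ q * D (ratio k l))"
    unfolding sum_distrib_left by (intro sum.cong refl) (simp add: power_divide inverse_eq_divide)
  finally show ?thesis using l by simp
qed

lemma section_tangent:
  assumes "b \<in> pullback_tangent 1 n n (fermat_form q) \<phi> c U" "u \<in> \<Union>U" "U \<subseteq> proj_space 1"
  shows "b u \<in> tangent_space n n (fermat_form q) (line (f u))"
proof -
  have "u \<in> \<Union>(proj_space 1)" using assms(2,3) by blast
  then show ?thesis using assms(1,2) phi unfolding pullback_tangent_def by fastforce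
qed

text \<open>The local lifts \<open>f l * b (ratio k l)\<close> differ by multiples of \<open>f\<close>; normalizing them by
  \<open>\<Sum> a j * w j = 0\<close> makes them agree.\<close>

lemma lift_section:
  assumes i: "i \<le> 1" and b: "b \<in> pullback_tangent 1 n n (fermat_form q) \<phi> (- 1) (chart i)"
    and a: "\<And>j. j \<le> n \<Longrightarrow> a j \<in> twist 1 (- int e) (chart i)"
      "\<And>u. u \<in> \<Union>(chart i) \<Longrightarrow> (\<Sum>j\<le>n. a j u * f u j) = 1"
  shows "\<exists>w. (\<forall>k\<le>n. (\<lambda>u. w u k) \<in> twist 1 (int e - 1) (chart i)) \<and>
    (\<forall>u\<in>\<Union>(chart i). (\<Sum>k\<le>n. f u k ^ q * w u k) = 0 \<and>
      (\<forall>l\<le>n. f u l \<noteq> 0 \<longrightarrow> (\<exists>c. \<forall>k\<le>n. w u k = f u l * b u (ratio k l) + c * f u k)))"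
proof -
  define v where "v u l k = f u l * b u (ratio k l)" for u l k
  define W where "W u l k = v u l k - f u k * (\<Sum>j\<le>n. a j u * v u l j)" for u l k
  define w where "w u k = W u (SOME l. l \<le> n \<and> f u l \<noteq> 0) k" for u k
  have cone: "u \<in> \<Union>(proj_space 1)" if "u \<in> \<Union>(chart i)" for u using that cone_chart[OF i] by blast
  have D: "b u \<in> tangent_space n n (fermat_form q) (line (f u))" if "u \<in> \<Union>(chart i)" for u
    by (rule section_tangent[OF b that basic_open_subset])
  have W_change: "W u l' k = W u l k"
    if u: "u \<in> \<Union>(chart i)" and l: "l \<le> n" "f u l \<noteq> 0" "l' \<le> n" "f u l' \<noteq> 0" and k: "k \<le> n" for u l l' k
  proof -
    obtain c where c: "\<And>k. k \<le> n \<Longrightarrow> v u l' k = v u l k + c * f u k"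
      using tangent_lift_change[OF D[OF u] f_cone[OF cone[OF u]] l] unfolding v_def by blast
    have "(\<Sum>j\<le>n. a j u * v u l' j) = (\<Sum>j\<le>n. a j u * v u l j + c * (a j u * f u j))"
      using c by (intro sum.cong) (auto simp: algebra_simps)
    also have "\<dots> = (\<Sum>j\<le>n. a j u * v u l j) + c"
      by (simp add: sum.distrib a(2)[OF u] flip: sum_distrib_left)
    finally show ?thesis unfolding W_def c[OF k] by (simp add: algebra_simps)
  qed
  have w: "w u k = W u l k" if "u \<in> \<Union>(chart i)" "l \<le> n" "f u l \<noteq> 0" "k \<le> n" for u l k
  proof -
    have "\<exists>l. l \<le> n \<and> f u l \<noteq> 0" using that by blast
    from someI_ex[OF this] show ?thesis unfolding w_def using that by (intro W_change) auto
  qed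
  have "(\<lambda>u. w u k) \<in> twist 1 (int e - 1) (chart i)" if k: "k \<le> n" for k
  proof (rule twist_local[OF _ basic_open_subset])
    fix u0 :: "'k vec" assume u0: "u0 \<in> \<Union>(chart i)"
    obtain l where l: "l \<le> n" "f u0 l \<noteq> 0" using f_nonzero[OF cone[OF u0]] by blast
    have opl: "zariski_open n (coord_open n l)" by (rule zariski_open_basic[OF form_var[OF l(1)]])
    \<comment> \<open>Regularity is local: near \<open>u0\<close> the fixed index \<open>l\<close>
      serves, although \<open>w\<close> chooses its index anew for every \<open>u\<close>.\<close>
    define \<Omega> where "\<Omega> = chart i \<inter> preimage 1 \<phi> (coord_open n l)"
    have op: "zariski_open 1 \<Omega>"
      unfolding \<Omega>_def by (intro zariski_open_Int open_chart[OF i] open_preimage opl)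
    have mem: "u \<in> \<Union>\<Omega> \<longleftrightarrow> u \<in> \<Union>(chart i) \<and> f u l \<noteq> 0" for u
    proof -
      have "u \<in> \<Union>\<Omega> \<longleftrightarrow> u \<in> \<Union>(chart i) \<and> u \<in> \<Union>(preimage 1 \<phi> (coord_open n l))"
        unfolding \<Omega>_def Union_Int_open[OF basic_open_subset zariski_open_subset[OF open_preimage[OF opl]]]
        by blast
      then show ?thesis
        unfolding mem_preimage[OF opl] cone_basic_open[OF form_var[OF l(1)]] using cone f_cone by blast
    qed
    have \<Omega>: "\<Omega> \<subseteq> chart i" "\<Omega> \<subseteq> proj_space 1" unfolding \<Omega>_def using basic_open_subset by auto
    have f\<Omega>: "(\<lambda>u. f u j) \<in> twist 1 (int e) \<Omega>" if "j \<le> n" for j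
      by (rule twist_restrict[OF f_twist[OF that] op \<Omega>(2)])
    have "(\<lambda>u. b u (ratio j l)) \<in> twist 1 (- 1) \<Omega>" if "j \<le> n" for j
      using b opl ratio_regular[OF that l(1)] unfolding pullback_tangent_def \<Omega>_def by blast
    then have v\<Omega>: "(\<lambda>u. v u l j) \<in> twist 1 (int e - 1) \<Omega>" if "j \<le> n" for j
      unfolding v_def using that by (intro twist_mult[OF f\<Omega>[OF l(1)] _ _ op]) auto
    have "(\<lambda>u. a j u * v u l j) \<in> twist 1 (- 1) \<Omega>" if "j \<le> n" for j
      by (rule twist_mult[OF twist_restrict[OF a(1)[OF that] op \<Omega>(1)] v\<Omega>[OF that] _ op]) simp
    then have "(\<lambda>u. \<Sum>j\<le>n. a j u * v u l j) \<in> twist 1 (- 1) \<Omega>"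
      by (intro twist_sum[OF op]) auto
    then have "(\<lambda>u. f u k * (\<Sum>j\<le>n. a j u * v u l j)) \<in> twist 1 (int e - 1) \<Omega>"
      by (rule twist_mult[OF f\<Omega>[OF k] _ _ op]) simp
    from twist_diff[OF v\<Omega>[OF k] this op] have "(\<lambda>u. W u l k) \<in> twist 1 (int e - 1) \<Omega>"
      unfolding W_def .
    then have "(\<lambda>u. w u k) \<in> twist 1 (int e - 1) \<Omega>"
      by (rule twist_cong) (use w mem l(1) k in auto)
    then show "\<exists>\<Omega>. u0 \<in> \<Union>\<Omega> \<and> \<Omega> \<subseteq> chart i \<and> (\<lambda>u. w u k) \<in> twist 1 (int e - 1) \<Omega>"
      using \<Omega>(1) mem u0 l(2) by blast
  qed
  moreover have "(\<Sum>k\<le>n. f u k ^ q * w u k) = 0" if u: "u \<in> \<Union>(chart i)" for u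
  proof -
    obtain l where l: "l \<le> n" "f u l \<noteq> 0" using f_nonzero[OF cone[OF u]] by blast
    define \<sigma> where "\<sigma> = (\<Sum>j\<le>n. a j u * v u l j)"
    have wk: "w u k = f u l * b u (ratio k l) - \<sigma> * f u k" if "k \<le> n" for k
      using w[OF u l that] by (simp add: W_def v_def \<sigma>_def mult.commute)
    \<comment> \<open>The tangent part vanishes by \<open>tangent_fermat\<close>, the multiple of
      \<open>f\<close> by the Fermat equation.\<close>
    have "(\<Sum>k\<le>n. f u k ^ q * w u k)
        = (\<Sum>k\<le>n. f u l * (f u k ^ q * b u (ratio k l)) - \<sigma> * (f u k ^ q * f u k))"
    proof (intro sum.cong refl)
      fix k assume "k \<in> {..n}"
      then have "k \<le> n" by simp
      show "f u k ^ q * w u k = f u l * (f u k ^ q * b u (ratio k l)) - \<sigma> * (f u k ^ q * f u k)"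
        unfolding wk[OF \<open>k \<le> n\<close>] by (simp add: algebra_simps)
    qed
    also have "\<dots> = f u l * (\<Sum>k\<le>n. f u k ^ q * b u (ratio k l)) - \<sigma> * (\<Sum>k\<le>n. f u k ^ q * f u k)"
      by (simp add: sum_subtractf sum_distrib_left)
    also have "\<dots> = 0"
      using tangent_fermat[OF D[OF u] f_cone[OF cone[OF u]] l] f_sum[OF cone[OF u]] by simp
    finally show ?thesis .
  qed
  moreover have "\<exists>c. \<forall>k\<le>n. w u k = f u l * b u (ratio k l) + c * f u k"
    if u: "u \<in> \<Union>(chart i)" and l: "l \<le> n" "f u l \<noteq> 0" for u l
    using w[OF u l] by (intro exI[of _ "- (\<Sum>j\<le>n. a j u * v u l j)"]) (auto simp: W_def v_def algebra_simps)
  ultimately show ?thesis by (intro exI[of _ w]) simp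
qed

text \<open>The converse of lifting: a vector field along the curve, of degree \<open>e - 1\<close>
  and in the kernel of the differential, gives a tangent section of degree
  \<open>- 1\<close>.\<close>

lemma dir_deriv_section:
  assumes U: "zariski_open 1 U"
    and V: "\<And>k. k \<le> n \<Longrightarrow> (\<lambda>u. V u k) \<in> twist 1 (int e - 1) U" "\<And>u k. k > n \<Longrightarrow> V u k = 0"
      "\<And>u. u \<in> \<Union>U \<Longrightarrow> (\<Sum>k\<le>n. f u k ^ q * V u k) = 0"
  shows "(\<lambda>u. dir_deriv n (f u) (V u)) \<in> pullback_tangent 1 n n (fermat_form q) \<phi> (- 1) U"
  unfolding pullback_tangent_def
proof (intro CollectI conjI ballI allI impI)
  fix u assume u: "u \<in> \<Union>U"
  then have cu: "u \<in> \<Union>(proj_space 1)" using zariski_open_subset[OF U] by blast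
  \<comment> \<open>The Fermat form along the arc, expanded by additivity of the q-th power. As
    \<open>q > 1\<close>, its linear coefficient is \<open>\<Sum> f u k ^ q * V u k\<close>.\<close>
  define P where "P = [:\<Sum>k\<le>n. f u k ^ q * f u k, \<Sum>k\<le>n. f u k ^ q * V u k:]
    + monom 1 q * [:\<Sum>k\<le>n. V u k ^ q * f u k, \<Sum>k\<le>n. V u k ^ q * V u k:]"
  have "fermat_form q (arc (f u) (V u) z) = poly P z" for z
  proof -
    have "fermat_form q (arc (f u) (V u) z)
        = (\<Sum>k\<le>n. (f u k ^ q + z ^ q * V u k ^ q) * (f u k + z * V u k))"
      unfolding fermat_sum add_power_q power_mult_distrib ..
    also have "\<dots> = (\<Sum>k\<le>n. f u k ^ q * f u k) + z * (\<Sum>k\<le>n. f u k ^ q * V u k)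
        + z ^ q * ((\<Sum>k\<le>n. V u k ^ q * f u k) + z * (\<Sum>k\<le>n. V u k ^ q * V u k))"
      unfolding sum_distrib_left sum.distrib[symmetric] by (intro sum.cong) (auto simp: algebra_simps)
    finally show ?thesis by (simp add: P_def poly_monom algebra_simps)
  qed
  moreover have "coeff P 0 = 0" "coeff P 1 = 0"
    using f_sum[OF cu] V(3)[OF u] q_gt_1 by (auto simp: P_def coeff_monom_mult)
  ultimately have "dir_deriv n (f u) (V u) \<in> tangent_space n n (fermat_form q) (line (f u))"
    by (intro dir_deriv_tangent[where P = P] f_cone[OF cu] V(2))
  then show "dir_deriv n (f u) (V u) \<in> tangent_space n n (fermat_form q) (\<phi> (line u))"
    using phi[OF cu] by simp
next
  fix V' and g :: "'k vec \<Rightarrow> 'k" assume "zariski_open n V' \<and> g \<in> regular n V'"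
  then have V': "zariski_open n V'" and g: "g \<in> regular n V'" by auto
  define \<Omega> where "\<Omega> = U \<inter> preimage 1 \<phi> V'"
  have op: "zariski_open 1 \<Omega>" unfolding \<Omega>_def by (intro zariski_open_Int U open_preimage V')
  have mem: "u \<in> \<Union>(proj_space 1)" "f u \<in> \<Union>V'" if "u \<in> \<Union>\<Omega>" for u
  proof -
    have "u \<in> \<Union>(preimage 1 \<phi> V')" using that unfolding \<Omega>_def by blast
    then show "u \<in> \<Union>(proj_space 1)" "f u \<in> \<Union>V'" unfolding mem_preimage[OF V'] by auto
  qed
  have "(\<lambda>u. arc_deriv (\<lambda>z. g (arc (f u) (V u) z))) \<in> twist 1 (- 1) \<Omega>"
  proof (rule arc_deriv_twist[OF g op, of f "int e"])
    show "(\<lambda>u. f u i) \<in> twist 1 (int e) \<Omega>" if "i \<le> n" for i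
      by (rule twist_restrict[OF f_twist[OF that] op zariski_open_subset[OF op]])
    show "(\<lambda>u. V u i) \<in> twist 1 (int e + - 1) \<Omega>" if "i \<le> n" for i
      using twist_restrict[OF V(1)[OF that] op] unfolding \<Omega>_def by simp
    show "f u i = 0" if "u \<in> \<Union>\<Omega>" "i > n" for u i
      using f_cone[OF mem(1)[OF that(1)]] that(2) unfolding cone_iff by blast
  qed (use mem(2) V(2) in auto)
  then have "(\<lambda>u. dir_deriv n (f u) (V u) g) \<in> twist 1 (- 1) \<Omega>"
  proof (rule twist_cong)
    fix u assume "u \<in> \<Union>\<Omega>"
    note m = mem[OF this]
    have "line (f u) \<in> V'"
      using m f_cone mem_Union_iff[OF zariski_open_subset[OF V'], of "f u"] by blast
    then have "g \<in> stalk n (line (f u))" using V' g unfolding stalk_def by blast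
    then show "arc_deriv (\<lambda>z. g (arc (f u) (V u) z)) = dir_deriv n (f u) (V u) g"
      by (simp add: dir_deriv_def)
  qed
  then show "(\<lambda>u. dir_deriv n (f u) (V u) g) \<in> twist 1 (- 1) (U \<inter> preimage 1 \<phi> V')"
    unfolding \<Omega>_def .
qed

text \<open>The quotient rule: lifting the directional derivative gives back \<open>w\<close> up to
  a multiple of \<open>x\<close>.\<close>

lemma dir_deriv_ratio:
  fixes x w :: "'k vec"
  assumes x: "x \<in> \<Union>(proj_space n)" and l: "l \<le> n" "x l \<noteq> 0" and k: "k \<le> n"
  shows "x l * dir_deriv n x w (ratio k l) = w k - (w l / x l) * x k"
proof -
  have "arc_rep (\<lambda>z. ratio k l (arc x w z)) [:x k, w k:] [:x l, w l:]"
    using l by (simp add: arc_rep_def)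
  from arc_deriv_eq[OF this] show ?thesis
    using ratio_stalk[OF k l(1) x l(2)] l by (simp add: dir_deriv_def field_simps)
qed

end

section \<open>The theorem\<close>

lemma chart_pt_simps: "i \<noteq> j \<Longrightarrow> chart_pt i j t i = 1" "i \<noteq> j \<Longrightarrow> chart_pt i j t j = t"
  by (auto simp: chart_pt_def)

context fermat_map begin

section \<open>Polynomial coordinates on the two charts\<close>

definition is_coords :: "nat \<Rightarrow> nat \<Rightarrow> (nat \<Rightarrow> 'k poly) \<Rightarrow> bool" where
  "is_coords i j F \<longleftrightarrow> (\<forall>k\<le>n. \<forall>u\<in>\<Union>(chart i). f u k = u i ^ e * poly (F k) (u j / u i))"

lemma is_coordsD:
  "is_coords i j F \<Longrightarrow> k \<le> n \<Longrightarrow> u \<in> \<Union>(chart i) \<Longrightarrow> f u k = u i ^ e * poly (F k) (u j / u i)"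
  unfolding is_coords_def by blast

lemma is_coords_exists:
  assumes "i \<le> 1" "j \<le> 1" "i \<noteq> j" shows "\<exists>F. is_coords i j F"
proof -
  have "\<exists>p. k \<le> n \<longrightarrow> (\<forall>u\<in>\<Union>(chart i). f u k = u i ^ e * poly p (u j / u i))" for k
  proof (cases "k \<le> n")
    case True
    have "(\<lambda>u. f u k) \<in> twist 1 (int e) (chart i)"
      by (rule twist_restrict[OF f_twist[OF True] open_chart[OF assms(1)] basic_open_subset])
    from twist_chart_poly[OF assms this] show ?thesis by simp
  qed simp
  then have "\<forall>k. \<exists>p. k \<le> n \<longrightarrow> (\<forall>u\<in>\<Union>(chart i). f u k = u i ^ e * poly p (u j / u i))" by (rule allI)
  from choice[OF this] show ?thesis unfolding is_coords_def by (elim exE) (intro exI)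
qed

context
  fixes i j F assumes ij: "i \<le> 1" "j \<le> 1" "i \<noteq> j" and F: "is_coords i j F"
begin

lemma chart_cone: "u \<in> \<Union>(chart i) \<Longrightarrow> u \<in> \<Union>(proj_space 1)"
  using cone_chart[OF ij(1)] by blast

lemma coords_at: "k \<le> n \<Longrightarrow> poly (F k) t = f (chart_pt i j t) k"
  using is_coordsD[OF F _ chart_pt_cone[OF ij, of t]] chart_pt_simps[OF ij(3), of t] by simp

lemma coords_nonzero: "\<exists>k\<le>n. poly (F k) t \<noteq> 0"
  using f_nonzero[OF chart_cone[OF chart_pt_cone[OF ij]], of t] coords_at by metis

lemma coords_sum: "(\<Sum>k\<le>n. F k ^ q * F k) = 0"
proof (rule poly_eq_0_of_dense[of 1])
  fix t
  have "poly (\<Sum>k\<le>n. F k ^ q * F k) t = (\<Sum>k\<le>n. f (chart_pt i j t) k ^ q * f (chart_pt i j t) k)"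
    unfolding poly_sum by (intro sum.cong) (auto simp: coords_at)
  then show "poly (\<Sum>k\<le>n. F k ^ q * F k) t = 0"
    using f_sum[OF chart_cone[OF chart_pt_cone[OF ij]]] by simp
qed simp

lemma coords_swap:
  assumes F': "is_coords j i F'" and "k \<le> n" "t \<noteq> 0"
  shows "poly (F k) t = t ^ e * poly (F' k) (inverse t)"
proof -
  define u where "u = chart_pt i j t"
  have u: "u i = 1" "u j = t" using chart_pt_simps[OF ij(3)] by (auto simp: u_def)
  have "u \<in> \<Union>(chart j)"
    unfolding cone_chart[OF ij(2)] using chart_cone[OF chart_pt_cone[OF ij]] u assms(3) by (simp add: u_def)
  then have "f u k = u j ^ e * poly (F' k) (u i / u j)" by (rule is_coordsD[OF F' assms(2)])
  then show ?thesis using coords_at[OF assms(2), of t] u by (simp add: u_def inverse_eq_divide)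
qed

text \<open>The coordinates are polynomial on both charts, which bounds their degree by
  \<open>e\<close>.\<close>

lemma coords_degree:
  assumes "k \<le> n" "l > e" shows "coeff (F k) l = 0"
proof (cases "F k = 0")
  case False
  obtain F' where F': "is_coords j i F'" using is_coords_exists[of j i] ij by blast
  have "poly (F k) t = t powi int e * poly (F' k) (inverse t)" if "t \<noteq> 0" for t
    using coords_swap[OF F' assms(1) that] by simp
  from degree_le_of_reflected[OF this False] assms(2) show ?thesis by (intro coeff_eq_0) simp
qed simp

text \<open>Bezout coefficients of the coordinates, homogenised to degree \<open>- e\<close>,
  provide the normalisation that \<open>lift_section\<close> asks for.\<close>

lemma lift_section_poly:
  assumes b: "b \<in> pullback_tangent 1 n n (fermat_form q) \<phi> (- 1) (chart i)"
  shows "\<exists>P. (\<Sum>k\<le>n. F k ^ q * P k) = 0 \<and>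
    (\<forall>u\<in>\<Union>(chart i). \<forall>l\<le>n. f u l \<noteq> 0 \<longrightarrow> (\<exists>c. \<forall>k\<le>n.
      u i powi (int e - 1) * poly (P k) (u j / u i) = f u l * b u (ratio k l) + c * f u k))"
proof -
  obtain A where A: "(\<Sum>k\<le>n. A k * F k) = 1" using poly_bezout[of n F] coords_nonzero by blast
  define a where "a k u = u i powi (- int e) * poly (A k) (u j / u i)" for k and u :: "'k vec"
  have a1: "a k \<in> twist 1 (- int e) (chart i)" for k
    unfolding a_def by (rule poly_chart_twist[OF ij(1,2)])
  have a2: "(\<Sum>k\<le>n. a k u * f u k) = 1" if u: "u \<in> \<Union>(chart i)" for u
  proof -
    have ui: "u i \<noteq> 0" using u cone_chart[OF ij(1)] by blast
    have "(\<Sum>k\<le>n. a k u * f u k) = (\<Sum>k\<le>n. poly (A k) (u j / u i) * poly (F k) (u j / u i))"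
    proof (intro sum.cong refl)
      fix k assume "k \<in> {..n}"
      then have "f u k = u i ^ e * poly (F k) (u j / u i)" by (intro is_coordsD[OF F _ u]) simp
      then show "a k u * f u k = poly (A k) (u j / u i) * poly (F k) (u j / u i)"
        using ui by (simp add: a_def power_int_minus field_simps)
    qed
    also have "\<dots> = poly (\<Sum>k\<le>n. A k * F k) (u j / u i)" by (simp add: poly_sum)
    finally show ?thesis unfolding A by simp
  qed
  obtain w where w: "\<And>k. k \<le> n \<Longrightarrow> (\<lambda>u. w u k) \<in> twist 1 (int e - 1) (chart i)"
    "\<And>u. u \<in> \<Union>(chart i) \<Longrightarrow> (\<Sum>k\<le>n. f u k ^ q * w u k) = 0"
    "\<And>u l. u \<in> \<Union>(chart i) \<Longrightarrow> l \<le> n \<Longrightarrow> f u l \<noteq> 0 \<Longrightarrow>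
      \<exists>c. \<forall>k\<le>n. w u k = f u l * b u (ratio k l) + c * f u k"
    using lift_section[OF ij(1) b a1 a2] by blast
  have "\<exists>p. k \<le> n \<longrightarrow> (\<forall>u\<in>\<Union>(chart i). w u k = u i powi (int e - 1) * poly p (u j / u i))" for k
    using twist_chart_poly[OF ij w(1), of k] by (cases "k \<le> n") auto
  then have "\<forall>k. \<exists>p. k \<le> n \<longrightarrow> (\<forall>u\<in>\<Union>(chart i). w u k = u i powi (int e - 1) * poly p (u j / u i))"
    by (rule allI)
  from choice[OF this] obtain P where
    P: "\<And>k u. k \<le> n \<Longrightarrow> u \<in> \<Union>(chart i) \<Longrightarrow> w u k = u i powi (int e - 1) * poly (P k) (u j / u i)"
    by blast
  have "(\<Sum>k\<le>n. F k ^ q * P k) = 0"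
  proof (rule poly_eq_0_of_dense[of 1])
    fix t
    note c = chart_pt_cone[OF ij, of t]
    have "poly (\<Sum>k\<le>n. F k ^ q * P k) t = (\<Sum>k\<le>n. f (chart_pt i j t) k ^ q * w (chart_pt i j t) k)"
      unfolding poly_sum
      by (intro sum.cong) (auto simp: coords_at P[OF _ c] chart_pt_simps[OF ij(3)])
    then show "poly (\<Sum>k\<le>n. F k ^ q * P k) t = 0" using w(2)[OF c] by simp
  qed simp
  moreover have "\<exists>c. \<forall>k\<le>n. u i powi (int e - 1) * poly (P k) (u j / u i) = f u l * b u (ratio k l) + c * f u k"
    if u: "u \<in> \<Union>(chart i)" "l \<le> n" "f u l \<noteq> 0" for u l
  proof -
    obtain c where "\<forall>k\<le>n. w u k = f u l * b u (ratio k l) + c * f u k" using w(3)[OF u] by blast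
    then show ?thesis using P[OF _ u(1)] by (intro exI[of _ c]) simp
  qed
  ultimately show ?thesis by (intro exI[of _ P]) simp
qed

text \<open>The q-th power of a Bezout identity is one for the \<open>F k ^ q\<close>, so every
  \<open>h\<close> is reached on a chart. The other clauses express this by homogeneous sections of
  degree \<open>e - 1\<close>.\<close>

lemma local_solution:
  "\<exists>B. (\<Sum>k\<le>n. F k ^ q * B k) = h \<and>
    (\<forall>k. (\<lambda>u. u i powi (int e - 1) * poly (B k) (u j / u i)) \<in> twist 1 (int e - 1) (chart i)) \<and>
    (\<forall>u\<in>\<Union>(chart i). (\<Sum>k\<le>n. f u k ^ q * (u i powi (int e - 1) * poly (B k) (u j / u i)))
      = u i ^ (q * e + e - 1) * poly h (u j / u i))"
proof -
  obtain A where A: "(\<Sum>k\<le>n. A k * F k) = 1" using poly_bezout[of n F] coords_nonzero by blast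
  have "(\<Sum>k\<le>n. A k * F k) ^ q = (\<Sum>k\<le>n. (A k * F k) ^ q)"
    using freshmans_dream_sum'[where 'a="'k poly"] prime_char q_eq by simp
  then have Aq: "(\<Sum>k\<le>n. A k ^ q * F k ^ q) = 1" unfolding A by (simp add: power_mult_distrib)
  define B where "B k = A k ^ q * h" for k
  have "(\<Sum>k\<le>n. F k ^ q * B k) = (\<Sum>k\<le>n. A k ^ q * F k ^ q) * h"
    unfolding sum_distrib_right B_def by (simp add: mult_ac)
  then have B: "(\<Sum>k\<le>n. F k ^ q * B k) = h" unfolding Aq by simp
  show ?thesis
  proof (intro exI[of _ B] conjI allI ballI)
    show "(\<Sum>k\<le>n. F k ^ q * B k) = h" by (rule B)
    show "(\<lambda>u. u i powi (int e - 1) * poly (B k) (u j / u i)) \<in> twist 1 (int e - 1) (chart i)" for k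
      by (rule poly_chart_twist[OF ij(1,2)])
    fix u :: "'k vec" assume u: "u \<in> \<Union>(chart i)"
    obtain d where d: "e = Suc d" using e_pos by (cases e) auto
    have "(\<Sum>k\<le>n. f u k ^ q * (u i powi (int e - 1) * poly (B k) (u j / u i)))
        = (\<Sum>k\<le>n. u i ^ (q * e + e - 1) * poly (F k ^ q * B k) (u j / u i))"
    proof (intro sum.cong refl)
      fix k assume "k \<in> {..n}"
      then have "f u k = u i ^ e * poly (F k) (u j / u i)" by (intro is_coordsD[OF F _ u]) simp
      moreover have "u i powi (int e - 1) = u i ^ d" by (simp add: d power_int_def)
      moreover have "u i ^ (q * e + e - 1) = (u i ^ e) ^ q * u i ^ d"
      proof -
        have "q * e + e - 1 = e * q + d" by (simp add: d mult.commute)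
        then show ?thesis by (simp only: power_add power_mult)
      qed
      ultimately show "f u k ^ q * (u i powi (int e - 1) * poly (B k) (u j / u i))
          = u i ^ (q * e + e - 1) * poly (F k ^ q * B k) (u j / u i)"
        by (simp add: power_mult_distrib)
    qed
    also have "\<dots> = u i ^ (q * e + e - 1) * poly (\<Sum>k\<le>n. F k ^ q * B k) (u j / u i)"
      by (simp add: poly_sum sum_distrib_left)
    finally show "(\<Sum>k\<le>n. f u k ^ q * (u i powi (int e - 1) * poly (B k) (u j / u i)))
      = u i ^ (q * e + e - 1) * poly h (u j / u i)" unfolding B .
  qed
qed

end

text \<open>The local solutions \<open>B\<close> and \<open>B'\<close> differ by a vector field
  \<open>V\<close> in the kernel of the differential, hence by a cocycle of tangent vectors.
  Freeness writes it as \<open>b - a\<close>. With lifts \<open>P\<close> of \<open>a\<close> and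
  \<open>P'\<close> of \<open>b\<close>, the corrected solutions \<open>B - P\<close> and
  \<open>B' - P'\<close> agree up to multiples of the coordinates, and these can be removed.\<close>

lemma global_solution:
  assumes free: "free_morphism n n (fermat_form q) \<phi>" and F: "is_coords 0 1 F"
    and h: "degree h \<le> q * e + e - 1"
  shows "\<exists>v. (\<forall>k\<le>n. \<forall>l\<ge>e. coeff (v k) l = 0) \<and> (\<Sum>k\<le>n. F k ^ q * v k) = h"
proof -
  have ij: "(0::nat) \<le> 1" "(1::nat) \<le> 1" "(0::nat) \<noteq> 1" "(1::nat) \<noteq> 0" by auto
  note c0 = ij(1,2,3) F
  obtain F' where F': "is_coords 1 0 F'" using is_coords_exists[OF ij(2,1,4)] by blast
  note c1 = ij(2,1,4) F'
  define h' where "h' = reverse_to (q * e + e - 1) h"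
  obtain B where B: "(\<Sum>k\<le>n. F k ^ q * B k) = h"
    "\<forall>k. (\<lambda>u. u 0 powi (int e - 1) * poly (B k) (u 1 / u 0)) \<in> twist 1 (int e - 1) (chart 0)"
    "\<forall>u\<in>\<Union>(chart 0). (\<Sum>k\<le>n. f u k ^ q * (u 0 powi (int e - 1) * poly (B k) (u 1 / u 0)))
      = u 0 ^ (q * e + e - 1) * poly h (u 1 / u 0)"
    using local_solution[OF c0, of h] by (elim exE conjE)
  obtain B' where B': "(\<Sum>k\<le>n. F' k ^ q * B' k) = h'"
    "\<forall>k. (\<lambda>u. u 1 powi (int e - 1) * poly (B' k) (u 0 / u 1)) \<in> twist 1 (int e - 1) (chart 1)"
    "\<forall>u\<in>\<Union>(chart 1). (\<Sum>k\<le>n. f u k ^ q * (u 1 powi (int e - 1) * poly (B' k) (u 0 / u 1)))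
      = u 1 ^ (q * e + e - 1) * poly h' (u 0 / u 1)"
    using local_solution[OF c1, of h'] by (elim exE conjE)
  define V where "V u k = (if k \<le> n then u 1 powi (int e - 1) * poly (B' k) (u 0 / u 1)
    - u 0 powi (int e - 1) * poly (B k) (u 1 / u 0) else 0)" for u :: "'k vec" and k
  define U where "U = (chart 0 \<inter> chart 1 :: 'k point set)"
  have op: "zariski_open 1 (chart 0 :: 'k point set)" "zariski_open 1 (chart 1 :: 'k point set)"
    "zariski_open 1 U" using zariski_open_Int open_chart unfolding U_def by auto
  have cover: "chart 0 \<union> chart 1 = (proj_space 1 :: 'k point set)"
  proof (intro equalityI subsetI)
    fix y :: "'k point" assume y: "y \<in> proj_space 1"
    then obtain u where u: "y = line u" "u \<in> \<Union>(proj_space 1)" using line_self unfolding proj_space_def by blast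
    have "u 0 \<noteq> 0 \<or> u 1 \<noteq> 0"
      using u(2) unfolding cone_iff by (metis One_nat_def less_one linorder_neqE_nat)
    then show "y \<in> chart 0 \<union> chart 1" using u unfolding basic_open_def by blast
  qed (use basic_open_subset in blast)
  have memU: "u \<in> \<Union>(chart 0)" "u \<in> \<Union>(chart 1)" if "u \<in> \<Union>U" for u using that unfolding U_def by auto
  have Vsec: "(\<lambda>u. V u k) \<in> twist 1 (int e - 1) U" if "k \<le> n" for k
    using twist_diff[OF twist_restrict[OF B'(2)[rule_format, of k] op(3)]
        twist_restrict[OF B(2)[rule_format, of k] op(3)] op(3)] that
    by (simp add: V_def U_def)
  have Vsum: "(\<Sum>k\<le>n. f u k ^ q * V u k) = 0" if u: "u \<in> \<Union>U" for u
  proof -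
    have nz: "u 0 \<noteq> 0" "u 1 \<noteq> 0" using memU[OF u] cone_chart[of 0] cone_chart[of 1] by auto
    have "(\<Sum>k\<le>n. f u k ^ q * V u k) = u 1 ^ (q * e + e - 1) * poly h' (u 0 / u 1)
        - u 0 ^ (q * e + e - 1) * poly h (u 1 / u 0)"
      unfolding B(3)[rule_format, OF memU(1)[OF u], symmetric]
        B'(3)[rule_format, OF memU(2)[OF u], symmetric] sum_subtractf[symmetric]
      by (intro sum.cong) (auto simp: V_def right_diff_distrib)
    also have "poly h' (u 0 / u 1) = (u 0 / u 1) ^ (q * e + e - 1) * poly h (u 1 / u 0)"
      unfolding h'_def using poly_reverse_to[OF h, of "u 0 / u 1"] nz by simp
    finally show ?thesis using nz by (simp add: power_divide)
  qed
  have s: "(\<lambda>u. dir_deriv n (f u) (V u)) \<in> pullback_tangent 1 n n (fermat_form q) \<phi> (- 1) U"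
    by (rule dir_deriv_section[OF op(3) Vsec _ Vsum]) (auto simp: V_def)
  have "\<exists>a\<in>pullback_tangent 1 n n (fermat_form q) \<phi> (- 1) (chart 0).
      \<exists>b\<in>pullback_tangent 1 n n (fermat_form q) \<phi> (- 1) (chart 1).
      \<forall>u\<in>\<Union>(chart 0 \<inter> chart 1). dir_deriv n (f u) (V u) = b u - a u"
    using cech_two_charts[OF free[unfolded free_morphism_def] op(1,2) cover
        s[unfolded U_def] pullback_tangent_uminus[OF mor op(3) s, unfolded U_def]
        pullback_tangent_zero[OF mor op(1)] pullback_tangent_zero[OF mor op(2)]] .
  then obtain a b where a: "a \<in> pullback_tangent 1 n n (fermat_form q) \<phi> (- 1) (chart 0)"
    and b: "b \<in> pullback_tangent 1 n n (fermat_form q) \<phi> (- 1) (chart 1)"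
    and ab: "\<And>u. u \<in> \<Union>U \<Longrightarrow> dir_deriv n (f u) (V u) = b u - a u" unfolding U_def by blast
  obtain P where P: "(\<Sum>k\<le>n. F k ^ q * P k) = 0"
    "\<And>u l. u\<in>\<Union>(chart 0) \<Longrightarrow> l \<le> n \<Longrightarrow> f u l \<noteq> 0 \<Longrightarrow> \<exists>c. \<forall>k\<le>n.
      u 0 powi (int e - 1) * poly (P k) (u 1 / u 0) = f u l * a u (ratio k l) + c * f u k"
    using lift_section_poly[OF c0 a] by blast
  obtain P' where P': "(\<Sum>k\<le>n. F' k ^ q * P' k) = 0"
    "\<And>u l. u\<in>\<Union>(chart 1) \<Longrightarrow> l \<le> n \<Longrightarrow> f u l \<noteq> 0 \<Longrightarrow> \<exists>c. \<forall>k\<le>n.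
      u 1 powi (int e - 1) * poly (P' k) (u 0 / u 1) = f u l * b u (ratio k l) + c * f u k"
    using lift_section_poly[OF c1 b] by blast
  obtain A where A: "(\<Sum>k\<le>n. A k * F k) = 1" using poly_bezout[of n F] coords_nonzero[OF c0] by blast
  have "\<exists>\<kappa>. \<forall>k\<le>n. \<forall>l\<ge>e. coeff (B k - P k + \<kappa> * F k) l = 0"
  proof (rule glue_modulo_multiple[OF e_pos coords_swap[OF c0 F'] A])
    fix t :: 'k assume t: "t \<noteq> 0"
    define u where "u = chart_pt 0 1 t"
    have u01: "u 0 = 1" "u 1 = t" by (auto simp: u_def chart_pt_simps)
    have u0: "u \<in> \<Union>(chart 0)" unfolding u_def by (rule chart_pt_cone[OF ij(1,2,3)])
    then have cu: "u \<in> \<Union>(proj_space 1)" by (rule chart_cone[OF c0])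
    have u1: "u \<in> \<Union>(chart 1)" unfolding cone_chart[OF ij(2)] using cu u01 t by simp
    have uU: "u \<in> \<Union>U"
      unfolding U_def Union_Int_open[OF basic_open_subset basic_open_subset] using u0 u1 by blast
    obtain l where l: "l \<le> n" "f u l \<noteq> 0" using f_nonzero[OF cu] by blast
    obtain c where c: "\<And>k. k \<le> n \<Longrightarrow> poly (P k) t = f u l * a u (ratio k l) + c * f u k"
      using P(2)[OF u0 l] u01 by auto
    have te: "t powi (int e - 1) = t ^ (e - 1)" using e_pos by (simp add: power_int_def nat_diff_distrib)
    obtain c' where c': "\<And>k. k \<le> n \<Longrightarrow> t ^ (e - 1) * poly (P' k) (inverse t) = f u l * b u (ratio k l) + c' * f u k"
      using P'(2)[OF u1 l] u01 te by (auto simp: inverse_eq_divide)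
    \<comment> \<open>The lifts \<open>P\<close> and \<open>P'\<close> contribute \<open>c\<close>
      and \<open>c'\<close>; lifting the directional derivative along \<open>V\<close> gives
      \<open>V\<close> only up to \<open>V u l / f u l\<close> times \<open>f u\<close>.\<close>
    show "\<exists>c. \<forall>k\<le>n. t ^ (e - 1) * poly (B' k - P' k) (inverse t) - poly (B k - P k) t = c * poly (F k) t"
    proof (intro exI[of _ "V u l / f u l - c' + c"] allI impI)
      fix k assume k: "k \<le> n"
      have "V u k = t ^ (e - 1) * poly (B' k) (inverse t) - poly (B k) t"
        using k u01 te by (simp add: V_def inverse_eq_divide)
      moreover have "f u l * (b u (ratio k l) - a u (ratio k l)) = V u k - V u l / f u l * f u k"
        using dir_deriv_ratio[OF f_cone[OF cu] l k, of "V u"] ab[OF uU] by simp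
      moreover have "poly (F k) t = f u k" using coords_at[OF c0 k] by (simp add: u_def)
      ultimately show "t ^ (e - 1) * poly (B' k - P' k) (inverse t) - poly (B k - P k) t
          = (V u l / f u l - c' + c) * poly (F k) t"
        using c[OF k] c'[OF k] by (simp add: algebra_simps)
    qed
  qed
  then obtain \<kappa> where \<kappa>: "\<forall>k\<le>n. \<forall>l\<ge>e. coeff (B k - P k + \<kappa> * F k) l = 0" by blast
  \<comment> \<open>Adding \<open>\<kappa> * F\<close> leaves the image unchanged, by the Fermat
    equation.\<close>
  have "(\<Sum>k\<le>n. F k ^ q * (B k - P k + \<kappa> * F k))
      = (\<Sum>k\<le>n. F k ^ q * B k) - (\<Sum>k\<le>n. F k ^ q * P k) + \<kappa> * (\<Sum>k\<le>n. F k ^ q * F k)"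
    unfolding sum_distrib_left sum_subtractf[symmetric] sum.distrib[symmetric]
    by (intro sum.cong) (auto simp: algebra_simps)
  also have "\<dots> = h" using B(1) P(1) coords_sum[OF c0] by simp
  finally show ?thesis using \<kappa> by (intro exI[of _ "\<lambda>k. B k - P k + \<kappa> * F k"]) simp
qed

end

text \<open>Comparing the two charts for \<open>e \<le> 0\<close> shows that the coordinates are
  constants, and zero if \<open>e < 0\<close>; so \<open>f\<close>, and with it
  \<open>\<phi>\<close>, would be constant.\<close>

lemma positive_degree:
  fixes \<phi> :: "'k::alg_closed_field point \<Rightarrow> 'k point"
  assumes f: "\<And>i. i \<le> n \<Longrightarrow> (\<lambda>u. f u i) \<in> twist 1 e (proj_space 1)"
    "\<And>u. u \<in> \<Union>(proj_space 1) \<Longrightarrow> f u \<in> \<Union>(proj_space n)"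
    "\<And>u. u \<in> \<Union>(proj_space 1) \<Longrightarrow> \<phi> (line u) = line (f u)"
    and nonconst: "\<exists>y\<in>proj_space 1. \<exists>z\<in>proj_space 1. \<phi> y \<noteq> \<phi> z"
  shows "e > 0"
proof (rule ccontr)
  assume e: "\<not> e > 0"
  have coords: "\<exists>p p'. \<forall>u\<in>\<Union>(proj_space 1). (u 0 \<noteq> 0 \<longrightarrow> f u i = u 0 powi e * poly p (u 1 / u 0)) \<and>
      (u 1 \<noteq> 0 \<longrightarrow> f u i = u 1 powi e * poly p' (u 0 / u 1))" if i: "i \<le> n" for i
  proof -
    have *: "(\<lambda>u. f u i) \<in> twist 1 e (chart j)" if "j \<le> 1" for j
      by (rule twist_restrict[OF f(1)[OF i] open_chart[OF that] basic_open_subset])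
    obtain p where p: "\<forall>u\<in>\<Union>(chart 0). f u i = u 0 powi e * poly p (u 1 / u 0)"
      using twist_chart_poly[OF _ _ _ *[of 0], of 1] by auto
    obtain p' where p': "\<forall>u\<in>\<Union>(chart 1). f u i = u 1 powi e * poly p' (u 0 / u 1)"
      using twist_chart_poly[OF _ _ _ *[of 1], of 0] by auto
    show ?thesis
    proof (rule exI[of _ p], rule exI[of _ p'], intro ballI conjI impI)
      fix u :: "'k vec" assume u: "u \<in> \<Union>(proj_space 1)"
      show "f u i = u 0 powi e * poly p (u 1 / u 0)" if "u 0 \<noteq> 0"
        using p cone_chart[OF zero_le_one, of u] u that by blast
      show "f u i = u 1 powi e * poly p' (u 0 / u 1)" if "u 1 \<noteq> 0"
        using p' cone_chart[OF order_refl, of u] u that by blast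
    qed
  qed
  have const: "\<exists>c. \<forall>u\<in>\<Union>(proj_space 1). f u i = (if e = 0 then c else 0)" if i: "i \<le> n" for i
  proof -
    obtain p p' where p: "\<And>u. u\<in>\<Union>(proj_space 1) \<Longrightarrow> u 0 \<noteq> 0 \<Longrightarrow> f u i = u 0 powi e * poly p (u 1 / u 0)"
      "\<And>u. u\<in>\<Union>(proj_space 1) \<Longrightarrow> u 1 \<noteq> 0 \<Longrightarrow> f u i = u 1 powi e * poly p' (u 0 / u 1)"
      using coords[OF i] by blast
    have pp: "poly p t = t powi e * poly p' (inverse t)" if t: "t \<noteq> 0" for t
    proof -
      have "chart_pt 0 1 t \<in> \<Union>(chart 0)" by (rule chart_pt_cone) auto
      then have "chart_pt 0 1 t \<in> \<Union>(proj_space 1)" using basic_open_subset by blast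
      then show ?thesis
        using p[of "chart_pt 0 1 t"] t by (simp add: chart_pt_simps inverse_eq_divide)
    qed
    have pp': "poly p' t = t powi e * poly p (inverse t)" if t: "t \<noteq> 0" for t
      using pp[of "inverse t"] t by (simp add: power_int_inverse flip: power_int_mult_distrib)
    have deg: "p = 0 \<or> (degree p = 0 \<and> e = 0)" "p' = 0 \<or> (degree p' = 0 \<and> e = 0)"
      using degree_le_of_reflected[OF pp] degree_le_of_reflected[OF pp'] e by fastforce+
    obtain c where pc: "p = [:c:]" using deg(1) degree_eq_zeroE[of p] by (metis pCons_0_0)
    obtain c' where pc': "p' = [:c':]" using deg(2) degree_eq_zeroE[of p'] by (metis pCons_0_0)
    have "f u i = (if e = 0 then c else 0)" if u: "u \<in> \<Union>(proj_space 1)" for u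
    proof -
      have u01: "u 0 \<noteq> 0 \<or> u 1 \<noteq> 0"
        using u unfolding cone_iff by (metis One_nat_def less_one linorder_neqE_nat)
      show ?thesis
      proof (cases "e = 0")
        case True
        then have "c = c'" using pp[of 1] unfolding pc pc' by simp
        then show ?thesis using p[OF u] u01 True unfolding pc pc' by auto
      next
        case False
        then have "p = 0" "p' = 0" using deg by auto
        then show ?thesis using p[OF u] False u01 by auto
      qed
    qed
    then show ?thesis by blast
  qed
  obtain y z where yz: "y \<in> proj_space 1" "z \<in> proj_space 1" "\<phi> y \<noteq> \<phi> z" using nonconst by blast
  then obtain u w where u: "y = line u" "u \<in> \<Union>(proj_space 1)" and w: "z = line w" "w \<in> \<Union>(proj_space 1)"
    using line_self unfolding proj_space_def by blast
  have "f u i = f w i" for i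
  proof (cases "i \<le> n")
    case True
    then show ?thesis using const[OF True] u w by metis
  next
    case False
    then show ?thesis using f(2)[OF u(2)] f(2)[OF w(2)] unfolding cone_iff by simp
  qed
  then have "f u = f w" by blast
  then show False using yz(3) f(3) u w by simp
qed

theorem mainTheorem2:
  fixes \<phi> :: "'k::alg_closed_field point \<Rightarrow> 'k point"
    and p q \<nu> :: nat and e m r :: int
  assumes "CHAR('k) = p" and "p > 0"
    and "\<nu> \<ge> 1" and "q = p ^ \<nu>"
    and "morphism_to_hypersurface 1 (q + 1) (fermat_form q) \<phi>"
    and "\<exists>y\<in>proj_space 1. \<exists>z\<in>proj_space 1. \<phi> y \<noteq> \<phi> z"
    and "has_degree (q + 1) \<phi> e"
    and "e = m * int q + r" and "0 \<le> r" and "r \<le> int q - 1"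
    and "free_morphism (q + 1) (q + 1) (fermat_form q) \<phi>"
  shows "(r > 0 \<longrightarrow> int q + 1 \<le> m\<^sup>2 + m + r) \<and> (r = 0 \<longrightarrow> int q \<le> m\<^sup>2 + m)"
proof -
  have prime: "prime CHAR('k)" using assms(1,2) by (intro prime_CHAR_semidom) simp
  have mor: "proj_morphism 1 (q + 1) \<phi>" and im: "\<forall>y\<in>proj_space 1. \<phi> y \<in> hypersurface (q + 1) (fermat_form q)"
    using assms(5) unfolding morphism_to_hypersurface_def by auto
  obtain s where s: "s \<in> pullback_twist 1 (q + 1) \<phi> 1 (- e) (proj_space 1)"
    "\<And>u v. u \<in> \<Union>(proj_space 1) \<Longrightarrow> v \<in> \<phi> (line u) \<Longrightarrow> s u v \<noteq> 0"
    using assms(7) unfolding has_degree_def by blast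
  obtain f where f: "\<And>i. i \<le> q + 1 \<Longrightarrow> (\<lambda>u. f u i) \<in> twist 1 e (proj_space 1)"
    "\<And>u. u \<in> \<Union>(proj_space 1) \<Longrightarrow> f u \<in> \<Union>(proj_space (q + 1))"
    "\<And>u. u \<in> \<Union>(proj_space 1) \<Longrightarrow> \<phi> (line u) = line (f u)"
    using degree_coordinates[OF mor s] by blast
  have e: "e > 0" by (rule positive_degree[OF f assms(6)])
  have fermat_f: "fermat_form q (f u) = 0" if "u \<in> \<Union>(proj_space 1)" for u
    using im line_in_proj_space[OF that] f(3)[OF that] line_self unfolding hypersurface_def by fastforce
  interpret fermat_map q \<nu> "TYPE('k)" \<phi> f "nat e" "q + 1"
    using prime assms(1,3,4) mor f fermat_f e by unfold_locales auto
  obtain F where F: "is_coords 0 1 F" using is_coords_exists[of 0 1] by auto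
  \<comment> \<open>Otherwise \<open>e \<le> - q + (q - 1)\<close>, which is negative.\<close>
  have m: "m \<ge> 0"
  proof (rule ccontr)
    assume "\<not> m \<ge> 0"
    then have "m * int q \<le> - 1 * int q" by (intro mult_right_mono) auto
    then show False using assms(8,10) e by linarith
  qed
  \<comment> \<open>On the chart where \<open>u 0 \<noteq> 0\<close>, freeness enters through the
    condition \<open>surj\<close>; the rest of the argument concerns polynomials alone.\<close>
  interpret fermat_curve q \<nu> "TYPE('k)" F "nat e" "nat m" "nat r"
  proof unfold_locales
    have "e = int (nat m * q + nat r)" using m assms(8,9) by simp
    then show "nat e = nat m * q + nat r" by (metis nat_int)
    show "nat r < q" using assms(9,10) by linarith
    show "coeff (F i) k = 0" if "i \<le> q + 1" "k > nat e" for i k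
      by (rule coords_degree[OF _ _ _ F that]) auto
    show "(\<Sum>i\<le>q+1. F i ^ (q + 1)) = 0" using coords_sum[OF _ _ _ F] by (simp add: mult.commute)
    show "\<exists>v. (\<forall>i\<le>q+1. \<forall>k\<ge>nat e. coeff (v i) k = 0) \<and> (\<Sum>i\<le>q+1. F i ^ q * v i) = h"
      if "degree h \<le> q * nat e + nat e - 1" for h
      by (rule global_solution[OF assms(11) F that])
  qed (use e in simp)
  have "(nat r > 0 \<longrightarrow> int (q + 1) \<le> int ((nat m)\<^sup>2 + nat m + nat r)) \<and>
      (nat r = 0 \<longrightarrow> int q \<le> int ((nat m)\<^sup>2 + nat m))"
    using numerical_bound by (metis of_nat_le_iff)
  then show ?thesis using m assms(9) by (auto simp: add.commute)
qed

end
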